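(* Let $\tau>0$, $1\le p<\infty$, $c_p:=\big(1-\frac1{2p}\big)\big(\frac2p\big)^{\frac1{2p-1}}$, and let $\lambda_0,\lambda\in L^\infty(\mathbb{R})$. Assume that there exist a number $\alpha_0>0$ and a function $\beta_0\in L^p(\mathbb{R})$ such that $$\lambda_0(x)\ge\alpha_0-\beta_0(x)\quad\text{for a.e. }x\in\mathbb{R},\qquad\|\beta_0\|_p<\Big(\frac{\alpha_0}{c_p}\Big)^{1-\frac1{2p}}.$$ Assume that there exist a positive constant $\alpha$ and a function $\beta\in L^p(\mathbb{R})$ (same $p$) such that $$\frac{e^\tau+1}{2}|\lambda(x)|\le\alpha+\beta(x)\quad\text{for a.e. }x\in\mathbb{R}$$ with $$0\le\alpha<\alpha_0\quad\text{and}\quad\|\beta_0+\beta\|_p<\Big(\frac{\alpha_0-\alpha}{c_p}\Big)^{1-\frac1{2p}}.$$ Then the problem $$\begin{cases} u_t(x,t)+u_{xxx}(x,t)-u_{xx}(x,t)+\lambda_0(x)u(x,t)+\lambda(x)u(x,t-\tau)+u(x,t)u_x(x,t)=0 & \text{in } \mathbb{R}\times(0,\infty),\\ u(x,s)=u_0(x,s) & \text{in } \mathbb{R}\times[-\tau,0] \end{cases}$$ is exponentially stable. In particular, for every $u_0\in C([-\tau,0];L^2(\mathbb{R}))$ the solution $u$ satisfies $$\mathcal{E}(t)\le C(u_0)e^{-\tilde\gamma t}\quad\text{for all }t\ge0,$$ where $$\tilde\gamma=\min\Big\{2\Big(\alpha_0-\alpha-\frac{2p-1}{2p}\Big(\frac2p\Big)^{\frac1{2p-1}}\|\beta+\beta_0\|_p^{\frac{2p}{2p-1}}\Big),\,1\Big\}$$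 and $$C(u_0)=\mathcal{E}(0)=\frac12\|u_0(\cdot,0)\|_2^2+\frac12\int_{-\tau}^0e^s\int_{\mathbb{R}}|\lambda(x)|u_0^2(x,s)\,dx\,ds.$$
   Context: All functions are real-valued; $\|\cdot\|_p$ is the norm of $L^p(\mathbb{R})$. For $t\ge0$, $$\mathcal{E}(t):=\frac12\int_{\mathbb{R}}u^2(x,t)\,dx+\frac12\int_{t-\tau}^t\int_{\mathbb{R}}e^{-(t-s)}|\lambda(x)|u^2(x,s)\,dx\,ds,$$ where $u=u_0$ on $[-\tau,0]$. The operator $A_{\lambda_0}u:=-u_{xxx}+u_{xx}-\lambda_0u$, $\mathcal{D}(A_{\lambda_0})=H^3(\mathbb{R})$, generates a strongly continuous semigroup $(S(t))_{t\ge0}$ in $L^2(\mathbb{R})$ (known). For $T>0$, $\mathcal{B}_T:=C([0,T];L^2(\mathbb{R}))\cap L^2(0,T;H^1(\mathbb{R}))$. A mild solution on $[0,T]$ is a function $u\in\mathcal{B}_T$ (extended by $u=u_0$ on $[-\tau,0]$, with $u(0)=u_0(0)$) such that $$u(t)=S(t)u_0(0)-\int_0^tS(t-s)\lambda u(s-\tau)\,ds-\int_0^tS(t-s)u(s)\partial_xu(s)\,ds,\quad t\in[0,T].$$ The solution is the global mild solution, i.e. the function on $[0,\infty)$ whose restriction to every bounded interval $[0,T]$ is a mild solution on $[0,T]$; under the hypotheses above it exists and is unique. Exponentially stable means that $\mathcal{E}$ decays exponentially along all solutions: there is $\gamma>0$ such that every solution satisfies $\mathcal{E}(t)\le Ce^{-\gamma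 t}$ for all $t\ge0$, with $C$ depending only on the initial datum $u_0$. *)

theory Defs
  imports "HOL-Analysis.Analysis"
begin

section \<open>The Hilbert space of square integrable functions on the real line\<close>

definition sq_integrable :: "(real \<Rightarrow> real) \<Rightarrow> bool" where
  "sq_integrable f \<longleftrightarrow> f \<in> borel_measurable lebesgue \<and> integrable lebesgue (\<lambda>x. (f x)\<^sup>2)"

definition L2_rel :: "(real \<Rightarrow> real) \<Rightarrow> (real \<Rightarrow> real) \<Rightarrow> bool" where
  "L2_rel f g \<longleftrightarrow> sq_integrable f \<and> sq_integrable g \<and> (AE x in lebesgue. f x = g x)"

lemma sq_integrable_zero [simp]: "sq_integrable (\<lambda>x. 0)"
  by (simp add: sq_integrable_def)

lemma sq_integrable_measurable [measurable_dest]: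
  "sq_integrable f \<Longrightarrow> f \<in> borel_measurable lebesgue"
  by (simp add: sq_integrable_def)

lemma sq_integrable_power2: "sq_integrable f \<Longrightarrow> integrable lebesgue (\<lambda>x. (f x)\<^sup>2)"
  by (simp add: sq_integrable_def)

lemma part_equivp_L2_rel: "part_equivp L2_rel"
proof (rule part_equivpI)
  show "\<exists>f. L2_rel f f"
    by (rule exI[of _ "\<lambda>x. 0"]) (simp add: L2_rel_def)
  show "symp L2_rel"
    by (auto simp: symp_def L2_rel_def elim: AE_mp)
  show "transp L2_rel"
    unfolding transp_def L2_rel_def by (auto elim: AE_mp)
qed

quotient_type L2 = "real \<Rightarrow> real" / partial: L2_rel
  by (rule part_equivp_L2_rel)

lemma rep_L2_rel: "L2_rel (rep_L2 f) (rep_L2 f)"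
  using Quotient_rep_reflp[OF Quotient_L2] .

lemma sq_integrable_rep [simp, intro]: "sq_integrable (rep_L2 f)"
  using rep_L2_rel[of f] by (simp add: L2_rel_def)

lemma rep_L2_measurable [measurable]: "rep_L2 f \<in> borel_measurable lebesgue"
  by (rule sq_integrable_measurable) simp

lemma L2_eqI:
  assumes "AE x in lebesgue. rep_L2 f x = rep_L2 g x"
  shows "f = g"
  using assms Quotient_rel_rep[OF Quotient_L2, of f g] by (simp add: L2_rel_def)

lemma rep_abs_L2: "sq_integrable f \<Longrightarrow> AE x in lebesgue. rep_L2 (abs_L2 f) x = f x"
  using Quotient_rep_abs[OF Quotient_L2, of f] by (simp add: L2_rel_def)

lemma sq_integrable_prod:
  assumes f: "sq_integrable f" and g: "sq_integrable g"
  shows "integrable lebesgue (\<lambda>x. f x * g x)"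
proof (rule Bochner_Integration.integrable_bound)
  show "integrable lebesgue (\<lambda>x. (f x)\<^sup>2 + (g x)\<^sup>2)"
    using f g by (simp add: sq_integrable_power2)
  have [measurable]: "f \<in> borel_measurable lebesgue" "g \<in> borel_measurable lebesgue"
    using f g by (simp_all add: sq_integrable_measurable)
  show "(\<lambda>x. f x * g x) \<in> borel_measurable lebesgue"
    by measurable
  have "\<bar>a * b\<bar> \<le> a\<^sup>2 + b\<^sup>2" for a b :: real
    using sum_squares_bound[of "\<bar>a\<bar>" "\<bar>b\<bar>"] mult_nonneg_nonneg[of "\<bar>a\<bar>" "\<bar>b\<bar>"]
    unfolding abs_mult power2_abs by linarith
  then show "AE x in lebesgue. norm (f x * g x) \<le> norm ((f x)\<^sup>2 + (g x)\<^sup>2)"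
    by (auto intro!: AE_I2)
qed

lemma sq_integrable_add:
  assumes f: "sq_integrable f" and g: "sq_integrable g"
  shows "sq_integrable (\<lambda>x. f x + g x)"
proof -
  have [measurable]: "f \<in> borel_measurable lebesgue" "g \<in> borel_measurable lebesgue"
    using f g by (simp_all add: sq_integrable_measurable)
  have "integrable lebesgue (\<lambda>x. (f x)\<^sup>2 + (g x)\<^sup>2 + 2 * (f x * g x))"
    using f g by (simp add: sq_integrable_power2 sq_integrable_prod)
  then show ?thesis
    by (simp add: sq_integrable_def power2_sum mult.assoc)
qed

lemma sq_integrable_cmult:
  assumes f: "sq_integrable f"
  shows "sq_integrable (\<lambda>x. c * f x)"
  using f by (auto simp: sq_integrable_def power_mult_distrib)

lemma sq_integrable_diff:
  assumes "sq_integrable f" "sq_integrable g"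
  shows "sq_integrable (\<lambda>x. f x - g x)"
  using sq_integrable_add[OF assms(1) sq_integrable_cmult[OF assms(2), of "- 1"]] by simp

instantiation L2 :: real_inner
begin

definition zero_L2 :: L2 where "0 = abs_L2 (\<lambda>x. 0)"
definition plus_L2 :: "L2 \<Rightarrow> L2 \<Rightarrow> L2" where
  "f + g = abs_L2 (\<lambda>x. rep_L2 f x + rep_L2 g x)"
definition uminus_L2 :: "L2 \<Rightarrow> L2" where
  "- f = abs_L2 (\<lambda>x. - rep_L2 f x)"
definition minus_L2 :: "L2 \<Rightarrow> L2 \<Rightarrow> L2" where
  "f - g = abs_L2 (\<lambda>x. rep_L2 f x - rep_L2 g x)"
definition scaleR_L2 :: "real \<Rightarrow> L2 \<Rightarrow> L2" where
  "c *\<^sub>R f = abs_L2 (\<lambda>x. c * rep_L2 f x)"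
definition inner_L2 :: "L2 \<Rightarrow> L2 \<Rightarrow> real" where
  "inner f g = (LINT x|lebesgue. rep_L2 f x * rep_L2 g x)"
definition norm_L2 :: "L2 \<Rightarrow> real" where
  "norm f = sqrt (LINT x|lebesgue. (rep_L2 f x)\<^sup>2)"
definition sgn_L2 :: "L2 \<Rightarrow> L2" where
  "sgn_L2 f = inverse (norm f) *\<^sub>R f"
definition dist_L2 :: "L2 \<Rightarrow> L2 \<Rightarrow> real" where
  "dist_L2 f g = norm (f - g)"
definition uniformity_L2 :: "(L2 \<times> L2) filter" where
  "uniformity_L2 = (INF e\<in>{0<..}. principal {(x, y). dist x y < e})"
definition open_L2 :: "L2 set \<Rightarrow> bool" where
  "open_L2 U \<longleftrightarrow> (\<forall>x\<in>U. \<forall>\<^sub>F (x', y) in uniformity. x' = x \<longrightarrow> y \<in> U)"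

lemma rep_L2_zero: "AE x in lebesgue. rep_L2 0 x = 0"
  unfolding zero_L2_def by (rule rep_abs_L2) simp

lemma rep_L2_plus: "AE x in lebesgue. rep_L2 (f + g) x = rep_L2 f x + rep_L2 g x"
  unfolding plus_L2_def by (rule rep_abs_L2) (simp add: sq_integrable_add)

lemma rep_L2_uminus: "AE x in lebesgue. rep_L2 (- f) x = - rep_L2 f x"
  unfolding uminus_L2_def by (rule rep_abs_L2) (use sq_integrable_cmult[of "rep_L2 f" "- 1"] in simp)

lemma rep_L2_minus: "AE x in lebesgue. rep_L2 (f - g) x = rep_L2 f x - rep_L2 g x"
  unfolding minus_L2_def
  by (rule rep_abs_L2) (simp add: sq_integrable_diff)

lemma rep_L2_scaleR: "AE x in lebesgue. rep_L2 (c *\<^sub>R f) x = c * rep_L2 f x"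
  unfolding scaleR_L2_def by (rule rep_abs_L2) (simp add: sq_integrable_cmult)

instance
proof
  fix f g h :: L2 and a b :: real
  show "f + g + h = f + (g + h)"
    by (rule L2_eqI)
      (use rep_L2_plus[of "f + g" h] rep_L2_plus[of f g] rep_L2_plus[of f "g + h"] rep_L2_plus[of g h]
        in eventually_elim, simp)
  show "f + g = g + f"
    by (simp add: plus_L2_def add.commute)
  show "0 + f = f"
    by (rule L2_eqI) (use rep_L2_plus[of 0 f] rep_L2_zero in eventually_elim, simp)
  show "- f + f = 0"
    by (rule L2_eqI)
      (use rep_L2_plus[of "- f" f] rep_L2_uminus[of f] rep_L2_zero in eventually_elim, simp)
  show "f - g = f + - g"
    by (rule L2_eqI)
      (use rep_L2_plus[of f "- g"] rep_L2_uminus[of g] rep_L2_minus[of f g] in eventually_elim, simp)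
  show "a *\<^sub>R (f + g) = a *\<^sub>R f + a *\<^sub>R g"
    by (rule L2_eqI)
      (use rep_L2_plus[of f g] rep_L2_scaleR[of a "f + g"] rep_L2_scaleR[of a f] rep_L2_scaleR[of a g]
        rep_L2_plus[of "a *\<^sub>R f" "a *\<^sub>R g"] in eventually_elim, simp add: algebra_simps)
  show "(a + b) *\<^sub>R f = a *\<^sub>R f + b *\<^sub>R f"
    by (rule L2_eqI)
      (use rep_L2_scaleR[of a f] rep_L2_scaleR[of b f] rep_L2_scaleR[of "a + b" f]
        rep_L2_plus[of "a *\<^sub>R f" "b *\<^sub>R f"] in eventually_elim, simp add: algebra_simps)
  show "a *\<^sub>R b *\<^sub>R f = (a * b) *\<^sub>R f"
    by (rule L2_eqI)
      (use rep_L2_scaleR[of b f] rep_L2_scaleR[of "a * b" f] rep_L2_scaleR[of a "b *\<^sub>R f"]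
        in eventually_elim, simp)
  show "1 *\<^sub>R f = f"
    by (rule L2_eqI) (use rep_L2_scaleR[of 1 f] in eventually_elim, simp)
  show "dist f g = norm (f - g)"
    by (rule dist_L2_def)
  show "sgn f = inverse (norm f) *\<^sub>R f"
    by (simp add: sgn_L2_def)
  show "(uniformity :: (L2 \<times> L2) filter) = (INF e\<in>{0<..}. principal {(x, y). dist x y < e})"
    by (rule uniformity_L2_def)
  show "open U \<longleftrightarrow> (\<forall>x\<in>U. \<forall>\<^sub>F (x', y) in uniformity. x' = x \<longrightarrow> y \<in> U)" for U :: "L2 set"
    by (rule open_L2_def)
  show "inner f g = inner g f"
    by (simp add: inner_L2_def mult.commute)
  have "inner (f + g) h = (LINT x|lebesgue. rep_L2 f x * rep_L2 h x + rep_L2 g x * rep_L2 h x)"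
    unfolding inner_L2_def
    by (rule integral_cong_AE)
      (measurable, use rep_L2_plus[of f g] in eventually_elim, simp add: algebra_simps)
  then show "inner (f + g) h = inner f h + inner g h"
    by (simp add: inner_L2_def sq_integrable_prod)
  have "inner (a *\<^sub>R f) g = (LINT x|lebesgue. a * (rep_L2 f x * rep_L2 g x))"
    unfolding inner_L2_def
    by (rule integral_cong_AE)
      (measurable, use rep_L2_scaleR[of a f] in eventually_elim, simp add: algebra_simps)
  then show "inner (a *\<^sub>R f) g = a * inner f g"
    by (simp add: inner_L2_def)
  show "0 \<le> inner f f"
    by (simp add: inner_L2_def)
  show "inner f f = 0 \<longleftrightarrow> f = 0"
  proof
    assume "inner f f = 0"
    then have "AE x in lebesgue. rep_L2 f x * rep_L2 f x = 0"
      unfolding inner_L2_def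
      by (subst (asm) integral_nonneg_eq_0_iff_AE) (auto simp: sq_integrable_prod)
    with rep_L2_zero have "AE x in lebesgue. rep_L2 f x = rep_L2 0 x"
      by eventually_elim simp
    then show "f = 0"
      by (rule L2_eqI)
  next
    assume "f = 0"
    show "inner f f = 0"
      unfolding inner_L2_def \<open>f = 0\<close>
      by (rule integral_eq_zero_AE) (use rep_L2_zero in eventually_elim, simp)
  qed
  show "norm f = sqrt (inner f f)"
    by (simp add: norm_L2_def inner_L2_def power2_eq_square)
qed

end

lemma norm_L2_power2: "(norm (f :: L2))\<^sup>2 = (LINT x|lebesgue. (rep_L2 f x)\<^sup>2)"
  by (simp add: norm_L2_def)

text \<open>The class of a function; functions that are not square integrable are sent to \<open>0\<close>.\<close>

definition L2_of :: "(real \<Rightarrow> real) \<Rightarrow> L2" where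
  "L2_of f = (if sq_integrable f then abs_L2 f else 0)"

lemma rep_L2_of: "sq_integrable f \<Longrightarrow> AE x in lebesgue. rep_L2 (L2_of f) x = f x"
  by (simp add: L2_of_def rep_abs_L2)

lemma L2_of_rep: "L2_of (rep_L2 f) = f"
  by (rule L2_eqI) (rule rep_L2_of, simp)

lemma norm_L2_of:
  assumes "sq_integrable f"
  shows "norm (L2_of f) = sqrt (LINT x|lebesgue. (f x)\<^sup>2)"
proof -
  have "(LINT x|lebesgue. (rep_L2 (L2_of f) x)\<^sup>2) = (LINT x|lebesgue. (f x)\<^sup>2)"
    using assms
    by (intro integral_cong_AE)
      (auto simp: sq_integrable_measurable intro!: borel_measurable_power elim!: AE_mp[OF rep_L2_of] )
  then show ?thesis
    by (simp add: norm_L2_def)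
qed

lemma L2_of_add:
  assumes "sq_integrable f" "sq_integrable g"
  shows "L2_of (\<lambda>x. f x + g x) = L2_of f + L2_of g"
  by (rule L2_eqI)
    (use rep_L2_of[OF assms(1)] rep_L2_of[OF assms(2)] rep_L2_of[OF sq_integrable_add[OF assms]]
      rep_L2_plus[of "L2_of f" "L2_of g"] in eventually_elim, simp)

lemma L2_of_cmult:
  assumes "sq_integrable f"
  shows "L2_of (\<lambda>x. c * f x) = c *\<^sub>R L2_of f"
  by (rule L2_eqI)
    (use rep_L2_of[OF assms] rep_L2_of[OF sq_integrable_cmult[OF assms, of c]]
      rep_L2_scaleR[of c "L2_of f"] in eventually_elim, simp)

lemma L2_of_diff:
  assumes "sq_integrable f" "sq_integrable g"
  shows "L2_of (\<lambda>x. f x - g x) = L2_of f - L2_of g"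
  using L2_of_add[OF assms(1) sq_integrable_cmult[OF assms(2), of "- 1"]]
    L2_of_cmult[OF assms(2), of "- 1"] by simp


lemma L2_converge_of_Cauchy:
  fixes X :: "nat \<Rightarrow> L2"
  assumes "Cauchy X"
  shows "convergent X"
proof -
  obtain h :: "real \<Rightarrow> ennreal" where h: "h \<in> borel_measurable lborel"
    and "integral\<^sup>N lborel h \<noteq> \<infinity>"
    and hpos: "\<And>x. 0 < h x \<and> h x < \<infinity>"
    using sigma_finite_measure.Ex_finite_integrable_function[OF sigma_finite_lborel] by auto
  then have hfin: "integral\<^sup>N lebesgue h \<noteq> \<infinity>"
    by (simp add: nn_integral_completion)
  have [measurable]: "h \<in> borel_measurable lebesgue"
    using h by (rule measurable_completion)
  define w where "w x = sqrt (enn2real (h x))" for x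
  have wpos: "w x > 0" for x
    using hpos[of x] by (simp add: w_def enn2real_positive_iff)
  have w_meas [measurable]: "w \<in> borel_measurable lebesgue"
    unfolding w_def by measurable
  have w2: "(w x)\<^sup>2 = enn2real (h x)" for x
    by (simp add: w_def)
  have "integrable lebesgue (\<lambda>x. (w x)\<^sup>2)"
    unfolding w2
  proof (rule integrableI_nonneg)
    show "(\<integral>\<^sup>+ x. ennreal (enn2real (h x)) \<partial>lebesgue) < \<infinity>"
      using hfin hpos by (simp add: less_top)
  qed auto
  then have w_sq: "sq_integrable w"
    by (simp add: sq_integrable_def)
  define W where "W = L2_of (\<lambda>x. \<bar>w x\<bar>)"
  have absw: "sq_integrable (\<lambda>x. \<bar>w x\<bar>)"
    using w_sq by (simp add: sq_integrable_def)
  define s where "s n x = rep_L2 (X n) x * w x" for n x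
  have s_int: "integrable lebesgue (s n)" for n
    unfolding s_def by (intro sq_integrable_prod w_sq) simp
  have bound: "(LINT x|lebesgue. norm (s i x - s j x)) \<le> norm (X i - X j) * norm W" for i j
  proof -
    have sqa: "sq_integrable (\<lambda>x. \<bar>rep_L2 (X i - X j) x\<bar>)"
      using sq_integrable_rep[of "X i - X j"] by (simp add: sq_integrable_def)
    have "(LINT x|lebesgue. norm (s i x - s j x)) =
        inner (L2_of (\<lambda>x. \<bar>rep_L2 (X i - X j) x\<bar>)) W"
      unfolding inner_L2_def W_def s_def
    proof (rule integral_cong_AE)
      show "AE x in lebesgue. norm (rep_L2 (X i) x * w x - rep_L2 (X j) x * w x) =
          rep_L2 (L2_of (\<lambda>x. \<bar>rep_L2 (X i - X j) x\<bar>)) x * rep_L2 (L2_of (\<lambda>x. \<bar>w x\<bar>)) x"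
        using rep_L2_of[OF sqa] rep_L2_of[OF absw] rep_L2_minus[of "X i" "X j"]
        by eventually_elim (simp add: abs_mult flip: left_diff_distrib)
    qed measurable
    also have "\<dots> \<le> norm (L2_of (\<lambda>x. \<bar>rep_L2 (X i - X j) x\<bar>)) * norm W"
      by (rule norm_cauchy_schwarz)
    also have "norm (L2_of (\<lambda>x. \<bar>rep_L2 (X i - X j) x\<bar>)) = norm (X i - X j)"
      by (subst norm_L2_of[OF sqa]) (simp add: norm_L2_def)
    finally show ?thesis .
  qed
  have "\<exists>N. \<forall>i\<ge>N. \<forall>j\<ge>N. (LINT x|lebesgue. norm (s i x - s j x)) < e" if "e > 0" for e
  proof -
    have "e / (norm W + 1) > 0"
      using \<open>e > 0\<close> by (simp add: add_nonneg_pos)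
    then obtain N where N: "\<And>i j. i \<ge> N \<Longrightarrow> j \<ge> N \<Longrightarrow> norm (X i - X j) < e / (norm W + 1)"
      using \<open>Cauchy X\<close> unfolding Cauchy_def dist_norm by blast
    have "(LINT x|lebesgue. norm (s i x - s j x)) < e" if "i \<ge> N" "j \<ge> N" for i j
    proof -
      have "norm (X i - X j) * norm W \<le> norm (X i - X j) * (norm W + 1)"
        by (intro mult_left_mono) auto
      also have "\<dots> < e"
        using N[OF that] by (simp add: pos_less_divide_eq add_nonneg_pos)
      finally show ?thesis
        using bound[of i j] by linarith
    qed
    then show ?thesis
      by blast
  qed
  from cauchy_L1_AE_cauchy_subseq[of lebesgue s, OF s_int this]
  obtain r :: "nat \<Rightarrow> nat" where r: "strict_mono r"
    and AE_Cauchy: "AE x in lebesgue. Cauchy (\<lambda>i. s (r i) x)"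
    by metis
  from AE_Cauchy have AE_conv: "AE x in lebesgue. convergent (\<lambda>i. rep_L2 (X (r i)) x)"
  proof (eventually_elim)
    case (elim x)
    then obtain l where "(\<lambda>i. s (r i) x) \<longlonglongrightarrow> l"
      by (auto simp: Cauchy_convergent_iff convergent_def)
    then have "(\<lambda>i. s (r i) x / w x) \<longlonglongrightarrow> l / w x"
      using wpos[of x] by (intro tendsto_intros) auto
    moreover have "s (r i) x / w x = rep_L2 (X (r i)) x" for i
      using wpos[of x] by (simp add: s_def)
    ultimately show ?case
      by (auto simp: convergent_def)
  qed
  define F where "F x = lim (\<lambda>i. rep_L2 (X (r i)) x)" for x
  have F_meas [measurable]: "F \<in> borel_measurable lebesgue"
    unfolding F_def by (intro borel_measurable_lim_metric) measurable
  have F_lim: "AE x in lebesgue. (\<lambda>i. rep_L2 (X (r i)) x) \<longlonglongrightarrow> F x"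
    using AE_conv by eventually_elim (simp add: F_def convergent_LIMSEQ_iff)
  have fatou: "(\<integral>\<^sup>+x. ennreal ((F x - rep_L2 (X n) x)\<^sup>2) \<partial>lebesgue) \<le> ennreal (e\<^sup>2)"
    if e: "e \<ge> 0" and N: "\<And>i. i \<ge> N \<Longrightarrow> norm (X i - X n) \<le> e" for e N n
  proof -
    have "(\<integral>\<^sup>+x. ennreal ((F x - rep_L2 (X n) x)\<^sup>2) \<partial>lebesgue) =
        (\<integral>\<^sup>+x. liminf (\<lambda>i. ennreal ((rep_L2 (X (r i)) x - rep_L2 (X n) x)\<^sup>2)) \<partial>lebesgue)"
    proof (rule nn_integral_cong_AE)
      show "AE x in lebesgue. ennreal ((F x - rep_L2 (X n) x)\<^sup>2) =
          liminf (\<lambda>i. ennreal ((rep_L2 (X (r i)) x - rep_L2 (X n) x)\<^sup>2))"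
        using F_lim
      proof eventually_elim
        case (elim x)
        then have "(\<lambda>i. ennreal ((rep_L2 (X (r i)) x - rep_L2 (X n) x)\<^sup>2)) \<longlonglongrightarrow>
            ennreal ((F x - rep_L2 (X n) x)\<^sup>2)"
          by (intro tendsto_intros)
        then show ?case
          by (intro lim_imp_Liminf[symmetric]) simp_all
      qed
    qed
    also have "\<dots> \<le> liminf (\<lambda>i. \<integral>\<^sup>+x. ennreal ((rep_L2 (X (r i)) x - rep_L2 (X n) x)\<^sup>2) \<partial>lebesgue)"
      by (rule nn_integral_liminf) measurable
    also have "\<dots> \<le> liminf (\<lambda>i. ennreal (e\<^sup>2))"
    proof (rule Liminf_mono)
      have "(\<integral>\<^sup>+x. ennreal ((rep_L2 (X (r i)) x - rep_L2 (X n) x)\<^sup>2) \<partial>lebesgue) \<le> ennreal (e\<^sup>2)"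
        if "i \<ge> N" for i
      proof -
        have "(\<integral>\<^sup>+x. ennreal ((rep_L2 (X (r i)) x - rep_L2 (X n) x)\<^sup>2) \<partial>lebesgue) =
            (\<integral>\<^sup>+x. ennreal ((rep_L2 (X (r i) - X n) x)\<^sup>2) \<partial>lebesgue)"
          by (rule nn_integral_cong_AE) (use rep_L2_minus[of "X (r i)" "X n"] in eventually_elim, simp)
        also have "\<dots> = ennreal ((norm (X (r i) - X n))\<^sup>2)"
          by (simp add: norm_L2_power2 nn_integral_eq_integral sq_integrable_power2)
        also have "\<dots> \<le> ennreal (e\<^sup>2)"
          using N[of "r i"] that seq_suble[OF r, of i] e by (intro ennreal_leI power_mono) auto
        finally show ?thesis .
      qed
      then show "\<forall>\<^sub>F i in sequentially.
          (\<integral>\<^sup>+x. ennreal ((rep_L2 (X (r i)) x - rep_L2 (X n) x)\<^sup>2) \<partial>lebesgue) \<le> ennreal (e\<^sup>2)"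
        by (auto simp: eventually_sequentially)
    qed
    finally show ?thesis
      by (simp add: Liminf_const)
  qed
  have diff_sq: "sq_integrable (\<lambda>x. F x - rep_L2 (X n) x)"
    if "e \<ge> 0" "\<And>i. i \<ge> N \<Longrightarrow> norm (X i - X n) \<le> e" for e N n
  proof -
    have "(\<integral>\<^sup>+x. ennreal ((F x - rep_L2 (X n) x)\<^sup>2) \<partial>lebesgue) \<le> ennreal (e\<^sup>2)"
      using that(1) by (rule fatou) (rule that(2))
    also have "\<dots> < \<infinity>"
      by simp
    finally have "integrable lebesgue (\<lambda>x. (F x - rep_L2 (X n) x)\<^sup>2)"
      by (intro integrableI_nonneg) auto
    then show ?thesis
      by (simp add: sq_integrable_def)
  qed
  have C: "\<exists>N. \<forall>i\<ge>N. \<forall>n\<ge>N. norm (X i - X n) \<le> e" if e: "e > 0" for e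
  proof -
    obtain N where "\<forall>i\<ge>N. \<forall>n\<ge>N. norm (X i - X n) < e"
      using \<open>Cauchy X\<close> e unfolding Cauchy_def dist_norm by blast
    then have "\<forall>i\<ge>N. \<forall>n\<ge>N. norm (X i - X n) \<le> e"
      by (simp add: less_imp_le)
    then show ?thesis ..
  qed
  obtain N1 where N1: "\<And>i n. i \<ge> N1 \<Longrightarrow> n \<ge> N1 \<Longrightarrow> norm (X i - X n) \<le> 1"
    using C[OF zero_less_one] by blast
  have F_sq: "sq_integrable F"
  proof -
    have "sq_integrable (\<lambda>x. F x - rep_L2 (X N1) x)"
      by (rule diff_sq[of 1 N1 N1, OF zero_le_one]) (rule N1, assumption, rule order_refl)
    from sq_integrable_add[OF this sq_integrable_rep[of "X N1"]] show ?thesis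
      by simp
  qed
  have "X \<longlonglongrightarrow> L2_of F"
  proof (rule metric_LIMSEQ_I)
    fix e :: real assume "e > 0"
    obtain N where N: "\<And>i n. i \<ge> N \<Longrightarrow> n \<ge> N \<Longrightarrow> norm (X i - X n) \<le> e / 2"
      using C[OF half_gt_zero[OF \<open>e > 0\<close>]] by blast
    have "dist (X n) (L2_of F) < e" if "n \<ge> N" for n
    proof -
      have "ennreal ((norm (L2_of F - X n))\<^sup>2) = (\<integral>\<^sup>+x. ennreal ((rep_L2 (L2_of F - X n) x)\<^sup>2) \<partial>lebesgue)"
        by (simp add: norm_L2_power2 nn_integral_eq_integral sq_integrable_power2)
      also have "\<dots> = (\<integral>\<^sup>+x. ennreal ((F x - rep_L2 (X n) x)\<^sup>2) \<partial>lebesgue)"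
        by (rule nn_integral_cong_AE)
          (use rep_L2_minus[of "L2_of F" "X n"] rep_L2_of[OF F_sq] in eventually_elim, simp)
      also have "\<dots> \<le> ennreal ((e / 2)\<^sup>2)"
      proof (rule fatou)
        show "0 \<le> e / 2"
          using \<open>e > 0\<close> by simp
        show "norm (X i - X n) \<le> e / 2" if "i \<ge> N" for i
          using that \<open>n \<ge> N\<close> by (rule N)
      qed
      finally have "(norm (L2_of F - X n))\<^sup>2 \<le> (e / 2)\<^sup>2"
        using \<open>e > 0\<close> by simp
      then have "norm (L2_of F - X n) \<le> e / 2"
        by (rule power2_le_imp_le) (use \<open>e > 0\<close> in simp)
      then show ?thesis
        using \<open>e > 0\<close> unfolding dist_norm norm_minus_commute[of "X n"] by linarith
    qed
    then show "\<exists>N. \<forall>n\<ge>N. dist (X n) (L2_of F) < e"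
      by blast
  qed
  then show ?thesis
    by (auto simp: convergent_def)
qed

instance L2 :: banach
  by standard (rule L2_converge_of_Cauchy)


text \<open>Separability, which the Bochner integral of the library requires: the finite rational
  combinations of indicator functions of compact intervals with rational endpoints are dense.\<close>

definition L2_ind :: "real set \<Rightarrow> L2" where
  "L2_ind A = L2_of (indicat_real A)"

lemma sq_integrable_indicator:
  assumes "A \<in> lmeasurable"
  shows "sq_integrable (indicat_real A)"
proof -
  have "(\<lambda>x. (indicat_real A x)\<^sup>2) = indicat_real A"
    by (auto simp: indicator_def)
  moreover have "integrable lebesgue (indicat_real A)"
    using assms by (auto simp: fmeasurable_def intro: integrable_real_indicator)
  ultimately show ?thesis
    using borel_measurable_integrable by (auto simp: sq_integrable_def)
qed

lemma L2_ind_diff: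
  assumes "A \<in> lmeasurable" "B \<in> lmeasurable" "A \<subseteq> B"
  shows "L2_ind B - L2_ind A = L2_ind (B - A)"
proof -
  have "indicat_real (B - A) = (\<lambda>x. indicat_real B x - indicat_real A x)"
    using assms(3) by (auto simp: indicator_def fun_eq_iff)
  then show ?thesis
    unfolding L2_ind_def using assms by (simp add: L2_of_diff sq_integrable_indicator)
qed

lemma norm_L2_ind:
  assumes "A \<in> lmeasurable"
  shows "norm (L2_ind A) = sqrt (measure lebesgue A)"
proof -
  have "(\<lambda>x. (indicat_real A x)\<^sup>2) = indicat_real A"
    by (auto simp: indicator_def)
  then show ?thesis
    unfolding L2_ind_def using assms by (simp add: norm_L2_of sq_integrable_indicator)
qed

definition L2_dense :: "L2 set" where
  "L2_dense = range (\<lambda>l :: (rat \<times> rat \<times> rat) list.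
     sum_list (map (\<lambda>(q, a, b). of_rat q *\<^sub>R L2_ind {of_rat a..of_rat b}) l))"

lemma countable_L2_dense: "countable L2_dense"
  unfolding L2_dense_def by simp

lemma L2_dense_add:
  assumes "f \<in> L2_dense" "g \<in> L2_dense"
  shows "f + g \<in> L2_dense"
proof -
  let ?S = "\<lambda>l :: (rat \<times> rat \<times> rat) list.
    sum_list (map (\<lambda>(q, a, b). of_rat q *\<^sub>R L2_ind {of_rat a..of_rat b}) l)"
  obtain l l' where "f = ?S l" "g = ?S l'"
    using assms unfolding L2_dense_def by blast
  then have "f + g = ?S (l @ l')"
    by simp
  then show ?thesis
    unfolding L2_dense_def by (rule image_eqI) simp
qed

lemma L2_dense_scale:
  assumes "f \<in> L2_dense"
  shows "of_rat c *\<^sub>R f \<in> L2_dense"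
proof -
  obtain l :: "(rat \<times> rat \<times> rat) list" where
    f: "f = sum_list (map (\<lambda>(q, a, b). of_rat q *\<^sub>R L2_ind {of_rat a..of_rat b}) l)"
    using assms by (auto simp: L2_dense_def)
  have "of_rat c *\<^sub>R f =
      sum_list (map (\<lambda>(q, a, b). of_rat q *\<^sub>R L2_ind {of_rat a..of_rat b})
        (map (\<lambda>(q, a, b). (c * q, a, b)) l))"
    unfolding f by (induction l) (auto simp: scaleR_add_right of_rat_mult)
  then show ?thesis
    unfolding L2_dense_def by blast
qed

lemma closure_L2_dense_0: "0 \<in> closure L2_dense"
  unfolding L2_dense_def
  by (rule subsetD[OF closure_subset], rule image_eqI[of _ _ "[]"]) auto

lemma closure_L2_dense_add:
  assumes "f \<in> closure L2_dense" "g \<in> closure L2_dense"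
  shows "f + g \<in> closure L2_dense"
proof -
  obtain F G where "\<And>n. F n \<in> L2_dense" "F \<longlonglongrightarrow> f" "\<And>n. G n \<in> L2_dense" "G \<longlonglongrightarrow> g"
    using assms unfolding closure_sequential by blast
  then have "(\<forall>n. F n + G n \<in> L2_dense) \<and> (\<lambda>n. F n + G n) \<longlonglongrightarrow> f + g"
    by (simp add: L2_dense_add tendsto_add)
  then show ?thesis
    unfolding closure_sequential by (rule exI[of _ "\<lambda>n. F n + G n"])
qed

lemma closure_L2_dense_scale:
  assumes "f \<in> closure L2_dense"
  shows "c *\<^sub>R f \<in> closure L2_dense"
proof -
  obtain F where F: "\<And>n. F n \<in> L2_dense" "F \<longlonglongrightarrow> f"
    using assms unfolding closure_sequential by blast
  have "\<exists>q :: rat. of_rat q \<in> {c<..<c + 1 / real (Suc n)}" for n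
    using of_rat_dense[of c "c + 1 / real (Suc n)"] by auto
  then obtain q :: "nat \<Rightarrow> rat" where q: "\<And>n. of_rat (q n) \<in> {c<..<c + 1 / real (Suc n)}"
    by metis
  have "(\<lambda>n. of_rat (q n)) \<longlonglongrightarrow> c"
  proof (rule tendsto_sandwich)
    show "\<forall>\<^sub>F n in sequentially. c \<le> of_rat (q n)"
      using q by (auto intro!: always_eventually simp: less_imp_le)
    show "\<forall>\<^sub>F n in sequentially. of_rat (q n) \<le> c + 1 / real (Suc n)"
      using q by (intro always_eventually) (metis greaterThanLessThan_iff less_imp_le)
    show "(\<lambda>n. c + 1 / real (Suc n)) \<longlonglongrightarrow> c"
      using tendsto_add[OF tendsto_const LIMSEQ_inverse_real_of_nat, of c]
      by (simp add: inverse_eq_divide)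
  qed auto
  then have "(\<forall>n. of_rat (q n) *\<^sub>R F n \<in> L2_dense) \<and> (\<lambda>n. of_rat (q n) *\<^sub>R F n) \<longlonglongrightarrow> c *\<^sub>R f"
    using F by (simp add: L2_dense_scale tendsto_scaleR)
  then show ?thesis
    unfolding closure_sequential by (rule exI[of _ "\<lambda>n. of_rat (q n) *\<^sub>R F n"])
qed

lemma closure_L2_dense_diff:
  assumes "f \<in> closure L2_dense" "g \<in> closure L2_dense"
  shows "f - g \<in> closure L2_dense"
  using closure_L2_dense_add[OF assms(1) closure_L2_dense_scale[OF assms(2), of "- 1"]] by simp

lemma closure_L2_dense_sum:
  assumes "\<And>i. i \<in> I \<Longrightarrow> F i \<in> closure L2_dense"
  shows "sum F I \<in> closure L2_dense"
  using assms
  by (induction I rule: infinite_finite_induct) (auto intro: closure_L2_dense_add closure_L2_dense_0)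

lemma L2_ind_interval: "L2_ind {a..b} \<in> closure L2_dense"
proof (cases "a \<le> b")
  case False
  have "L2_ind {} = 0"
    using norm_L2_ind[of "{}"] by simp
  with False show ?thesis
    by (simp add: closure_L2_dense_0)
next
  case True
  show ?thesis
    unfolding closure_approachable
  proof (intro allI impI)
    fix e :: real assume e: "e > 0"
    obtain q r :: rat where q: "a - e\<^sup>2 / 4 < of_rat q" "of_rat q < a"
      and r: "b < of_rat r" "of_rat r < b + e\<^sup>2 / 4"
      using of_rat_dense[of "a - e\<^sup>2 / 4" a] of_rat_dense[of b "b + e\<^sup>2 / 4"] e by auto
    let ?I = "{of_rat q..of_rat r} :: real set"
    have sub: "{a..b} \<subseteq> ?I"
      using q r by auto
    have "dist (L2_ind ?I) (L2_ind {a..b}) = sqrt (measure lebesgue (?I - {a..b}))"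
      unfolding dist_norm using sub by (simp add: L2_ind_diff norm_L2_ind fmeasurable.Diff)
    also have "measure lebesgue (?I - {a..b}) = measure lebesgue ?I - measure lebesgue {a..b}"
      using sub by (intro measurable_measure_Diff) auto
    also have "\<dots> = (of_rat r - of_rat q) - (b - a)"
      using True q r by simp
    also have "\<dots> < e\<^sup>2"
      using q r by (simp add: field_simps)
    finally have "dist (L2_ind ?I) (L2_ind {a..b}) < e"
      using e by (simp add: real_less_lsqrt)
    moreover have "L2_ind ?I \<in> L2_dense"
      unfolding L2_dense_def by (rule image_eqI[of _ _ "[(1, q, r)]"]) auto
    ultimately show "\<exists>f\<in>L2_dense. dist f (L2_ind {a..b}) < e"
      by blast
  qed
qed

lemma L2_ind_borel:
  assumes "A \<in> sets borel"
  shows "L2_ind (A \<inter> {- c..c}) \<in> closure L2_dense"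
proof -
  have lm: "B \<inter> {- c..c} \<in> lmeasurable" if "B \<in> sets borel" for B
    by (rule fmeasurableI2[of "{- c..c}"]) (use that in auto)
  have "Int_stable (range (\<lambda>a :: real. {..a}))"
    by (auto simp: Int_stable_def)
  moreover have "range (\<lambda>a :: real. {..a}) \<subseteq> Pow UNIV"
    by auto
  moreover have "A \<in> sigma_sets UNIV (range (\<lambda>a :: real. {..a}))"
    using assms by (simp add: borel_eq_atMost)
  ultimately show ?thesis
  proof (induction rule: sigma_sets_induct_disjoint)
    case (basic B)
    then obtain a where "B = {..a}"
      by auto
    then have "B \<inter> {- c..c} = {- c..min a c}"
      by auto
    then show ?case
      by (simp add: L2_ind_interval)
  next
    case empty
    show ?case
      using L2_ind_interval[of 1 0] by simp
  next
    case (compl B)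
    then have "B \<in> sets borel"
      by (simp add: borel_eq_atMost)
    have "(UNIV - B) \<inter> {- c..c} = {- c..c} - B \<inter> {- c..c}"
      by auto
    also have "L2_ind \<dots> = L2_ind {- c..c} - L2_ind (B \<inter> {- c..c})"
      using lm[OF \<open>B \<in> sets borel\<close>] by (intro L2_ind_diff[symmetric]) auto
    finally show ?case
      using compl L2_ind_interval[of "- c" c] by (simp add: closure_L2_dense_diff)
  next
    case (union B)
    have Bm: "B i \<in> sets borel" for i
      using union(2) by (auto simp: borel_eq_atMost)
    define U where "U k = (\<Union>i<k. B i \<inter> {- c..c})" for k
    define V where "V = (\<Union>i. B i) \<inter> {- c..c}"
    have V: "V \<in> lmeasurable"
      unfolding V_def using Bm by (intro lm) auto
    have U: "U k \<in> lmeasurable" for k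
      unfolding U_def using Bm by (intro fmeasurable.finite_UN) (auto intro: lm)
    have "U k \<subseteq> V" for k
      by (auto simp: U_def V_def)
    have U_Suc: "L2_ind (U (Suc k)) = L2_ind (U k) + L2_ind (B k \<inter> {- c..c})" for k
    proof -
      have "U k \<inter> B k = {}"
        using union(1) unfolding U_def disjoint_family_on_def by (fastforce dest: less_imp_neq)
      then have "U (Suc k) - U k = B k \<inter> {- c..c}"
        by (auto simp: U_def less_Suc_eq)
      moreover have "U k \<subseteq> U (Suc k)"
        unfolding U_def by (intro UN_mono) auto
      ultimately show ?thesis
        using L2_ind_diff[OF U[of k] U[of "Suc k"]] by (simp add: algebra_simps)
    qed
    have mem: "L2_ind (U k) \<in> closure L2_dense" for k
    proof (induction k)
      case 0
      show ?case
        using L2_ind_interval[of 1 0] by (simp add: U_def)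
    next
      case (Suc k)
      then show ?case
        using union(3)[of k] unfolding U_Suc by (intro closure_L2_dense_add)
    qed
    have "(\<lambda>k. measure lebesgue (U k)) \<longlonglongrightarrow> measure lebesgue (\<Union>k. U k)"
    proof (rule Lim_measure_incseq)
      show "range U \<subseteq> sets lebesgue"
        using U by auto
      show "incseq U"
        unfolding U_def incseq_def by (intro allI impI UN_mono) auto
      have "(\<Union>k. U k) = V"
        by (auto simp: U_def V_def)
      then show "emeasure lebesgue (\<Union>k. U k) \<noteq> \<infinity>"
        using V by (auto simp: fmeasurable_def)
    qed
    moreover have "(\<Union>k. U k) = V"
      by (auto simp: U_def V_def)
    ultimately have "(\<lambda>k. sqrt (measure lebesgue V - measure lebesgue (U k))) \<longlonglongrightarrow>
        sqrt (measure lebesgue V - measure lebesgue V)"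
      by (intro tendsto_intros) auto
    moreover have "dist (L2_ind (U k)) (L2_ind V) = sqrt (measure lebesgue V - measure lebesgue (U k))" for k
    proof -
      have "measure lebesgue (V - U k) = measure lebesgue V - measure lebesgue (U k)"
        using U V \<open>U k \<subseteq> V\<close> by (intro measurable_measure_Diff) auto
      then show ?thesis
        using U V \<open>U k \<subseteq> V\<close>
        by (simp add: dist_norm norm_minus_commute[of "L2_ind (U k)"] L2_ind_diff norm_L2_ind fmeasurable.Diff)
    qed
    ultimately have "(\<lambda>k. L2_ind (U k)) \<longlonglongrightarrow> L2_ind V"
      by (subst tendsto_dist_iff) simp
    then have "L2_ind V \<in> closure L2_dense"
      using closed_sequentially[OF closed_closure[of L2_dense], of "\<lambda>k. L2_ind (U k)"] mem by blast
    then show ?case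
      by (simp add: V_def)
  qed
qed

lemma closure_L2_dense: "closure L2_dense = UNIV"
proof -
  have "f \<in> closure L2_dense" for f
  proof -
    obtain g where g [measurable]: "g \<in> borel_measurable lborel" and fg: "AE x in lborel. rep_L2 f x = g x"
      using completion_ex_borel_measurable_real[of "rep_L2 f" lborel] by auto
    have g_meas: "g \<in> borel_measurable lebesgue"
      using g by (rule measurable_completion)
    have fg': "AE x in lebesgue. rep_L2 f x = g x"
      using fg by (rule AE_completion)
    have "integrable lebesgue (\<lambda>x. (g x)\<^sup>2) \<longleftrightarrow> integrable lebesgue (\<lambda>x. (rep_L2 f x)\<^sup>2)"
    proof (rule integrable_cong_AE)
      show "AE x in lebesgue. (g x)\<^sup>2 = (rep_L2 f x)\<^sup>2"
        using fg' by eventually_elim simp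
    qed (use g_meas in \<open>auto intro!: borel_measurable_power rep_L2_measurable\<close>)
    then have g_sq: "sq_integrable g"
      using g_meas sq_integrable_power2[OF sq_integrable_rep[of f]] by (simp add: sq_integrable_def)
    have f_eq: "f = L2_of g"
      by (rule L2_eqI) (use fg' rep_L2_of[OF g_sq] in eventually_elim, simp)
    obtain s where s: "\<And>i. simple_function lborel (s i)" "\<And>x. (\<lambda>i. s i x) \<longlonglongrightarrow> g x"
      "\<And>i x. dist (s i x) 0 \<le> 2 * dist (g x) 0"
      using borel_measurable_implies_sequence_metric[OF g, of 0] by auto
    have s_meas: "s i \<in> borel_measurable lborel" for i
      using s(1) by (rule borel_measurable_simple_function)
    define t where "t i x = s i x * indicat_real {- real i..real i} x" for i x
    have t_sum: "t i = (\<lambda>x. \<Sum>y\<in>range (s i). y * indicat_real (s i -` {y} \<inter> {- real i..real i}) x)" for i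
    proof
      fix x
      have "(\<Sum>y\<in>range (s i). y * indicat_real (s i -` {y} \<inter> {- real i..real i}) x) =
          (\<Sum>y\<in>range (s i). if y = s i x then t i x else 0)"
        by (rule sum.cong) (auto simp: t_def indicator_def)
      also have "\<dots> = t i x"
        using s(1)[of i] by (simp add: simple_function_def)
      finally show "t i x = (\<Sum>y\<in>range (s i). y * indicat_real (s i -` {y} \<inter> {- real i..real i}) x)"
        by simp
    qed
    have B: "s i -` {y} \<in> sets borel" for i y
      using measurable_sets[OF s_meas[of i], of "{y}"] by simp
    have lm: "s i -` {y} \<inter> {- real i..real i} \<in> lmeasurable" for i y
      by (rule fmeasurableI2[of "{- real i..real i}"]) (use B in auto)
    have fin: "sq_integrable (\<lambda>x. \<Sum>y\<in>Y. y * indicat_real (s i -` {y} \<inter> {- real i..real i}) x) \<and>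
        L2_of (\<lambda>x. \<Sum>y\<in>Y. y * indicat_real (s i -` {y} \<inter> {- real i..real i}) x) \<in> closure L2_dense"
      if "finite Y" for Y i
      using that
    proof (induction Y)
      case empty
      have "L2_of (\<lambda>x. 0) = 0"
        using norm_L2_of[of "\<lambda>x. 0"] by simp
      then show ?case
        by (simp add: closure_L2_dense_0)
    next
      case (insert y Y)
      have "sq_integrable (\<lambda>x. y * indicat_real (s i -` {y} \<inter> {- real i..real i}) x)"
        by (intro sq_integrable_cmult sq_integrable_indicator lm)
      moreover have "L2_of (\<lambda>x. y * indicat_real (s i -` {y} \<inter> {- real i..real i}) x) \<in> closure L2_dense"
        by (subst L2_of_cmult)
          (auto simp: L2_ind_def[symmetric] intro!: sq_integrable_indicator lm closure_L2_dense_scale L2_ind_borel B)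
      ultimately show ?case
        using insert
        by (simp add: sq_integrable_add L2_of_add closure_L2_dense_add del: sum_mult_indicator indicator_simps)
    qed
    have t_sq: "sq_integrable (t i)" and t_mem: "L2_of (t i) \<in> closure L2_dense" for i
      using fin[of "range (s i)" i] s(1)[of i] by (simp_all add: t_sum simple_function_def)
    have t_lim: "(\<lambda>i. t i x) \<longlonglongrightarrow> g x" for x
    proof -
      obtain n where n: "\<bar>x\<bar> \<le> real n"
        using real_arch_simple by blast
      have "\<forall>\<^sub>F i in sequentially. s i x = t i x"
        using eventually_ge_at_top[of n]
      proof eventually_elim
        case (elim i)
        then have "\<bar>x\<bar> \<le> real i"
          using n by linarith
        then show ?case
          by (auto simp: t_def indicator_def)
      qed
      then show ?thesis
        by (rule Lim_transform_eventually[OF s(2)])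
    qed
    have t_bound: "(t i x - g x)\<^sup>2 \<le> 9 * (g x)\<^sup>2" for i x
    proof -
      have "\<bar>t i x\<bar> \<le> 2 * \<bar>g x\<bar>"
        using s(3)[of i x] by (auto simp: t_def indicator_def dist_real_def)
      then have "\<bar>t i x - g x\<bar> \<le> \<bar>3 * g x\<bar>"
        by linarith
      then have "(t i x - g x)\<^sup>2 \<le> (3 * g x)\<^sup>2"
        by (simp only: abs_le_square_iff)
      then show ?thesis
        by (simp add: power_mult_distrib)
    qed
    have "(\<lambda>i. LINT x|lebesgue. (t i x - g x)\<^sup>2) \<longlonglongrightarrow> (LINT x :: real|lebesgue. (0 :: real))"
    proof (rule integral_dominated_convergence[where w = "\<lambda>x. 9 * (g x)\<^sup>2"])
      show "integrable lebesgue (\<lambda>x. 9 * (g x)\<^sup>2)"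
        using g_sq by (simp add: sq_integrable_power2)
      show "AE x in lebesgue. (\<lambda>i. (t i x - g x)\<^sup>2) \<longlonglongrightarrow> 0"
      proof (intro AE_I2)
        fix x
        have "(\<lambda>i. (t i x - g x)\<^sup>2) \<longlonglongrightarrow> (g x - g x)\<^sup>2"
          by (intro tendsto_intros t_lim)
        then show "(\<lambda>i. (t i x - g x)\<^sup>2) \<longlonglongrightarrow> 0"
          by simp
      qed
      show "AE x in lebesgue. norm ((t i x - g x)\<^sup>2) \<le> 9 * (g x)\<^sup>2" for i
        using t_bound by (intro AE_I2) (simp only: real_norm_def abs_power2)
      show "(\<lambda>x. (t i x - g x)\<^sup>2) \<in> borel_measurable lebesgue" for i
        by (intro borel_measurable_power borel_measurable_diff g_meas sq_integrable_measurable t_sq)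
    qed simp
    then have "(\<lambda>i. sqrt (LINT x|lebesgue. (t i x - g x)\<^sup>2)) \<longlonglongrightarrow> sqrt 0"
      by (intro tendsto_real_sqrt) simp
    moreover have "sqrt (LINT x|lebesgue. (t i x - g x)\<^sup>2) = dist (L2_of (t i)) f" for i
      unfolding f_eq dist_norm L2_of_diff[OF t_sq g_sq, symmetric]
      by (rule norm_L2_of[OF sq_integrable_diff[OF t_sq g_sq], symmetric])
    ultimately have "(\<lambda>i. L2_of (t i)) \<longlonglongrightarrow> f"
      by (subst tendsto_dist_iff) simp
    then show ?thesis
      using closed_sequentially[OF closed_closure[of L2_dense], of "\<lambda>i. L2_of (t i)"] t_mem by blast
  qed
  then show ?thesis
    by blast
qed

instance L2 :: second_countable_topology
proof
  define \<B> where "\<B> = (\<lambda>(f :: L2, n). ball f (1 / real (Suc n))) ` (L2_dense \<times> UNIV)"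
  have "countable \<B>"
    unfolding \<B>_def by (intro countable_image countable_SIGMA countable_L2_dense) auto
  moreover have "topological_basis \<B>"
  proof (rule topological_basisI)
    show "open U" if "U \<in> \<B>" for U
      using that by (auto simp: \<B>_def)
    fix U :: "L2 set" and f assume "open U" "f \<in> U"
    then obtain e where e: "e > 0" "ball f e \<subseteq> U"
      using open_contains_ball by blast
    obtain n where n: "1 / real (Suc n) < e / 2"
      using nat_approx_posE[of "e / 2"] e by auto
    obtain g where g: "g \<in> L2_dense" "dist g f < 1 / real (Suc n)"
      using closure_approachable[of f L2_dense] closure_L2_dense
        zero_less_divide_1_iff[of "real (Suc n)"] of_nat_0_less_iff[of "Suc n"] by (metis UNIV_I zero_less_Suc)
    have "ball g (1 / real (Suc n)) \<subseteq> ball f e"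
    proof
      fix h assume "h \<in> ball g (1 / real (Suc n))"
      then have "dist g h < 1 / real (Suc n)"
        by simp
      then show "h \<in> ball f e"
        using dist_triangle[of f h g] g(2) n by (simp add: dist_commute del: of_nat_Suc)
    qed
    then show "\<exists>V\<in>\<B>. f \<in> V \<and> V \<subseteq> U"
      using e g by (intro bexI[of _ "ball g (1 / real (Suc n))"]) (auto simp: \<B>_def simp del: of_nat_Suc)
  qed
  ultimately show "\<exists>B :: L2 set set. countable B \<and> open = generate_topology B"
    by (blast intro: topological_basis_imp_subbasis)
qed


section \<open>Function spaces on the real line\<close>

definition in_Lp :: "real \<Rightarrow> (real \<Rightarrow> real) \<Rightarrow> bool" where
  "in_Lp p f \<longleftrightarrow> f \<in> borel_measurable lebesgue \<and> integrable lebesgue (\<lambda>x. \<bar>f x\<bar> powr p)"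

definition Lp_norm :: "real \<Rightarrow> (real \<Rightarrow> real) \<Rightarrow> real" where
  "Lp_norm p f = (LINT x|lebesgue. \<bar>f x\<bar> powr p) powr (1 / p)"

definition in_Linf :: "(real \<Rightarrow> real) \<Rightarrow> bool" where
  "in_Linf f \<longleftrightarrow> f \<in> borel_measurable lebesgue \<and> (\<exists>C. AE x in lebesgue. \<bar>f x\<bar> \<le> C)"

definition test_function :: "(real \<Rightarrow> real) \<Rightarrow> bool" where
  "test_function \<phi> \<longleftrightarrow>
     (\<forall>k x. (deriv ^^ k) \<phi> field_differentiable at x) \<and> compact (closure {x. \<phi> x \<noteq> 0})"

definition has_weak_deriv :: "nat \<Rightarrow> L2 \<Rightarrow> L2 \<Rightarrow> bool" where
  "has_weak_deriv k f g \<longleftrightarrow> (\<forall>\<phi>. test_function \<phi> \<longrightarrow>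
     (LINT x|lebesgue. rep_L2 f x * (deriv ^^ k) \<phi> x) = (- 1) ^ k * (LINT x|lebesgue. rep_L2 g x * \<phi> x))"

definition weak_deriv :: "nat \<Rightarrow> L2 \<Rightarrow> L2" where
  "weak_deriv k f = (THE g. has_weak_deriv k f g)"

text \<open>The Sobolev space \<open>H\<^sup>k(\<real>)\<close>.\<close>

definition sobolev :: "nat \<Rightarrow> L2 set" where
  "sobolev k = {f. \<forall>j\<le>k. \<exists>g. has_weak_deriv j f g}"

text \<open>Pointwise product of a function with a class; it is \<open>0\<close> if the product is not square
  integrable, which happens neither for an essentially bounded \<open>a\<close> nor for \<open>a\<close> in \<open>H\<^sup>1(\<real>)\<close>.\<close>

definition mult_L2 :: "(real \<Rightarrow> real) \<Rightarrow> L2 \<Rightarrow> L2" where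
  "mult_L2 a f = L2_of (\<lambda>x. a x * rep_L2 f x)"

section \<open>Semigroups\<close>

text \<open>A semigroup is a function on the whole real line of which only the values at
  \<open>t \<ge> 0\<close> are meaningful.\<close>

definition C0_semigroup :: "(real \<Rightarrow> 'a \<Rightarrow> 'a :: real_normed_vector) \<Rightarrow> bool" where
  "C0_semigroup S \<longleftrightarrow>
     (\<forall>t\<ge>0. bounded_linear (S t)) \<and> S 0 = id \<and>
     (\<forall>s\<ge>0. \<forall>t\<ge>0. S (s + t) = S s \<circ> S t) \<and>
     (\<forall>f. ((\<lambda>t. S t f) \<longlongrightarrow> f) (at_right 0))"

text \<open>Unbounded operators are given by their graphs.\<close>

definition generator :: "(real \<Rightarrow> 'a \<Rightarrow> 'a :: real_normed_vector) \<Rightarrow> ('a \<times> 'a) set" where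
  "generator S = {(f, g). ((\<lambda>h. (S h f - f) /\<^sub>R h) \<longlongrightarrow> g) (at_right 0)}"

definition A_op :: "(real \<Rightarrow> real) \<Rightarrow> (L2 \<times> L2) set" where
  "A_op lam0 = {(f, g). f \<in> sobolev 3 \<and> g = - weak_deriv 3 f + weak_deriv 2 f - mult_L2 lam0 f}"

section \<open>The delayed Korteweg-de Vries-Burgers equation\<close>

text \<open>\<open>C([0,T]; L\<^sup>2(\<real>)) \<inter> L\<^sup>2(0,T; H\<^sup>1(\<real>))\<close>. Measurability into \<open>H\<^sup>1(\<real>)\<close> and the norm of
  \<open>H\<^sup>1(\<real>)\<close> are those of the pair \<open>(f, f')\<close> in \<open>L\<^sup>2(\<real>) \<times> L\<^sup>2(\<real>)\<close>.\<close>

definition space_B :: "real \<Rightarrow> (real \<Rightarrow> L2) set" where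
  "space_B T = {u. continuous_on {0..T} u \<and>
     (AE t in lebesgue_on {0..T}. u t \<in> sobolev 1) \<and>
     (\<lambda>t. (u t, weak_deriv 1 (u t))) \<in> borel_measurable (lebesgue_on {0..T}) \<and>
     integrable (lebesgue_on {0..T}) (\<lambda>t. (norm (u t, weak_deriv 1 (u t)))\<^sup>2)}"

text \<open>A mild solution of \<open>u\<^sub>t + u\<^sub>x\<^sub>x\<^sub>x - u\<^sub>x\<^sub>x + lam0 u + lam u(t - \<tau>) + u u\<^sub>x = 0\<close> on \<open>[0,T]\<close> with the
  history \<open>u0\<close> on \<open>[-\<tau>,0]\<close>, where \<open>S\<close> is the semigroup generated by \<open>A_op lam0\<close>. The integrals
  are Bochner integrals in \<open>L\<^sup>2(\<real>)\<close>; that they exist is stated because the library integral of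
  a function that is not integrable is \<open>0\<close>.\<close>

definition mild_solution ::
  "real \<Rightarrow> (real \<Rightarrow> real) \<Rightarrow> (real \<Rightarrow> L2 \<Rightarrow> L2) \<Rightarrow> (real \<Rightarrow> L2) \<Rightarrow> real \<Rightarrow> (real \<Rightarrow> L2) \<Rightarrow> bool" where
  "mild_solution \<tau> lam S u0 T u \<longleftrightarrow>
     u \<in> space_B T \<and> (\<forall>s\<in>{- \<tau>..0}. u s = u0 s) \<and>
     (\<forall>t\<in>{0..T}.
        set_integrable lebesgue {0..t} (\<lambda>s. S (t - s) (mult_L2 lam (u (s - \<tau>)))) \<and>
        set_integrable lebesgue {0..t} (\<lambda>s. S (t - s) (mult_L2 (rep_L2 (u s)) (weak_deriv 1 (u s)))) \<and>
        u t = S t (u0 0)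
          - (LINT s:{0..t}|lebesgue. S (t - s) (mult_L2 lam (u (s - \<tau>))))
          - (LINT s:{0..t}|lebesgue. S (t - s) (mult_L2 (rep_L2 (u s)) (weak_deriv 1 (u s)))))"

definition global_mild_solution ::
  "real \<Rightarrow> (real \<Rightarrow> real) \<Rightarrow> (real \<Rightarrow> L2 \<Rightarrow> L2) \<Rightarrow> (real \<Rightarrow> L2) \<Rightarrow> (real \<Rightarrow> L2) \<Rightarrow> bool" where
  "global_mild_solution \<tau> lam S u0 u \<longleftrightarrow> (\<forall>T>0. mild_solution \<tau> lam S u0 T u)"

definition energy :: "real \<Rightarrow> (real \<Rightarrow> real) \<Rightarrow> (real \<Rightarrow> L2) \<Rightarrow> real \<Rightarrow> real" where
  "energy \<tau> lam u t =
     1 / 2 * (LINT x|lebesgue. (rep_L2 (u t) x)\<^sup>2) +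
     1 / 2 * (LINT s:{t - \<tau>..t}|lebesgue.
       LINT x|lebesgue. exp (- (t - s)) * \<bar>lam x\<bar> * (rep_L2 (u s) x)\<^sup>2)"

definition exponentially_stable ::
  "real \<Rightarrow> (real \<Rightarrow> real) \<Rightarrow> (real \<Rightarrow> L2 \<Rightarrow> L2) \<Rightarrow> bool" where
  "exponentially_stable \<tau> lam S \<longleftrightarrow>
     (\<exists>\<gamma>>0. \<forall>u0. continuous_on {- \<tau>..0} u0 \<longrightarrow>
       (\<exists>C. \<forall>u. global_mild_solution \<tau> lam S u0 u \<longrightarrow>
         (\<forall>t\<ge>0. energy \<tau> lam u t \<le> C * exp (- \<gamma> * t))))"

definition c_const :: "real \<Rightarrow> real" where
  "c_const p = (1 - 1 / (2 * p)) * (2 / p) powr (1 / (2 * p - 1))"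

end

theory Submission
  imports Defs "HOL-Computational_Algebra.Polynomial"
begin

text \<open>
  The theorem is an energy estimate. Everything rests on one inequality for the generator
  \<open>A v = - v\<^sub>x\<^sub>x\<^sub>x + v\<^sub>x\<^sub>x - \<lambda>\<^sub>0 v\<close>. The dispersive term is skew and the diffusive one gives \<open>- |v\<^sub>x|\<^sup>2\<close>. The
  hypotheses bound \<open>(e\<^sup>\<tau> + 1)/2 |\<lambda>| - \<lambda>\<^sub>0\<close> by \<open>\<alpha> - \<alpha>\<^sub>0 + \<beta> + \<beta>\<^sub>0\<close>, and the Gagliardo-Nirenberg and Young
  inequalities bound the integral of \<open>|\<beta> + \<beta>\<^sub>0| v\<^sup>2\<close> by \<open>|v\<^sub>x|\<^sup>2 + K |v|\<^sup>2\<close>, where \<open>K\<close> is the constant that is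
  subtracted in the decay rate (\<open>potential_form_bound\<close>). The gradient cancels, and \<open>\<langle>A v, v\<rangle> \<le> - Q v\<close> with
  \<open>Q v = (e\<^sup>\<tau> + 1)/2 \<integral> |\<lambda>| v\<^sup>2 + c |v|\<^sup>2\<close> and \<open>c = \<alpha>\<^sub>0 - \<alpha> - K > 0\<close> (\<open>A_op_dissipative\<close>). Because \<open>Q\<close> is continuous on
  \<open>L\<^sup>2(\<real>)\<close>, this inequality can be carried to limits of smooth solutions without any compactness or
  semicontinuity argument for gradients.

  A mild solution need not be differentiable in time, so the equation is not multiplied by \<open>u\<close>. Instead
  \<open>semigroup_dissipation\<close> integrates \<open>\<langle>A v, v\<rangle> \<le> - Q v\<close> along the orbits of the semigroup, and \<open>mild_energy_inequality\<close>
  compares \<open>u\<close> with such orbits on the cells of a partition in time; as the mesh tends to \<open>0\<close>,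
  \<open>|u(b)|\<^sup>2 - |u(a)|\<^sup>2 \<le> \<integral> - 2 Q(u) + 2 \<langle>u, f\<rangle>\<close> over \<open>{a..b}\<close>, where \<open>f\<close> collects the delayed and the nonlinear term.

  In this inequality the nonlinear term vanishes, as \<open>\<integral> u\<^sup>2 u\<^sub>x = 0\<close> (\<open>burgers_term\<close>). The delayed product is
  split by Young's inequality with the weights \<open>e\<^sup>\<tau>\<close> and \<open>e\<^sup>-\<^sup>\<tau>\<close>; then the delay part of the energy
  compensates \<open>u(t - \<tau>)\<close> exactly, and the energy \<open>\<E>\<close> satisfies \<open>\<E>(T) - \<E>(a) \<le> - \<gamma> \<integral> \<E>\<close> over \<open>{a..T}\<close>
  (\<open>delayed_energy_decay\<close>). A Gronwall argument gives the exponential decay.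

  The facts about Sobolev functions (the sup bound, integration by parts, the cubic integral) are obtained
  by mollification: testing the weak derivative with \<open>y \<mapsto> \<phi> (x - y)\<close> shows that mollifying commutes with
  differentiation, and mollifications converge in \<open>L\<^sup>2(\<real>)\<close> because translations are continuous there.
\<close>

section \<open>Strongly continuous semigroups\<close>

text \<open>The sets \<open>E k\<close> on which the whole family is bounded by \<open>k\<close> are closed and cover the space, so by
  Baire one of them contains a ball; differences of points of that ball give a bound on the unit ball.\<close>

lemma uniform_boundedness_principle:
  fixes T :: "nat \<Rightarrow> 'a::banach \<Rightarrow> 'b::real_normed_vector"
  assumes lin: "\<And>n. bounded_linear (T n)" and bdd: "\<And>x. \<exists>B. \<forall>n. norm (T n x) \<le> B"
  shows "\<exists>M. \<forall>n x. norm (T n x) \<le> M * norm x"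
proof -
  define E where "E k = {x. \<forall>n. norm (T n x) \<le> real k}" for k
  have cont: "continuous_on UNIV (T n)" for n
    using lin by (simp add: linear_continuous_on)
  have "E k = (\<Inter>n. {x. norm (T n x) \<le> real k})" for k
    by (auto simp: E_def)
  then have "closed (E k)" for k
    by (simp add: closed_INT closed_Collect_le cont continuous_on_norm)
  moreover have "\<Union>(range E) = UNIV"
  proof (intro equalityI subsetI UNIV_I)
    fix x
    obtain B where "\<forall>n. norm (T n x) \<le> B" using bdd by blast
    moreover obtain k where "B \<le> real k" using real_arch_simple by blast
    ultimately have "x \<in> E k" unfolding E_def by (auto intro: order_trans)
    then show "x \<in> \<Union>(range E)" by blast
  qed
  ultimately have "\<exists>k. interior (E k) \<noteq> {}"
    using Met_TC.metric_Baire_category_alt[of "range E"] by (auto simp: complete_UNIV)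
  then obtain k x0 where "x0 \<in> interior (E k)" by blast
  then obtain r where r: "r > 0" "cball x0 r \<subseteq> E k"
    unfolding mem_interior_cball by blast
  have "norm (T n x) \<le> (2 * real k / r) * norm x" for n x
  proof (cases "x = 0")
    case True
    then show ?thesis using lin[of n] by (simp add: linear_simps)
  next
    case False
    define c where "c = r / norm x"
    have c: "c > 0" using False r by (simp add: c_def)
    have "x0 + c *\<^sub>R x \<in> cball x0 r" "x0 \<in> cball x0 r"
      using False r by (auto simp: dist_norm c_def)
    then have "norm (T n (x0 + c *\<^sub>R x)) \<le> real k" "norm (T n x0) \<le> real k"
      using r(2) unfolding E_def by blast+
    then have "norm (T n (x0 + c *\<^sub>R x) - T n x0) \<le> 2 * real k"
      by (smt (verit) norm_triangle_ineq4)
    also have "T n (x0 + c *\<^sub>R x) - T n x0 = c *\<^sub>R T n x"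
      using lin[of n] by (simp add: linear_simps)
    finally have "c * norm (T n x) \<le> 2 * real k" using c by simp
    then show ?thesis using c False r(1)
      by (simp add: c_def field_simps)
  qed
  then show ?thesis by blast
qed

lemma C0_semigroupD:
  assumes "C0_semigroup S"
  shows "t \<ge> 0 \<Longrightarrow> bounded_linear (S t)" "S 0 x = x"
    "s \<ge> 0 \<Longrightarrow> t \<ge> 0 \<Longrightarrow> S (s + t) x = S s (S t x)"
    "((\<lambda>t. S t x) \<longlongrightarrow> x) (at_right 0)"
  using assms unfolding C0_semigroup_def by auto

text \<open>Strong continuity is only pointwise in the vector. If the norms were unbounded near \<open>0\<close>, they would be
  unbounded along a sequence \<open>t n \<rightarrow> 0\<close>; but \<open>S (t n) y\<close> converges for every \<open>y\<close>, which contradicts uniform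
  boundedness.\<close>

lemma C0_semigroup_bounded_near_0:
  fixes S :: "real \<Rightarrow> 'a::banach \<Rightarrow> 'a"
  assumes S: "C0_semigroup S"
  shows "\<exists>d>0. \<exists>M. \<forall>t\<in>{0..d}. \<forall>x. norm (S t x) \<le> M * norm x"
proof (rule ccontr)
  assume neg: "\<not> ?thesis"
  have "\<exists>t x. t \<in> {0..1 / real (Suc n)} \<and> norm (S t x) > real n * norm x" for n
    using neg[simplified, rule_format, of "1 / real (Suc n)" "real n"]
    by (auto simp: not_le simp del: of_nat_Suc)
  then obtain t x where t: "\<And>n. t n \<in> {0..1 / real (Suc n)}"
    and x: "\<And>n. norm (S (t n) (x n)) > real n * norm (x n)" by metis
  have t0: "t \<longlonglongrightarrow> 0"
  proof (rule tendsto_sandwich[OF _ _ tendsto_const])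
    show "(\<lambda>n. 1 / real (Suc n)) \<longlonglongrightarrow> 0" by (rule LIMSEQ_Suc[OF lim_1_over_n])
  qed (use t in \<open>auto intro: always_eventually\<close>)
  have conv: "(\<lambda>n. S (t n) y) \<longlonglongrightarrow> y" for y
  proof -
    have "((\<lambda>r. S r y) \<longlongrightarrow> y) (at 0 within {0..})"
      using C0_semigroupD(4)[OF S, of y] at_within_Ici_at_right[of "0::real"] by simp
    then have "continuous (at 0 within {0..}) (\<lambda>r. S r y)"
      by (simp add: continuous_within C0_semigroupD(2)[OF S])
    then show ?thesis
      using t t0 C0_semigroupD(2)[OF S] by (auto simp: continuous_within_sequentially o_def)
  qed
  have "\<exists>M. \<forall>n y. norm (S (t n) y) \<le> M * norm y"
  proof (rule uniform_boundedness_principle)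
    show "bounded_linear (S (t n))" for n using C0_semigroupD(1)[OF S] t[of n] by auto
    show "\<exists>B. \<forall>n. norm (S (t n) y) \<le> B" for y
      using convergent_imp_Bseq[of "\<lambda>n. S (t n) y"] conv[of y]
      by (auto simp: convergent_def Bseq_def)
  qed
  then obtain M where M: "\<And>n y. norm (S (t n) y) \<le> M * norm y" by blast
  obtain n where "M \<le> real n" using real_arch_simple by blast
  then have "M * norm (x n) \<le> real n * norm (x n)" by (rule mult_right_mono) simp
  then show False using x[of n] M[of n "x n"] by linarith
qed

text \<open>The semigroup law propagates the bound on \<open>{0..d}\<close> to \<open>{0..T}\<close> in finitely many steps.\<close>

lemma C0_semigroup_locally_bounded:
  fixes S :: "real \<Rightarrow> 'a::banach \<Rightarrow> 'a"
  assumes S: "C0_semigroup S"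
  obtains M where "M \<ge> 1" "\<And>t x. t \<in> {0..T} \<Longrightarrow> norm (S t x) \<le> M * norm x"
proof -
  obtain d M0 where d: "d > 0" and M0: "\<And>t x. t \<in> {0..d} \<Longrightarrow> norm (S t x) \<le> M0 * norm x"
    using C0_semigroup_bounded_near_0[OF S] by blast
  define M where "M = max M0 1"
  have M: "norm (S t x) \<le> M * norm x" if "t \<in> {0..d}" for t x
    using M0[OF that, of x] mult_right_mono[of M0 M "norm x"] by (simp add: M_def)
  have iter: "norm (S t x) \<le> M ^ Suc n * norm x" if "t \<in> {0..real (Suc n) * d}" for n t x
    using that
  proof (induction n arbitrary: t)
    case 0
    then show ?case using M by simp
  next
    case (Suc n)
    show ?case
    proof (cases "t \<le> d")
      case True
      have "M * 1 \<le> M ^ Suc (Suc n)"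
        unfolding power_Suc[of M "Suc n"] by (intro mult_left_mono one_le_power) (auto simp: M_def)
      then show ?thesis
        using M[of t x] True Suc.prems mult_right_mono[of M "M ^ Suc (Suc n)" "norm x"] by simp
    next
      case False
      then have "S t x = S d (S (t - d) x)"
        using C0_semigroupD(3)[OF S, of d "t - d" x] d by simp
      also have "norm \<dots> \<le> M * norm (S (t - d) x)" using M d by simp
      also have "\<dots> \<le> M * (M ^ Suc n * norm x)"
        using Suc False by (intro mult_left_mono Suc.IH) (auto simp: algebra_simps M_def)
      finally show ?thesis by (simp add: mult.assoc)
    qed
  qed
  obtain n where n: "T / d \<le> real n" using real_arch_simple by blast
  have "T \<le> real (Suc n) * d" using n d by (simp add: field_simps)
  then show thesis
    using iter[of _ n] by (intro that[of "M ^ Suc n"] one_le_power) (auto simp: M_def)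
qed

text \<open>Joint continuity. Continuity from the left at \<open>t0\<close> also follows from continuity at \<open>0\<close>, because
  \<open>S t0 x - S t x = S t (S (t0 - t) x - x)\<close> and the norms of \<open>S t\<close> are bounded near \<open>t0\<close>.\<close>

lemma C0_semigroup_tendsto:
  fixes S :: "real \<Rightarrow> 'a::banach \<Rightarrow> 'a"
  assumes S: "C0_semigroup S" and t: "t \<longlonglongrightarrow> t0" "\<And>n. t n \<ge> 0" and x: "x \<longlonglongrightarrow> x0"
  shows "(\<lambda>n. S (t n) (x n)) \<longlonglongrightarrow> S t0 x0"
proof -
  have t0: "t0 \<ge> 0" using t by (intro LIMSEQ_le_const[of t t0 0]) auto
  obtain B where B: "\<And>n. t n \<le> B"
    using convergent_imp_Bseq[of t] t(1) by (auto simp: convergent_def Bseq_def abs_le_iff)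
  have t0B: "t0 \<le> B" by (rule LIMSEQ_le_const2[OF t(1)]) (use B in auto)
  obtain M where M: "M \<ge> 1" "\<And>t x. t \<in> {0..B} \<Longrightarrow> norm (S t x) \<le> M * norm x"
    by (rule C0_semigroup_locally_bounded[OF S, of B]) blast
  have lin: "bounded_linear (S r)" if "r \<ge> 0" for r using C0_semigroupD(1)[OF S that] .
  \<comment> \<open>The larger of \<open>t n\<close> and \<open>t0\<close> is the smaller one plus \<open>d n\<close>, whichever side \<open>t n\<close> lies on.\<close>
  define d where "d = (\<lambda>n. \<bar>t n - t0\<bar>)"
  have d: "d \<longlonglongrightarrow> 0" "\<And>n. d n \<ge> 0" 
    using tendsto_rabs_zero[OF LIM_zero[OF t(1)]] by (simp_all add: d_def)
  have conv: "(\<lambda>n. S (d n) x0) \<longlonglongrightarrow> x0"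
  proof -
    have "((\<lambda>r. S r x0) \<longlongrightarrow> x0) (at 0 within {0..})"
      using C0_semigroupD(4)[OF S, of x0] at_within_Ici_at_right[of "0::real"] by simp
    then have "continuous (at 0 within {0..}) (\<lambda>r. S r x0)"
      by (simp add: continuous_within C0_semigroupD(2)[OF S])
    then show ?thesis
      using d C0_semigroupD(2)[OF S] by (auto simp: continuous_within_sequentially o_def)
  qed
  have bound: "norm (S (t n) (x n) - S t0 x0) \<le> M * norm (x n - x0) + M * norm (S (d n) x0 - x0)" for n
  proof -
    have "norm (S (t n) (x n) - S (t n) x0) \<le> M * norm (x n - x0)"
      using M(2)[of "t n" "x n - x0"] t(2)[of n] B lin[OF t(2)[of n]] by (simp add: linear_simps)
    moreover have "norm (S (t n) x0 - S t0 x0) \<le> M * norm (S (d n) x0 - x0)"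
    proof (cases "t n \<ge> t0")
      case True
      then have "S (t n) x0 = S t0 (S (d n) x0)"
        using C0_semigroupD(3)[OF S t0, of "d n" x0] by (simp add: d_def)
      then show ?thesis
        using M(2)[of t0 "S (d n) x0 - x0"] t0 t0B lin[OF t0] by (simp add: linear_simps)
    next
      case False
      then have "S t0 x0 = S (t n) (S (d n) x0)"
        using C0_semigroupD(3)[OF S t(2), of "d n" n x0] by (simp add: d_def)
      then show ?thesis
        using M(2)[of "t n" "S (d n) x0 - x0"] t(2)[of n] B lin[OF t(2)[of n]]
        by (simp add: linear_simps norm_minus_commute)
    qed
    ultimately show ?thesis
      using norm_triangle_ineq[of "S (t n) (x n) - S (t n) x0" "S (t n) x0 - S t0 x0"] by simp
  qed
  have "(\<lambda>n. M * norm (x n - x0) + M * norm (S (d n) x0 - x0)) \<longlonglongrightarrow> M * 0 + M * 0"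
    using x conv by (intro tendsto_intros tendsto_norm_zero LIM_zero)
  then have "(\<lambda>n. S (t n) (x n) - S t0 x0) \<longlonglongrightarrow> 0"
    by (intro Lim_null_comparison[OF always_eventually[OF allI[OF bound]]]) simp
  then show ?thesis by (rule LIM_zero_cancel)
qed

lemma C0_semigroup_continuous_on:
  fixes S :: "real \<Rightarrow> 'a::banach \<Rightarrow> 'a"
  assumes S: "C0_semigroup S"
  shows "continuous_on {0..} (\<lambda>t. S t x)"
  unfolding continuous_on_sequentially o_def
  using C0_semigroup_tendsto[OF S _ _ tendsto_const] by auto


section \<open>Dissipative semigroups\<close>

text \<open>The generator is defined by one-sided difference quotients; this is the form in which a derivative
  enters it.\<close>

lemma has_vector_derivative_right_quotient:
  assumes "(y has_vector_derivative y') (at r)"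
  shows "((\<lambda>q. (y (r + q) - y r) /\<^sub>R q) \<longlongrightarrow> y') (at_right 0)"
proof -
  have "((\<lambda>q. norm (y (r + q) - y r - q *\<^sub>R y') / norm q) \<longlongrightarrow> 0) (at 0)"
    using assms unfolding has_vector_derivative_def has_derivative_at by blast
  then have "((\<lambda>q. norm (y (r + q) - y r - q *\<^sub>R y') / norm q) \<longlongrightarrow> 0) (at_right 0)"
    by (rule tendsto_within_subset) simp
  moreover have "norm (y (r + q) - y r - q *\<^sub>R y') / norm q = norm ((y (r + q) - y r) /\<^sub>R q - y')"
    if "q > 0" for q :: real
  proof -
    have "(y (r + q) - y r) /\<^sub>R q - y' = (y (r + q) - y r - q *\<^sub>R y') /\<^sub>R q"
      using that by (simp add: scaleR_diff_right)
    then show ?thesis using that by (simp add: divide_inverse mult.commute)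
  qed
  then have "\<forall>\<^sub>F q in at_right 0. norm (y (r + q) - y r - q *\<^sub>R y') / norm q
      = norm ((y (r + q) - y r) /\<^sub>R q - y')"
    by (auto simp: eventually_at_filter)
  ultimately have "((\<lambda>q. norm ((y (r + q) - y r) /\<^sub>R q - y')) \<longlongrightarrow> 0) (at_right 0)"
    by (rule Lim_transform_eventually)
  then show ?thesis
    by (rule LIM_zero_cancel[OF tendsto_norm_zero_cancel])
qed

text \<open>Sliding averages of an orbit are differentiable and recover the orbit as the window shrinks. They
  replace the orbits of arbitrary vectors, which need not be differentiable.\<close>

lemma integral_continuous_deriv:
  fixes s :: "real \<Rightarrow> 'a::banach"
  assumes s: "continuous_on UNIV s" and "h \<ge> 0"
  shows "((\<lambda>r. integral {r..r + h} s) has_vector_derivative (s (r + h) - s r)) (at r)"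
    and "((\<lambda>h. integral {r..r + h} s /\<^sub>R h) \<longlongrightarrow> s r) (at_right 0)"
proof -
  have sub: "continuous_on {a..b} s" for a b using s continuous_on_subset by blast
  define a where "a = min r (r + h) - 1"
  define J where "J x = integral {a..x} s" for x
  have J: "(J has_vector_derivative s x) (at x)" if "x > a" for x
  proof -
    have "(J has_vector_derivative s x) (at x within {a..x + 1})"
      unfolding J_def using that by (intro integral_has_vector_derivative sub) auto
    then show ?thesis using that at_within_Icc_at[of a x "x + 1"] by simp
  qed
  have "((\<lambda>x. x + h) has_vector_derivative 1) (at r)"
    by (auto intro!: derivative_eq_intros)
  moreover have "(J has_vector_derivative s (r + h)) (at (r + h))"
    by (rule J) (simp add: a_def)
  ultimately have "(J \<circ> (\<lambda>x. x + h) has_vector_derivative 1 *\<^sub>R s (r + h)) (at r)"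
    by (rule vector_diff_chain_at)
  then have "((\<lambda>x. J (x + h)) has_vector_derivative s (r + h)) (at r)"
    by (simp add: o_def)
  then have D: "((\<lambda>x. J (x + h) - J x) has_vector_derivative s (r + h) - s r) (at r)"
    using J[of r] by (intro has_vector_derivative_diff) (auto simp: a_def)
  have eq: "J (x + k) - J x = integral {x..x + k} s" if "x > a" "k \<ge> 0" for x k
  proof -
    have "J x + integral {x..x + k} s = J (x + k)"
      unfolding J_def
      by (rule Henstock_Kurzweil_Integration.integral_combine)
        (use that in \<open>auto intro: integrable_continuous_real[OF sub]\<close>)
    then show ?thesis by (simp add: algebra_simps)
  qed
  show "((\<lambda>r. integral {r..r + h} s) has_vector_derivative (s (r + h) - s r)) (at r)"
  proof (rule has_vector_derivative_transform_within_open[OF D])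
    show "r \<in> {a<..}" by (simp add: a_def)
    show "J (x + h) - J x = integral {x..x + h} s" if "x \<in> {a<..}" for x
      using that assms by (intro eq) auto
  qed auto
  have "((\<lambda>q. (J (r + q) - J r) /\<^sub>R q) \<longlongrightarrow> s r) (at_right 0)"
    by (intro has_vector_derivative_right_quotient J) (auto simp: a_def)
  then show "((\<lambda>h. integral {r..r + h} s /\<^sub>R h) \<longlongrightarrow> s r) (at_right 0)"
  proof (rule Lim_transform_eventually)
    have "J (r + k) - J r = integral {r..r + k} s" if "k > 0" for k
      using eq[of r k] that by (simp add: a_def)
    then show "\<forall>\<^sub>F k in at_right 0. (J (r + k) - J r) /\<^sub>R k = integral {r..r + k} s /\<^sub>R k"
      using eventually_at_right_less[of "0 :: real"] by (auto elim!: eventually_mono)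
  qed
qed

lemma semigroup_integral_orbit:
  fixes S :: "real \<Rightarrow> 'a::banach \<Rightarrow> 'a"
  assumes S: "C0_semigroup S" and rq: "r \<ge> 0" "q \<ge> 0"
  shows "S q (integral {r..r + h} (\<lambda>x. S x w)) = integral {r + q..r + q + h} (\<lambda>x. S x w)"
proof -
  have cont: "continuous_on {a..b} (\<lambda>x. S x w)" if "a \<ge> 0" for a b
    using C0_semigroup_continuous_on[OF S] by (rule continuous_on_subset) (use that in auto)
  have lin: "bounded_linear (S q)" using C0_semigroupD(1)[OF S] rq by simp
  have "((\<lambda>x. S x w) has_integral integral {r + q..r + q + h} (\<lambda>x. S x w)) (cbox (r + q) (r + q + h))"
    using integrable_integral[OF integrable_continuous_real[OF cont]] rq by simp
  from has_integral_affinity'[OF this, of 1 q]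
  have "((\<lambda>x. S (x + q) w) has_integral integral {r + q..r + q + h} (\<lambda>x. S x w)) {r..r + h}"
    by (simp add: algebra_simps)
  then have *: "((S q \<circ> (\<lambda>x. S x w)) has_integral integral {r + q..r + q + h} (\<lambda>x. S x w)) {r..r + h}"
  proof (rule has_integral_eq[rotated])
    fix x assume "x \<in> {r..r + h}"
    then show "S (x + q) w = (S q \<circ> (\<lambda>x. S x w)) x"
      using C0_semigroupD(3)[OF S, of q x w] rq by (simp add: add.commute)
  qed
  have "((S q \<circ> (\<lambda>x. S x w)) has_integral S q (integral {r..r + h} (\<lambda>x. S x w))) {r..r + h}"
    using integrable_integral[OF integrable_continuous_real[OF cont[OF rq(1)]]] lin
    by (intro has_integral_linear)
  from has_integral_unique[OF this *] show ?thesis .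
qed

text \<open>For \<open>w\<close> in the domain of the generator one integrates
  \<open>d/dr |S r w|\<^sup>2 = 2 \<langle>A S r w, S r w\<rangle> \<le> - 2 Q (S r w)\<close>. The averaged orbit
  \<open>y h r = (1/h) \<integral>\<^sub>r\<^sup>r\<^sup>+\<^sup>h S x w dx\<close> lies in that domain for every \<open>w\<close>, since \<open>S q (y h r) = y h (r + q)\<close> is
  differentiable in \<open>q\<close>. As \<open>Q\<close> is continuous on the whole space, the estimate survives \<open>h \<rightarrow> 0\<close>.\<close>

lemma semigroup_dissipation:
  fixes S :: "real \<Rightarrow> 'a::{real_inner,banach} \<Rightarrow> 'a"
  assumes S: "C0_semigroup S"
    and gen: "\<And>v g. (v, g) \<in> generator S \<Longrightarrow> inner g v \<le> - Q v"
    and Q: "continuous_on UNIV Q" "\<And>v. \<bar>Q v\<bar> \<le> C * (norm v)\<^sup>2" and t: "t \<ge> 0"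
  shows "(norm (S t w))\<^sup>2 \<le> (norm w)\<^sup>2 - 2 * integral {0..t} (\<lambda>r. Q (S r w))"
proof -
  \<comment> \<open>The orbit is made constant on the negative axis, so that derivatives at \<open>0\<close> can be two-sided.\<close>
  define s where "s r = S (max r 0) w" for r
  have s: "continuous_on UNIV s"
    unfolding s_def
    by (rule continuous_on_compose2[OF C0_semigroup_continuous_on[OF S, of w]]) (auto intro!: continuous_intros)
  define y where "y h r = integral {r..r + h} s /\<^sub>R h" for h r :: real
  have y_deriv: "(y h has_vector_derivative (s (r + h) - s r) /\<^sub>R h) (at r)" if "h > 0" for h r
    unfolding y_def
    by (rule bounded_linear.has_vector_derivative[OF bounded_linear_scaleR_right integral_continuous_deriv(1)[OF s]])
      (use that in auto)
  have y_cont: "continuous_on A (y h)" if "h > 0" for h A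
    using y_deriv[OF that] has_vector_derivative_continuous continuous_at_imp_continuous_on by blast
  have y_shift: "S q (y h r) = y h (r + q)" if "h > 0" "r \<ge> 0" "q \<ge> 0" for h r q
  proof -
    have "integral {a..b} s = integral {a..b} (\<lambda>x. S x w)" if "a \<ge> 0" for a b
      by (rule integral_cong) (use that in \<open>auto simp: s_def\<close>)
    then show ?thesis
      using semigroup_integral_orbit[OF S, of r q h w] that C0_semigroupD(1)[OF S, of q]
      by (simp add: y_def linear_simps)
  qed
  have y_gen: "(y h r, (s (r + h) - s r) /\<^sub>R h) \<in> generator S" if "h > 0" "r \<ge> 0" for h r
  proof -
    have "((\<lambda>q. (y h (r + q) - y h r) /\<^sub>R q) \<longlongrightarrow> (s (r + h) - s r) /\<^sub>R h) (at_right 0)"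
      by (rule has_vector_derivative_right_quotient[OF y_deriv[OF \<open>h > 0\<close>]])
    then have "((\<lambda>q. (S q (y h r) - y h r) /\<^sub>R q) \<longlongrightarrow> (s (r + h) - s r) /\<^sub>R h) (at_right 0)"
      by (rule Lim_transform_eventually) (auto simp: eventually_at_filter y_shift that)
    then show ?thesis unfolding generator_def by simp
  qed
  have ineq: "(norm (y h t))\<^sup>2 \<le> (norm (y h 0))\<^sup>2 - 2 * integral {0..t} (\<lambda>r. Q (y h r))" if "h > 0" for h
  proof -
    have FTC: "((\<lambda>r. 2 * inner ((s (r + h) - s r) /\<^sub>R h) (y h r)) has_integral
        (norm (y h t))\<^sup>2 - (norm (y h 0))\<^sup>2) {0..t}"
      unfolding power2_norm_eq_inner
    proof (rule fundamental_theorem_of_calculus[OF t])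
      fix r :: real
      have "((\<lambda>r. inner (y h r) (y h r)) has_derivative
          (\<lambda>x. inner (y h r) (x *\<^sub>R ((s (r + h) - s r) /\<^sub>R h)) +
               inner (x *\<^sub>R ((s (r + h) - s r) /\<^sub>R h)) (y h r))) (at r)"
        using y_deriv[OF that, of r] unfolding has_vector_derivative_def
        by (intro has_derivative_inner)
      then have "((\<lambda>r. inner (y h r) (y h r)) has_vector_derivative
          2 * inner ((s (r + h) - s r) /\<^sub>R h) (y h r)) (at r)"
        unfolding has_vector_derivative_def
        by (rule has_derivative_eq_rhs) (simp add: inner_commute algebra_simps fun_eq_iff)
      then show "((\<lambda>r. inner (y h r) (y h r)) has_vector_derivative
          2 * inner ((s (r + h) - s r) /\<^sub>R h) (y h r)) (at r within {0..t})"
        by (rule has_vector_derivative_at_within)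
    qed
    have "continuous_on {0..t} (\<lambda>r. - 2 * Q (y h r))"
      by (intro continuous_intros continuous_on_compose2[OF Q(1)] y_cont[OF that]) auto
    then have "((\<lambda>r. - 2 * Q (y h r)) has_integral integral {0..t} (\<lambda>r. - 2 * Q (y h r))) {0..t}"
      by (intro integrable_integral integrable_continuous_real)
    from has_integral_le[OF FTC this]
    have "(norm (y h t))\<^sup>2 - (norm (y h 0))\<^sup>2 \<le> integral {0..t} (\<lambda>r. - 2 * Q (y h r))"
      using gen[OF y_gen[OF that]] by (auto simp del: inner_scaleR_left)
    then show ?thesis by simp
  qed
  obtain M where M: "M \<ge> 1" "\<And>r x. r \<in> {0..t + 1} \<Longrightarrow> norm (S r x) \<le> M * norm x"
    by (rule C0_semigroup_locally_bounded[OF S, of "t + 1"]) blast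
  have y_bound: "norm (y h r) \<le> M * norm w" if "0 < h" "h \<le> 1" "r \<in> {0..t}" for h r
  proof -
    have "norm (integral {r..r + h} s) \<le> (M * norm w) * (r + h - r)"
      by (rule integral_bound) (use that M(2) s in \<open>auto simp: s_def intro: continuous_on_subset\<close>)
    then show ?thesis using that by (simp add: y_def field_simps)
  qed
  define k where "k = (\<lambda>n. 1 / real (Suc n))"
  have k: "k n > 0" "k n \<le> 1" for n by (auto simp: k_def)
  have k_lim: "filterlim k (at_right 0) sequentially"
  proof -
    have "k \<longlonglongrightarrow> 0"
      unfolding k_def by (rule LIMSEQ_Suc[OF lim_1_over_n])
    then show ?thesis
      unfolding filterlim_at using k(1) by (auto intro!: always_eventually simp: less_imp_neq[OF k(1), symmetric])
  qed
  have y_lim: "(\<lambda>n. y (k n) r) \<longlonglongrightarrow> s r" for r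
    unfolding y_def by (rule filterlim_compose[OF integral_continuous_deriv(2)[OF s order_refl] k_lim])
  have Q_lim: "(\<lambda>n. Q (y (k n) r)) \<longlonglongrightarrow> Q (s r)" for r
    by (rule continuous_on_tendsto_compose[OF Q(1) y_lim]) auto
  have int_lim: "(\<lambda>n. integral {0..t} (\<lambda>r. Q (y (k n) r))) \<longlonglongrightarrow> integral {0..t} (\<lambda>r. Q (s r))"
  proof (rule dominated_convergence)
    show "(\<lambda>r. Q (y (k n) r)) integrable_on {0..t}" for n
      by (intro integrable_continuous_real continuous_on_compose2[OF Q(1)] y_cont k) auto
    show "(\<lambda>r. \<bar>C\<bar> * (M * norm w)\<^sup>2) integrable_on {0..t}"
      by (intro integrable_continuous_real continuous_intros)
    show "norm (Q (y (k n) r)) \<le> \<bar>C\<bar> * (M * norm w)\<^sup>2" if "r \<in> {0..t}" for n r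
    proof -
      have "norm (Q (y (k n) r)) \<le> \<bar>C\<bar> * (norm (y (k n) r))\<^sup>2"
        using order_trans[OF Q(2)[of "y (k n) r"] mult_right_mono[OF abs_ge_self]] by simp
      also have "\<dots> \<le> \<bar>C\<bar> * (M * norm w)\<^sup>2"
        using y_bound[OF k that] by (intro mult_left_mono power_mono) auto
      finally show ?thesis .
    qed
  qed (rule Q_lim)
  have "(norm (s t))\<^sup>2 \<le> (norm (s 0))\<^sup>2 - 2 * integral {0..t} (\<lambda>r. Q (s r))"
  proof (rule LIMSEQ_le)
    show "(\<lambda>n. (norm (y (k n) t))\<^sup>2) \<longlonglongrightarrow> (norm (s t))\<^sup>2"
      by (intro tendsto_intros y_lim)
    show "(\<lambda>n. (norm (y (k n) 0))\<^sup>2 - 2 * integral {0..t} (\<lambda>r. Q (y (k n) r))) \<longlonglongrightarrow>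
        (norm (s 0))\<^sup>2 - 2 * integral {0..t} (\<lambda>r. Q (s r))"
      by (intro tendsto_intros y_lim int_lim)
  qed (use ineq k in blast)
  moreover have "integral {0..t} (\<lambda>r. Q (s r)) = integral {0..t} (\<lambda>r. Q (S r w))"
    by (rule integral_cong) (simp add: s_def)
  ultimately show ?thesis using t C0_semigroupD(2)[OF S] by (simp add: s_def)
qed


section \<open>The energy inequality for mild solutions\<close>

lemma set_lebesgue_Ico_Icc:
  fixes f :: "real \<Rightarrow> 'a::{banach,second_countable_topology}"
  shows "set_integrable lebesgue {a..<b} f \<longleftrightarrow> set_integrable lebesgue {a..b} f"
    and "(LINT s:{a..<b}|lebesgue. f s) = (LINT s:{a..b}|lebesgue. f s)"
proof -
  have d: "({a..<b} - {a..b}) \<union> ({a..b} - {a..<b}) \<subseteq> {b}" by auto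
  show "set_integrable lebesgue {a..<b} f \<longleftrightarrow> set_integrable lebesgue {a..b} f"
    by (rule set_integrable_discrete_difference[OF _ d]) auto
  show "(LINT s:{a..<b}|lebesgue. f s) = (LINT s:{a..b}|lebesgue. f s)"
    by (rule set_integral_discrete_difference[OF _ d]) auto
qed

lemma set_lebesgue_integral_split:
  fixes f :: "real \<Rightarrow> 'a::{banach,second_countable_topology}"
  assumes f: "set_integrable lebesgue {a..c} f" and b: "a \<le> b" "b \<le> c"
  shows "(LINT s:{a..c}|lebesgue. f s) = (LINT s:{a..b}|lebesgue. f s) + (LINT s:{b..c}|lebesgue. f s)"
proof -
  have "(LINT s:{a..<b} \<union> {b..c}|lebesgue. f s) = (LINT s:{a..<b}|lebesgue. f s) + (LINT s:{b..c}|lebesgue. f s)"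
    by (rule set_integral_Un) (use b in \<open>auto intro!: set_integrable_subset[OF f]\<close>)
  moreover have "{a..<b} \<union> {b..c} = {a..c}" using b by auto
  ultimately show ?thesis by (simp add: set_lebesgue_Ico_Icc)
qed

lemma set_lebesgue_integral_continuous:
  fixes f :: "real \<Rightarrow> real"
  assumes "continuous_on {a..b} f"
  shows "set_integrable lebesgue {a..b} f" "(LINT s:{a..b}|lebesgue. f s) = integral {a..b} f"
  using absolutely_integrable_continuous_real[OF assms] set_lebesgue_integral_eq_integral(2)
  by blast+

lemma mild_solution_restart:
  fixes S :: "real \<Rightarrow> 'a::{banach,second_countable_topology} \<Rightarrow> 'a"
  assumes S: "C0_semigroup S" and pq: "0 \<le> p" "p \<le> q" "q \<le> T"
    and int: "\<And>t. t \<in> {0..T} \<Longrightarrow> set_integrable lebesgue {0..t} (\<lambda>s. S (t - s) (f s))"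
    and mild: "\<And>t. t \<in> {0..T} \<Longrightarrow> u t = S t u0 + (LINT s:{0..t}|lebesgue. S (t - s) (f s))"
  shows "u q = S (q - p) (u p) + (LINT s:{p..q}|lebesgue. S (q - s) (f s))"
proof -
  have lin: "bounded_linear (S (q - p))" using C0_semigroupD(1)[OF S] pq by simp
  have intp: "set_integrable lebesgue {0..p} (\<lambda>s. S (p - s) (f s))" using int pq by simp
  have "S (q - p) (LINT s:{0..p}|lebesgue. S (p - s) (f s)) =
      (LINT s:{0..p}|lebesgue. S (q - p) (S (p - s) (f s)))"
    using integral_bounded_linear[OF lin intp[unfolded set_integrable_def]] lin
    by (simp add: set_lebesgue_integral_def linear_simps)
  also have "\<dots> = (LINT s:{0..p}|lebesgue. S (q - s) (f s))"
  proof (rule set_lebesgue_integral_cong)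
    show "\<forall>s. s \<in> {0..p} \<longrightarrow> S (q - p) (S (p - s) (f s)) = S (q - s) (f s)"
      using C0_semigroupD(3)[OF S, of "q - p", symmetric] pq by auto
  qed auto
  finally have "S (q - p) (u p) = S q u0 + (LINT s:{0..p}|lebesgue. S (q - s) (f s))"
    using mild[of p] pq lin C0_semigroupD(3)[OF S, of "q - p" p u0] by (simp add: linear_simps)
  moreover have "(LINT s:{0..q}|lebesgue. S (q - s) (f s)) =
      (LINT s:{0..p}|lebesgue. S (q - s) (f s)) + (LINT s:{p..q}|lebesgue. S (q - s) (f s))"
    by (rule set_lebesgue_integral_split) (use int pq in auto)
  ultimately show ?thesis using mild[of q] pq by (simp add: algebra_simps)
qed

text \<open>With \<open>x = S (q - p) (u p)\<close> the Duhamel integral over \<open>{p..q}\<close> is \<open>u q - x\<close>, and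
  \<open>|u q|\<^sup>2 - |x|\<^sup>2 = \<langle>x + u q, u q - x\<rangle>\<close>. This form is linear in the Duhamel integral, so
  the inner product can be moved under the integral, and \<open>x\<close> and \<open>u q\<close> both tend to \<open>u s\<close> as the step shrinks.\<close>

lemma mild_energy_step:
  fixes S :: "real \<Rightarrow> 'a::{real_inner,banach,second_countable_topology} \<Rightarrow> 'a"
  assumes S: "C0_semigroup S"
    and gen: "\<And>v g. (v, g) \<in> generator S \<Longrightarrow> inner g v \<le> - Q v"
    and Q: "continuous_on UNIV Q" "\<And>v. \<bar>Q v\<bar> \<le> C * (norm v)\<^sup>2"
    and pq: "0 \<le> p" "p \<le> q" "q \<le> T"
    and int: "\<And>t. t \<in> {0..T} \<Longrightarrow> set_integrable lebesgue {0..t} (\<lambda>s. S (t - s) (f s))"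
    and mild: "\<And>t. t \<in> {0..T} \<Longrightarrow> u t = S t u0 + (LINT s:{0..t}|lebesgue. S (t - s) (f s))"
  defines "\<psi> \<equiv> \<lambda>s. - 2 * Q (S (s - p) (u p)) + inner (S (q - p) (u p) + u q) (S (q - s) (f s))"
  shows "set_integrable lebesgue {p..q} \<psi>" "(norm (u q))\<^sup>2 - (norm (u p))\<^sup>2 \<le> (LINT s:{p..q}|lebesgue. \<psi> s)"
proof -
  define x where "x = S (q - p) (u p)"
  have intq: "set_integrable lebesgue {p..q} (\<lambda>s. S (q - s) (f s))"
    by (rule set_integrable_subset[OF int[of q]]) (use pq in auto)
  have lin: "bounded_linear (inner (x + u q))" by (rule bounded_linear_inner_right)
  have int_inner: "set_integrable lebesgue {p..q} (\<lambda>s. inner (x + u q) (S (q - s) (f s)))"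
    using integrable_bounded_linear[OF lin intq[unfolded set_integrable_def]]
    by (simp add: set_integrable_def inner_scaleR_right del: inner_add_left)
  have "u q - x = (LINT s:{p..q}|lebesgue. S (q - s) (f s))"
    using mild_solution_restart[OF S pq int mild] by (simp add: x_def)
  then have "inner (x + u q) (u q - x) = (LINT s:{p..q}|lebesgue. inner (x + u q) (S (q - s) (f s)))"
    using integral_bounded_linear[OF lin intq[unfolded set_integrable_def]]
    by (simp add: set_lebesgue_integral_def del: inner_add_left)
  moreover have "inner (x + u q) (u q - x) = (norm (u q))\<^sup>2 - (norm x)\<^sup>2"
    by (simp add: power2_norm_eq_inner inner_add_left inner_diff_right inner_commute[of x "u q"])
  ultimately have A: "(norm (u q))\<^sup>2 - (norm x)\<^sup>2 = (LINT s:{p..q}|lebesgue. inner (x + u q) (S (q - s) (f s)))"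
    by simp
  have cont: "continuous_on {p..q} (\<lambda>s. Q (S (s - p) (u p)))"
    by (intro continuous_on_compose2[OF Q(1)] continuous_on_compose2[OF C0_semigroup_continuous_on[OF S]])
      (auto intro!: continuous_intros)
  have "((\<lambda>r. Q (S r (u p))) has_integral integral {0..q - p} (\<lambda>r. Q (S r (u p)))) (cbox 0 (q - p))"
    by (auto intro!: integrable_integral integrable_continuous_real continuous_on_compose2[OF Q(1)]
      continuous_on_subset[OF C0_semigroup_continuous_on[OF S]])
  from has_integral_affinity'[OF this, of 1 "- p"]
  have "((\<lambda>s. Q (S (s - p) (u p))) has_integral integral {0..q - p} (\<lambda>r. Q (S r (u p)))) {p..q}"
    by simp
  then have "(LINT s:{p..q}|lebesgue. Q (S (s - p) (u p))) = integral {0..q - p} (\<lambda>r. Q (S r (u p)))"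
    using set_lebesgue_integral_continuous(2)[OF cont] by (simp add: has_integral_iff)
  with semigroup_dissipation[OF S gen Q, of "q - p" "u p"] pq
  have B: "(norm x)\<^sup>2 - (norm (u p))\<^sup>2 \<le> - 2 * (LINT s:{p..q}|lebesgue. Q (S (s - p) (u p)))"
    by (simp add: x_def)
  have intQ: "set_integrable lebesgue {p..q} (\<lambda>s. - 2 * Q (S (s - p) (u p)))"
    by (intro set_lebesgue_integral_continuous(1) continuous_intros cont)
  show "set_integrable lebesgue {p..q} \<psi>"
    unfolding \<psi>_def x_def[symmetric] using intQ int_inner by (rule set_integral_add)
  have "(LINT s:{p..q}|lebesgue. - 2 * Q (S (s - p) (u p))) = - 2 * (LINT s:{p..q}|lebesgue. Q (S (s - p) (u p)))"
    by (rule set_integral_mult_right)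
  then have "(LINT s:{p..q}|lebesgue. \<psi> s) =
      - 2 * (LINT s:{p..q}|lebesgue. Q (S (s - p) (u p))) + (LINT s:{p..q}|lebesgue. inner (x + u q) (S (q - s) (f s)))"
    unfolding \<psi>_def x_def[symmetric] using set_integral_add(2)[OF intQ int_inner] by (simp only:)
  with A B show "(norm (u q))\<^sup>2 - (norm (u p))\<^sup>2 \<le> (LINT s:{p..q}|lebesgue. \<psi> s)" by linarith
qed

text \<open>Formally this is \<open>d/ds |u|\<^sup>2 = 2 \<langle>A u + f, u\<rangle>\<close>, but a mild solution need not be differentiable.
  The one-step estimates are added over a partition of mesh \<open>d n\<close>; the sum is the integral of a single
  function \<open>\<psi> n\<close> that is built from the left end point \<open>p n s\<close> of the cell of \<open>s\<close>. By joint continuity of the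
  semigroup \<open>\<psi> n\<close> converges pointwise to the integrand of the claim, and it is dominated because \<open>|f|\<close> is.
  Measurability of the limit is inherited from \<open>\<psi> n\<close>, hence from the maps \<open>s \<mapsto> S (t - s) (f s)\<close> in the
  Duhamel integrals.\<close>

lemma mild_energy_inequality:
  fixes S :: "real \<Rightarrow> 'a::{real_inner,banach,second_countable_topology} \<Rightarrow> 'a"
  assumes S: "C0_semigroup S"
    and gen: "\<And>v g. (v, g) \<in> generator S \<Longrightarrow> inner g v \<le> - Q v"
    and Q: "continuous_on UNIV Q" "\<And>v. \<bar>Q v\<bar> \<le> C * (norm v)\<^sup>2"
    and u: "continuous_on {0..T} u"
    and int: "\<And>t. t \<in> {0..T} \<Longrightarrow> set_integrable lebesgue {0..t} (\<lambda>s. S (t - s) (f s))"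
    and mild: "\<And>t. t \<in> {0..T} \<Longrightarrow> u t = S t u0 + (LINT s:{0..t}|lebesgue. S (t - s) (f s))"
    and g: "set_integrable lebesgue {0..T} g" "AE s in lebesgue. s \<in> {0..T} \<longrightarrow> norm (f s) \<le> g s"
    and ab: "0 \<le> a" "a < b" "b \<le> T"
  shows "set_integrable lebesgue {a..b} (\<lambda>s. - 2 * Q (u s) + 2 * inner (u s) (f s))" (is "set_integrable _ _ ?R")
    and "(norm (u b))\<^sup>2 - (norm (u a))\<^sup>2 \<le> (LINT s:{a..b}|lebesgue. - 2 * Q (u s) + 2 * inner (u s) (f s))"
proof -
  define d where "d n = (b - a) / real (Suc n)" for n
  \<comment> \<open>The number of the cell that contains \<open>s\<close>; cells are half-open, so that \<open>\<psi> n\<close> is unambiguous.\<close>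
  define k where "k n s = \<lfloor>(s - a) / d n\<rfloor>" for n s
  define p where "p n s = a + d n * real_of_int (k n s)" for n s
  define \<psi> where "\<psi> n s = - 2 * Q (S (s - p n s) (u (p n s))) +
    inner (S (d n) (u (p n s)) + u (p n s + d n)) (S (p n s + d n - s) (f s))" for n s
  have d: "d n > 0" for n using ab by (simp add: d_def)
  have d_lim: "d \<longlonglongrightarrow> 0"
  proof -
    have "(\<lambda>n. (b - a) * (1 / real (Suc n))) \<longlonglongrightarrow> (b - a) * 0"
      by (intro tendsto_intros LIMSEQ_Suc[OF lim_1_over_n])
    then show ?thesis by (simp add: d_def[abs_def])
  qed
  have p: "p n s \<le> s" "s < p n s + d n" for n s
  proof -
    have "real_of_int (k n s) \<le> (s - a) / d n" "(s - a) / d n < real_of_int (k n s) + 1"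
      unfolding k_def by linarith+
    then show "p n s \<le> s" "s < p n s + d n"
      using d[of n] by (auto simp: p_def field_simps)
  qed
  have p_range: "p n s \<ge> a" "p n s + d n \<le> b" if "s \<in> {a..<b}" for n s
  proof -
    have "(s - a) / d n \<ge> 0" using d[of n] that by simp
    then have "k n s \<ge> 0" unfolding k_def by simp
    then show "p n s \<ge> a" using d[of n] by (simp add: p_def)
    have "(s - a) / d n < (b - a) / d n" using that d[of n] by (intro divide_strict_right_mono) auto
    also have "(b - a) / d n = real (Suc n)" using ab by (simp add: d_def)
    finally have "(s - a) / d n < real (Suc n)" .
    then have "k n s < int (Suc n)" unfolding k_def by linarith
    then have "k n s + 1 \<le> int (Suc n)" by linarith
    then have "real_of_int (k n s) + 1 \<le> real (Suc n)" by linarith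
    then have "d n * (real_of_int (k n s) + 1) \<le> d n * real (Suc n)"
      using d[of n] by (intro mult_left_mono) auto
    also have "d n * real (Suc n) = b - a" by (simp add: d_def)
    finally show "p n s + d n \<le> b" by (simp add: p_def distrib_left)
  qed
  have p_const: "p n s = a + d n * real j" if "s \<in> {a + d n * real j..<a + d n * real (Suc j)}" for n s j
  proof -
    have "real j \<le> (s - a) / d n" "(s - a) / d n < real j + 1"
      using that d[of n] by (auto simp: field_simps)
    then have "k n s = int j" unfolding k_def by linarith
    then show ?thesis by (simp add: p_def)
  qed
  have steps: "set_integrable lebesgue {a..<a + d n * real j} (\<psi> n) \<and>
      (norm (u (a + d n * real j)))\<^sup>2 - (norm (u a))\<^sup>2 \<le> (LINT s:{a..<a + d n * real j}|lebesgue. \<psi> n s)"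
    if "j \<le> Suc n" for n j
    using that
  proof (induction j)
    case 0
    then show ?case by (simp add: set_integrable_def set_lebesgue_integral_def)
  next
    case (Suc j)
    define p' where "p' = a + d n * real j"
    define q' where "q' = a + d n * real (Suc j)"
    have q': "q' = p' + d n" by (simp add: p'_def q'_def algebra_simps)
    have "d n * real (Suc j) \<le> d n * real (Suc n)"
      using Suc.prems d[of n] by (intro mult_left_mono) auto
    then have "q' \<le> b" by (simp add: q'_def d_def)
    then have pq': "0 \<le> p'" "p' \<le> q'" "q' \<le> T" "a \<le> p'"
      using ab d[of n] by (auto simp: q' p'_def)
    note step = mild_energy_step[OF S gen Q pq'(1-3) int mild]
    have eq: "\<psi> n s = - 2 * Q (S (s - p') (u p')) + inner (S (q' - p') (u p') + u q') (S (q' - s) (f s))"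
      if "s \<in> {p'..<q'}" for s
    proof -
      have "p n s = p'" using p_const[of s n j] that by (simp only: p'_def q'_def)
      then show ?thesis by (simp add: \<psi>_def q')
    qed
    have I: "set_integrable lebesgue {p'..<q'} (\<psi> n)"
      using step(1) unfolding set_lebesgue_Ico_Icc(1)[symmetric]
      by (subst set_integrable_cong[OF refl refl eq]) auto
    have "(LINT s:{p'..<q'}|lebesgue. \<psi> n s) = (LINT s:{p'..<q'}|lebesgue.
        - 2 * Q (S (s - p') (u p')) + inner (S (q' - p') (u p') + u q') (S (q' - s) (f s)))"
      by (rule set_lebesgue_integral_cong) (auto simp: eq)
    then have L: "(norm (u q'))\<^sup>2 - (norm (u p'))\<^sup>2 \<le> (LINT s:{p'..<q'}|lebesgue. \<psi> n s)"
      using step(2) by (simp only: set_lebesgue_Ico_Icc(2))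
    have IH: "set_integrable lebesgue {a..<p'} (\<psi> n)"
      "(norm (u p'))\<^sup>2 - (norm (u a))\<^sup>2 \<le> (LINT s:{a..<p'}|lebesgue. \<psi> n s)"
      using Suc by (simp_all add: p'_def)
    have U: "{a..<p'} \<union> {p'..<q'} = {a..<q'}" using pq' by auto
    have "set_integrable lebesgue ({a..<p'} \<union> {p'..<q'}) (\<psi> n)"
      by (rule set_integrable_Un[OF IH(1) I]) auto
    moreover have "(LINT s:{a..<p'} \<union> {p'..<q'}|lebesgue. \<psi> n s) =
        (LINT s:{a..<p'}|lebesgue. \<psi> n s) + (LINT s:{p'..<q'}|lebesgue. \<psi> n s)"
      by (rule set_integral_Un[OF _ IH(1) I]) auto
    ultimately show ?case using IH(2) L unfolding U q'_def[symmetric] by simp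
  qed
  have end_eq: "a + d n * real (Suc n) = b" for n by (simp add: d_def)
  have \<psi>_int: "set_integrable lebesgue {a..<b} (\<psi> n)"
    and \<psi>_le: "(norm (u b))\<^sup>2 - (norm (u a))\<^sup>2 \<le> (LINT s:{a..<b}|lebesgue. \<psi> n s)" for n
    using steps[of "Suc n" n] unfolding end_eq by auto
  obtain M where M: "M \<ge> 1" "\<And>t x. t \<in> {0..T} \<Longrightarrow> norm (S t x) \<le> M * norm x"
    by (rule C0_semigroup_locally_bounded[OF S, of T]) blast
  obtain B where B: "\<And>t. t \<in> {0..T} \<Longrightarrow> norm (u t) \<le> B"
    using compact_imp_bounded[OF compact_continuous_image[OF u compact_Icc]]
    unfolding bounded_iff by blast
  have B0: "B \<ge> 0" using order_trans[OF norm_ge_zero B[of a]] ab by auto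
  define w where "w s = 2 * \<bar>C\<bar> * (M * B)\<^sup>2 + (M * B + B) * M * g s" for s
  have bound: "norm (\<psi> n s) \<le> w s" if s: "s \<in> {a..<b}" and fg: "norm (f s) \<le> g s" for n s
  proof -
    note pr = p_range[OF s, of n] p(1)[of n s] p(2)[of s n] d[of n]
    have up: "norm (u (p n s)) \<le> B" "norm (u (p n s + d n)) \<le> B" using pr ab s by (auto intro!: B)
    have "norm (S (s - p n s) (u (p n s))) \<le> M * norm (u (p n s))"
      by (rule M(2)) (use pr ab s in auto)
    also have "\<dots> \<le> M * B" using up M by (intro mult_left_mono) auto
    finally have 1: "(norm (S (s - p n s) (u (p n s))))\<^sup>2 \<le> (M * B)\<^sup>2" by (rule power_mono) simp
    have "\<bar>Q (S (s - p n s) (u (p n s)))\<bar> \<le> \<bar>C\<bar> * (norm (S (s - p n s) (u (p n s))))\<^sup>2"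
      using order_trans[OF Q(2) mult_right_mono[OF abs_ge_self]] by simp
    also have "\<dots> \<le> \<bar>C\<bar> * (M * B)\<^sup>2" by (rule mult_left_mono[OF 1]) simp
    finally have 2: "\<bar>Q (S (s - p n s) (u (p n s)))\<bar> \<le> \<bar>C\<bar> * (M * B)\<^sup>2" .
    have "norm (S (d n) (u (p n s))) \<le> M * norm (u (p n s))"
      by (rule M(2)) (use pr ab in auto)
    also have "\<dots> \<le> M * B" using up M by (intro mult_left_mono) auto
    finally have 3: "norm (S (d n) (u (p n s)) + u (p n s + d n)) \<le> M * B + B"
      using up norm_triangle_ineq[of "S (d n) (u (p n s))" "u (p n s + d n)"] by linarith
    have "norm (S (p n s + d n - s) (f s)) \<le> M * norm (f s)"
      by (rule M(2)) (use pr ab s in auto)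
    also have "\<dots> \<le> M * g s" using fg M by (intro mult_left_mono) auto
    finally have 4: "norm (S (p n s + d n - s) (f s)) \<le> M * g s" .
    have "\<bar>inner (S (d n) (u (p n s)) + u (p n s + d n)) (S (p n s + d n - s) (f s))\<bar>
        \<le> norm (S (d n) (u (p n s)) + u (p n s + d n)) * norm (S (p n s + d n - s) (f s))"
      by (rule Cauchy_Schwarz_ineq2)
    also have "\<dots> \<le> (M * B + B) * (M * g s)"
      using 3 4 B0 M by (intro mult_mono) auto
    finally show ?thesis using 2 unfolding \<psi>_def w_def real_norm_def mult.assoc by linarith
  qed
  have lim: "(\<lambda>n. \<psi> n s) \<longlonglongrightarrow> ?R s" if s: "s \<in> {a..<b}" for s
  proof -
    have pl: "(\<lambda>n. p n s) \<longlonglongrightarrow> s"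
    proof (rule tendsto_sandwich[OF _ _ _ tendsto_const])
      show "(\<lambda>n. s - d n) \<longlonglongrightarrow> s" using tendsto_diff[OF tendsto_const d_lim, of s] by simp
      show "\<forall>\<^sub>F n in sequentially. s - d n \<le> p n s" using p(2)
        by (auto intro!: always_eventually less_imp_le simp: less_diff_eq diff_less_eq)
    qed (use p in \<open>auto intro: always_eventually\<close>)
    have ql: "(\<lambda>n. p n s + d n) \<longlonglongrightarrow> s" using tendsto_add[OF pl d_lim] by simp
    have up: "(\<lambda>n. u (p n s)) \<longlonglongrightarrow> u s" "(\<lambda>n. u (p n s + d n)) \<longlonglongrightarrow> u s"
      using p_range[OF s] d less_imp_le[OF d] s ab
      by (auto intro!: continuous_on_tendsto_compose[OF u pl] continuous_on_tendsto_compose[OF u ql] always_eventually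
          simp: add_nonneg_nonneg order_trans[OF _ p_range(1)[OF s]] order_trans[OF p_range(2)[OF s]]
            order_trans[OF p(1)])
    have S0: "S 0 x = x" for x by (rule C0_semigroupD(2)[OF S])
    have "(\<lambda>n. s - p n s) \<longlonglongrightarrow> 0" using tendsto_diff[OF tendsto_const pl, of s] by simp
    from C0_semigroup_tendsto[OF S this _ up(1)] p
    have 1: "(\<lambda>n. S (s - p n s) (u (p n s))) \<longlonglongrightarrow> u s" by (simp add: S0)
    from C0_semigroup_tendsto[OF S d_lim _ up(1)] less_imp_le[OF d]
    have 2: "(\<lambda>n. S (d n) (u (p n s))) \<longlonglongrightarrow> u s" by (simp add: S0)
    have "(\<lambda>n. p n s + d n - s) \<longlonglongrightarrow> 0" using tendsto_diff[OF ql tendsto_const, of s] by simp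
    from C0_semigroup_tendsto[OF S this _ tendsto_const] less_imp_le[OF p(2)]
    have 3: "(\<lambda>n. S (p n s + d n - s) (f s)) \<longlonglongrightarrow> f s" by (simp add: S0)
    have "(\<lambda>n. \<psi> n s) \<longlonglongrightarrow> - 2 * Q (u s) + inner (u s + u s) (f s)"
      unfolding \<psi>_def
      by (intro tendsto_intros continuous_on_tendsto_compose[OF Q(1) 1] 2 3 up) auto
    then show ?thesis by (simp add: inner_add_left)
  qed
  have gab: "set_integrable lebesgue {a..<b} g"
    by (rule set_integrable_subset[OF g(1)]) (use ab in auto)
  have wint: "set_integrable lebesgue {a..<b} w"
  proof -
    have "set_integrable lebesgue {a..<b} (\<lambda>s. 2 * \<bar>C\<bar> * (M * B)\<^sup>2)"
      unfolding set_lebesgue_Ico_Icc(1) by (rule set_lebesgue_integral_continuous(1)) (rule continuous_on_const)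
    then show ?thesis unfolding w_def using gab by (intro set_integral_add(1)) auto
  qed
  have lim': "(\<lambda>n. indicator {a..<b} s *\<^sub>R \<psi> n s) \<longlonglongrightarrow> indicator {a..<b} s *\<^sub>R ?R s" for s
    using lim[of s] by (cases "s \<in> {a..<b}") auto
  have meas: "(\<lambda>s. indicator {a..<b} s *\<^sub>R \<psi> n s) \<in> borel_measurable lebesgue" for n
    using \<psi>_int[of n] unfolding set_integrable_def by (rule borel_measurable_integrable)
  have meas_lim: "(\<lambda>s. indicator {a..<b} s *\<^sub>R ?R s) \<in> borel_measurable lebesgue"
    by (rule borel_measurable_LIMSEQ_real[OF lim' meas])
  have dom: "AE s in lebesgue. norm (indicator {a..<b} s *\<^sub>R \<psi> n s) \<le> indicator {a..<b} s *\<^sub>R w s" for n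
    using g(2) by eventually_elim (use bound ab in \<open>auto simp: indicator_def\<close>)
  have R: "set_integrable lebesgue {a..<b} ?R"
    unfolding set_integrable_def
    by (rule integrable_dominated_convergence[OF meas_lim meas wint[unfolded set_integrable_def] AE_I2[OF lim'] dom])
  then show "set_integrable lebesgue {a..b} ?R" by (simp only: set_lebesgue_Ico_Icc)
  have "(\<lambda>n. LINT s:{a..<b}|lebesgue. \<psi> n s) \<longlonglongrightarrow> (LINT s:{a..<b}|lebesgue. ?R s)"
    unfolding set_lebesgue_integral_def
    by (rule integral_dominated_convergence[OF meas_lim meas wint[unfolded set_integrable_def] AE_I2[OF lim'] dom])
  then have "(norm (u b))\<^sup>2 - (norm (u a))\<^sup>2 \<le> (LINT s:{a..<b}|lebesgue. ?R s)"
    by (rule LIMSEQ_le_const) (use \<psi>_le in auto)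
  then show "(norm (u b))\<^sup>2 - (norm (u a))\<^sup>2 \<le> (LINT s:{a..b}|lebesgue. ?R s)"
    by (simp only: set_lebesgue_Ico_Icc)
qed


section \<open>Smooth functions with compact support\<close>

definition flat_exp :: "real poly \<Rightarrow> real \<Rightarrow> real" where
  "flat_exp p x = (if x > 0 then poly p (1 / x) * exp (- (1 / x)) else 0)"

lemma poly_times_exp_tendsto_0: "((\<lambda>y :: real. poly p y * exp (- y)) \<longlongrightarrow> 0) at_top"
proof -
  have "((\<lambda>y. \<Sum>i\<le>degree p. coeff p i * (y ^ i / exp y)) \<longlongrightarrow> (\<Sum>i\<le>degree p. coeff p i * 0)) at_top"
    by (intro tendsto_intros tendsto_power_div_exp_0)
  moreover have "(\<lambda>y. \<Sum>i\<le>degree p. coeff p i * (y ^ i / exp y)) = (\<lambda>y. poly p y * exp (- y))"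
    by (simp add: poly_altdef sum_distrib_right exp_minus divide_inverse mult.assoc)
  ultimately show ?thesis by simp
qed

text \<open>All derivatives of \<open>exp (-1/x)\<close> are of the form \<open>p(1/x) exp (-1/x)\<close>, and all of these vanish at \<open>0\<close>: this is
  why the extension by \<open>0\<close> is smooth.\<close>

lemma flat_exp_tendsto_0: "(flat_exp p \<longlongrightarrow> 0) (at 0)"
proof (rule filterlim_split_at)
  show "(flat_exp p \<longlongrightarrow> 0) (at_left 0)"
    by (rule tendsto_eventually) (auto simp: flat_exp_def eventually_at_filter)
  have "((\<lambda>x. poly p (inverse x) * exp (- inverse x)) \<longlongrightarrow> 0) (at_right (0 :: real))"
    by (rule filterlim_compose[OF poly_times_exp_tendsto_0 filterlim_inverse_at_top_right])
  then show "(flat_exp p \<longlongrightarrow> 0) (at_right 0)"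
    by (rule Lim_transform_eventually) (auto simp: flat_exp_def eventually_at_filter inverse_eq_divide)
qed

definition flat_deriv :: "real poly \<Rightarrow> real poly" where
  "flat_deriv p = [:0, 0, 1:] * (p - pderiv p)"

lemma flat_exp_has_derivative:
  "(flat_exp p has_real_derivative flat_exp (flat_deriv p) x) (at x)"
proof -
  consider "x > 0" | "x < 0" | "x = 0" by linarith
  then show ?thesis
  proof cases
    case 1
    have "((\<lambda>x. poly p (1 / x) * exp (- (1 / x))) has_real_derivative flat_exp (flat_deriv p) x) (at x)"
      using 1
      by (auto intro!: derivative_eq_intros DERIV_chain2[OF poly_DERIV]
        simp: flat_exp_def flat_deriv_def field_simps power2_eq_square)
    then show ?thesis
      by (rule has_field_derivative_transform_within_open[where S = "{0<..}"]) (use 1 in \<open>auto simp: flat_exp_def\<close>)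
  next
    case 2
    have "((\<lambda>x. 0) has_real_derivative flat_exp (flat_deriv p) x) (at x)"
      using 2 by (simp add: flat_exp_def)
    then show ?thesis
      by (rule has_field_derivative_transform_within_open[where S = "{..<0}"]) (use 2 in \<open>auto simp: flat_exp_def\<close>)
  next
    case 3
    have "((\<lambda>h. (flat_exp p (0 + h) - flat_exp p 0) / h) \<longlongrightarrow> 0) (at 0)"
      by (rule Lim_transform_eventually[OF flat_exp_tendsto_0[of "pCons 0 p"]])
        (auto simp: flat_exp_def eventually_at_filter)
    then show ?thesis
      by (simp add: 3 DERIV_def flat_exp_def)
  qed
qed

lemma test_function_iff:
  "test_function \<phi> \<longleftrightarrow> (\<forall>k x. (deriv ^^ k) \<phi> field_differentiable at x) \<and> (\<exists>R. \<forall>x. \<phi> x \<noteq> 0 \<longrightarrow> \<bar>x\<bar> \<le> R)"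
  by (simp add: test_function_def compact_closure bounded_iff)

text \<open>The product rule leads from a product of two cut-offs to a sum of such products. The set is closed under
  differentiation, so all its members are smooth, and they are supported in \<open>{-1..1}\<close>.\<close>

inductive_set bump_span :: "(real \<Rightarrow> real) set" where
  prod: "(\<lambda>x. c * (flat_exp p (1 + x) * flat_exp q (1 - x))) \<in> bump_span"
| add: "f \<in> bump_span \<Longrightarrow> g \<in> bump_span \<Longrightarrow> (\<lambda>x. f x + g x) \<in> bump_span"

lemma bump_span_deriv:
  assumes "f \<in> bump_span"
  shows "(\<forall>x. f field_differentiable at x) \<and> deriv f \<in> bump_span"
proof -
  have "\<exists>f'\<in>bump_span. \<forall>x. (f has_real_derivative f' x) (at x)"
    using assms
  proof induction
    case (prod c p q)
    let ?f' = "\<lambda>x. c * (flat_exp (flat_deriv p) (1 + x) * flat_exp q (1 - x)) +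
        (- c) * (flat_exp p (1 + x) * flat_exp (flat_deriv q) (1 - x))"
    have "((\<lambda>x. c * (flat_exp p (1 + x) * flat_exp q (1 - x))) has_real_derivative ?f' x) (at x)" for x
      by (auto intro!: derivative_eq_intros DERIV_chain2[OF flat_exp_has_derivative] simp: algebra_simps)
    moreover have "?f' \<in> bump_span" by (intro bump_span.intros)
    ultimately show ?case by (intro bexI[of _ ?f']) auto
  next
    case (add f g)
    then obtain f' g' where "f' \<in> bump_span" "g' \<in> bump_span"
      "\<And>x. (f has_real_derivative f' x) (at x)" "\<And>x. (g has_real_derivative g' x) (at x)" by blast
    then show ?case
      by (intro bexI[of _ "\<lambda>x. f' x + g' x"]) (auto intro: bump_span.intros DERIV_add)
  qed
  then obtain f' where f': "f' \<in> bump_span" "\<And>x. (f has_real_derivative f' x) (at x)" by blast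
  then have "deriv f = f'" by (auto intro: DERIV_imp_deriv)
  with f' show ?thesis unfolding field_differentiable_def by blast
qed

lemma test_function_bump_span:
  assumes "f \<in> bump_span"
  shows "test_function f"
proof -
  have "(deriv ^^ k) f \<in> bump_span" for k
    by (induction k) (use assms bump_span_deriv in auto)
  moreover have "f x \<noteq> 0 \<longrightarrow> \<bar>x\<bar> \<le> 1" for x
    using assms by induction (auto simp: flat_exp_def)
  ultimately show ?thesis
    unfolding test_function_iff using bump_span_deriv by blast
qed

text \<open>Weak derivatives are tested with \<open>y \<mapsto> \<phi> (x - y)\<close>, whose iterated derivatives are needed.\<close>

lemma funpow_deriv_affine:
  assumes "\<And>k x. (deriv ^^ k) \<phi> field_differentiable at x"
  shows "(deriv ^^ k) (\<lambda>y. c * \<phi> (b + a * y)) = (\<lambda>y :: real. c * a ^ k * (deriv ^^ k) \<phi> (b + a * y))"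
proof (induction k)
  case (Suc k)
  have "((\<lambda>y. c * a ^ k * (deriv ^^ k) \<phi> (b + a * y)) has_real_derivative
      c * a ^ Suc k * (deriv ^^ Suc k) \<phi> (b + a * y)) (at y)" for y
    using DERIV_deriv_iff_field_differentiable[of "(deriv ^^ k) \<phi>" "b + a * y"] assms[of k "b + a * y"]
    by (auto intro!: derivative_eq_intros DERIV_chain2[of "(deriv ^^ k) \<phi>"] simp: algebra_simps)
  then show ?case using Suc by (auto intro: DERIV_imp_deriv)
qed simp

lemma test_function_differentiable:
  "test_function \<phi> \<Longrightarrow> (deriv ^^ k) \<phi> field_differentiable at x"
  by (simp add: test_function_def)

lemma test_function_affine:
  assumes \<phi>: "test_function \<phi>" and a: "a \<noteq> 0"
  shows "test_function (\<lambda>y. c * \<phi> (b + a * y))"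
  unfolding test_function_iff
proof (intro conjI allI)
  fix k x
  have *: "((\<lambda>y. c * a ^ k * (deriv ^^ k) \<phi> (b + a * y)) has_real_derivative
      c * a ^ Suc k * (deriv ^^ Suc k) \<phi> (b + a * x)) (at x)"
    using DERIV_deriv_iff_field_differentiable[of "(deriv ^^ k) \<phi>" "b + a * x"]
      test_function_differentiable[OF \<phi>, of k "b + a * x"]
    by (auto intro!: derivative_eq_intros DERIV_chain2[of "(deriv ^^ k) \<phi>"] simp: algebra_simps)
  then show "(deriv ^^ k) (\<lambda>y. c * \<phi> (b + a * y)) field_differentiable at x"
    unfolding funpow_deriv_affine[OF test_function_differentiable[OF \<phi>]] field_differentiable_def by blast
next
  obtain R where R: "\<And>x. \<phi> x \<noteq> 0 \<Longrightarrow> \<bar>x\<bar> \<le> R" using \<phi> by (auto simp: test_function_iff)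
  have "\<bar>y\<bar> \<le> (R + \<bar>b\<bar>) / \<bar>a\<bar>" if "c * \<phi> (b + a * y) \<noteq> 0" for y
  proof -
    have "\<bar>a * y\<bar> \<le> \<bar>b + a * y\<bar> + \<bar>b\<bar>" by linarith
    then have "\<bar>a\<bar> * \<bar>y\<bar> \<le> R + \<bar>b\<bar>" using R[of "b + a * y"] that by (auto simp: abs_mult)
    then show ?thesis using a by (simp add: field_simps)
  qed
  then show "\<exists>R. \<forall>x. c * \<phi> (b + a * x) \<noteq> 0 \<longrightarrow> \<bar>x\<bar> \<le> R" by blast
qed

lemma test_function_deriv:
  assumes \<phi>: "test_function \<phi>"
  shows "test_function (deriv \<phi>)"
  unfolding test_function_iff
proof (intro conjI allI)
  show "(deriv ^^ k) (deriv \<phi>) field_differentiable at x" for k x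
    using test_function_differentiable[OF \<phi>, of "Suc k" x] by (simp add: funpow_swap1)
  obtain R where R: "\<And>x. \<phi> x \<noteq> 0 \<Longrightarrow> \<bar>x\<bar> \<le> R" using \<phi> by (auto simp: test_function_iff)
  have "deriv \<phi> x = 0" if "\<bar>x\<bar> > R" for x
  proof -
    have "open {y. \<bar>y\<bar> > R}" by (intro open_Collect_less continuous_intros)
    moreover have "((\<lambda>y. 0) has_real_derivative 0) (at x)" by simp
    ultimately have "(\<phi> has_real_derivative 0) (at x)"
      using that R by (elim has_field_derivative_transform_within_open) force+
    then show ?thesis by (rule DERIV_imp_deriv)
  qed
  then have "deriv \<phi> x \<noteq> 0 \<longrightarrow> \<bar>x\<bar> \<le> R" for x by (meson not_le)
  then show "\<exists>R. \<forall>x. deriv \<phi> x \<noteq> 0 \<longrightarrow> \<bar>x\<bar> \<le> R" by blast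
qed

lemma test_function_has_derivative:
  "test_function \<phi> \<Longrightarrow> (\<phi> has_real_derivative deriv \<phi> x) (at x)"
  using test_function_differentiable[of \<phi> 0 x] by (simp add: DERIV_deriv_iff_field_differentiable)

lemma test_function_continuous: "test_function \<phi> \<Longrightarrow> continuous_on A \<phi>"
  by (intro continuous_at_imp_continuous_on ballI DERIV_isCont[OF test_function_has_derivative])

lemma test_function_bounded_support:
  assumes "test_function \<phi>"
  obtains K R where "K \<ge> 0" "R \<ge> 0" "\<And>x. \<bar>\<phi> x\<bar> \<le> K * indicat_real {- R..R} x"
proof -
  obtain R where R: "\<And>x. \<phi> x \<noteq> 0 \<Longrightarrow> \<bar>x\<bar> \<le> R" using assms by (auto simp: test_function_iff)
  obtain K where K: "\<And>x. x \<in> {- R..R} \<Longrightarrow> \<bar>\<phi> x\<bar> \<le> K"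
    using compact_imp_bounded[OF compact_continuous_image[OF test_function_continuous[OF assms] compact_Icc]]
    unfolding bounded_iff real_norm_def by blast
  have "\<bar>\<phi> x\<bar> \<le> \<bar>K\<bar> * indicat_real {- \<bar>R\<bar>..\<bar>R\<bar>} x" for x
  proof (cases "\<phi> x = 0")
    case False
    then have "x \<in> {- R..R}" "x \<in> {- \<bar>R\<bar>..\<bar>R\<bar>}" using R[of x] by auto
    then show ?thesis using K[of x] by simp
  qed simp
  then show thesis by (intro that[of "\<bar>K\<bar>" "\<bar>R\<bar>"]) auto
qed

lemma sq_integrable_bound:
  assumes "f \<in> borel_measurable lebesgue" "sq_integrable g" "\<And>x. \<bar>f x\<bar> \<le> \<bar>g x\<bar>"
  shows "sq_integrable f"
  unfolding sq_integrable_def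
proof
  show "integrable lebesgue (\<lambda>x. (f x)\<^sup>2)"
  proof (rule Bochner_Integration.integrable_bound[OF sq_integrable_power2[OF assms(2)]])
    show "AE x in lebesgue. norm ((f x)\<^sup>2) \<le> norm ((g x)\<^sup>2)"
      using assms(3) by (auto intro!: AE_I2 simp: abs_le_square_iff[symmetric])
  qed (use assms(1) in measurable)
qed (rule assms(1))

lemma test_function_sq_integrable:
  assumes "test_function \<phi>"
  shows "sq_integrable \<phi>"
proof -
  obtain K R where KR: "K \<ge> 0" "R \<ge> 0" "\<And>x. \<bar>\<phi> x\<bar> \<le> K * indicat_real {- R..R} x"
    using test_function_bounded_support[OF assms] by blast
  show ?thesis
  proof (rule sq_integrable_bound)
    show "\<phi> \<in> borel_measurable lebesgue"
      using borel_measurable_continuous_onI[OF test_function_continuous[OF assms]]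
      by (simp add: measurable_completion)
    show "sq_integrable (\<lambda>x. K * indicat_real {- R..R} x)"
      by (intro sq_integrable_cmult sq_integrable_indicator) auto
    show "\<bar>\<phi> x\<bar> \<le> \<bar>K * indicat_real {- R..R} x\<bar>" for x using KR(3)[of x] by linarith
  qed
qed

lemma exists_mollifier:
  obtains \<eta> where "test_function \<eta>" "\<And>x. \<eta> x \<ge> 0" "\<And>x. \<bar>x\<bar> > 1 \<Longrightarrow> \<eta> x = 0"
    "integrable lborel \<eta>" "(LINT x|lborel. \<eta> x) = 1"
proof -
  define \<psi> where "\<psi> x = flat_exp 1 (1 + x) * flat_exp 1 (1 - x)" for x
  have "(\<lambda>x. 1 * (flat_exp 1 (1 + x) * flat_exp 1 (1 - x))) \<in> bump_span" by (rule bump_span.prod)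
  then have test: "test_function \<psi>" unfolding \<psi>_def[abs_def] by (intro test_function_bump_span) simp
  have nonneg: "\<psi> x \<ge> 0" and supp: "\<bar>x\<bar> > 1 \<Longrightarrow> \<psi> x = 0" and pos: "\<bar>x\<bar> < 1 \<Longrightarrow> \<psi> x > 0" for x
    by (auto simp: \<psi>_def flat_exp_def)
  have cont: "continuous_on A \<psi>" for A by (rule test_function_continuous[OF test])
  have ind: "(\<lambda>x. indicat_real {- 1..1} x *\<^sub>R \<psi> x) = \<psi>"
    using supp by (fastforce simp: indicator_def abs_le_iff not_le[symmetric])
  have int: "integrable lborel \<psi>"
    using borel_integrable_atLeastAtMost'[OF cont, of "- 1" 1] by (simp only: set_integrable_def ind)
  have "(LINT x|lborel. \<psi> x) \<noteq> 0"
  proof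
    assume "(LINT x|lborel. \<psi> x) = 0"
    then have "AE x in lborel. \<psi> x = 0"
      using integral_nonneg_eq_0_iff_AE[OF int] nonneg by auto
    then have "AE x in lborel. x \<notin> {- 1<..<1 :: real}"
    proof eventually_elim
      case (elim x)
      then show ?case using pos[of x] by (auto simp: abs_less_iff)
    qed
    then have "emeasure lborel {- 1<..<1 :: real} = 0"
      by (subst (asm) AE_iff_measurable[of "{- 1<..<1 :: real}"]) auto
    then show False by simp
  qed
  then have c: "(LINT x|lborel. \<psi> x) > 0"
    using integral_nonneg_AE[of \<psi> lborel] nonneg by (simp add: less_le)
  define c where "c = 1 / (LINT x|lborel. \<psi> x)"
  \<comment> \<open>The trivial affine map \<open>0 + 1 * x\<close> brings the rescaled bump into the form of \<open>test_function_affine\<close>.\<close>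
  show thesis
  proof (rule that[of "\<lambda>x. c * \<psi> (0 + 1 * x)"])
    show "test_function (\<lambda>x. c * \<psi> (0 + 1 * x))" by (rule test_function_affine[OF test]) simp
  qed (use c int nonneg supp in \<open>auto simp: c_def\<close>)
qed


section \<open>Mollification in \<open>L\<^sup>2(\<real>)\<close>\<close>

lemma sq_integrable_shift:
  assumes "sq_integrable f"
  shows "sq_integrable (\<lambda>x. f (z + x))"
  using borel_measurable_affine[of f 1 z] lebesgue_integrable_real_affine[of "\<lambda>x. (f x)\<^sup>2" 1 z] assms
  by (simp add: sq_integrable_def)

lemma norm_L2_of_shift_diff:
  assumes "sq_integrable f" "sq_integrable g"
  shows "norm (L2_of (\<lambda>x. f (z + x)) - L2_of (\<lambda>x. g (z + x))) = norm (L2_of f - L2_of g)"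
  using assms lebesgue_integral_real_affine[of 1 "\<lambda>x. (f x - g x)\<^sup>2" z]
  by (simp add: L2_of_diff[symmetric] sq_integrable_shift norm_L2_of sq_integrable_diff)

lemma L2_shift_indicator:
  "((\<lambda>z. L2_of (\<lambda>x. indicat_real {a..b} (z + x))) \<longlongrightarrow> L2_of (indicat_real {a..b})) (at 0)"
proof -
  have lm: "{c..d} \<in> lmeasurable" for c d :: real by simp
  have sq: "sq_integrable (indicat_real {c..d})" for c d :: real
    by (rule sq_integrable_indicator[OF lm])
  have bound: "norm (L2_of (\<lambda>x. indicat_real {a..b} (z + x)) - L2_of (indicat_real {a..b})) \<le> sqrt (4 * \<bar>z\<bar>)" for z
  proof -
    let ?h = "\<lambda>x. indicat_real {a - \<bar>z\<bar>..a + \<bar>z\<bar>} x + indicat_real {b - \<bar>z\<bar>..b + \<bar>z\<bar>} x"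
    have "norm (L2_of (\<lambda>x. indicat_real {a..b} (z + x)) - L2_of (indicat_real {a..b})) =
        sqrt (LINT x|lebesgue. (indicat_real {a..b} (z + x) - indicat_real {a..b} x)\<^sup>2)"
      by (subst L2_of_diff[symmetric]) (auto intro!: norm_L2_of sq_integrable_diff sq sq_integrable_shift)
    also have "\<dots> \<le> sqrt (LINT x|lebesgue. ?h x)"
    proof (intro real_sqrt_le_mono integral_mono)
      show "integrable lebesgue (\<lambda>x. (indicat_real {a..b} (z + x) - indicat_real {a..b} x)\<^sup>2)"
        by (intro sq_integrable_power2 sq_integrable_diff sq sq_integrable_shift)
      show "integrable lebesgue ?h"
        by (intro Bochner_Integration.integrable_add integrable_real_indicator) auto
      show "(indicat_real {a..b} (z + x) - indicat_real {a..b} x)\<^sup>2 \<le> ?h x" for x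
        by (auto simp: indicator_def)
    qed
    also have "(LINT x|lebesgue. ?h x) = 4 * \<bar>z\<bar>"
      by (subst Bochner_Integration.integral_add) (auto intro!: integrable_real_indicator)
    finally show ?thesis .
  qed
  have "((\<lambda>z. sqrt (4 * \<bar>z\<bar>)) \<longlongrightarrow> sqrt (4 * \<bar>0\<bar>)) (at (0 :: real))"
    by (intro tendsto_intros)
  then have "((\<lambda>z. L2_of (\<lambda>x. indicat_real {a..b} (z + x)) - L2_of (indicat_real {a..b})) \<longlongrightarrow> 0) (at 0)"
    by (intro Lim_null_comparison[OF always_eventually[OF allI[OF bound]]]) simp
  then show ?thesis by (rule LIM_zero_cancel)
qed

text \<open>Translation acts on functions. The combination of indicator functions itself, rather than the
  representative chosen by the quotient, is translated summand by summand.\<close>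

lemma L2_shift_dense:
  assumes "v \<in> L2_dense"
  shows "\<exists>f. sq_integrable f \<and> v = L2_of f \<and> ((\<lambda>z. L2_of (\<lambda>x. f (z + x))) \<longlongrightarrow> L2_of f) (at 0)"
proof -
  obtain l :: "(rat \<times> rat \<times> rat) list" where
    v: "v = sum_list (map (\<lambda>(q, a, b). of_rat q *\<^sub>R L2_ind {of_rat a..of_rat b}) l)"
    using assms by (auto simp: L2_dense_def)
  show ?thesis
    unfolding v
  proof (induction l)
    case Nil
    have "L2_of (\<lambda>x. 0) = 0" using norm_L2_of[of "\<lambda>x. 0"] by simp
    then show ?case by (intro exI[of _ "\<lambda>x. 0"]) simp
  next
    case (Cons h l)
    obtain q a b where h: "h = (q, a, b)" by (cases h)
    obtain f where f: "sq_integrable f"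
      "sum_list (map (\<lambda>(q, a, b). of_rat q *\<^sub>R L2_ind {of_rat a..of_rat b}) l) = L2_of f"
      "((\<lambda>z. L2_of (\<lambda>x. f (z + x))) \<longlongrightarrow> L2_of f) (at 0)"
      using Cons by blast
    define g :: "real \<Rightarrow> real" where "g = indicat_real {of_rat a..of_rat b}"
    have g: "sq_integrable g" unfolding g_def by (rule sq_integrable_indicator) simp
    have gc: "((\<lambda>z. L2_of (\<lambda>x. g (z + x))) \<longlongrightarrow> L2_of g) (at 0)"
      unfolding g_def by (rule L2_shift_indicator)
    let ?k = "\<lambda>x. of_rat q * g x + f x"
    have eq: "L2_of (\<lambda>x. ?k (z + x)) = of_rat q *\<^sub>R L2_of (\<lambda>x. g (z + x)) + L2_of (\<lambda>x. f (z + x))" for z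
      using f(1) g by (simp add: L2_of_add L2_of_cmult sq_integrable_cmult sq_integrable_shift)
    have eq0: "L2_of ?k = of_rat q *\<^sub>R L2_of g + L2_of f"
      using eq[of 0] by simp
    have "((\<lambda>z. L2_of (\<lambda>x. ?k (z + x))) \<longlongrightarrow> L2_of ?k) (at 0)"
      unfolding eq eq0 by (intro tendsto_intros f(3) gc)
    moreover have "sq_integrable ?k" using f(1) g by (intro sq_integrable_add sq_integrable_cmult)
    ultimately show ?case
      using f(2) eq0 by (intro exI[of _ ?k]) (simp add: h g_def L2_ind_def)
  qed
qed

text \<open>Translations are isometries, so continuity at \<open>0\<close> extends from a dense set.\<close>

lemma L2_shift_tendsto:
  assumes f: "sq_integrable f"
  shows "((\<lambda>z. L2_of (\<lambda>x. f (z + x))) \<longlongrightarrow> L2_of f) (at 0)"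
proof (rule tendstoI)
  fix e :: real assume "e > 0"
  then have "L2_of f \<in> closure L2_dense" "e / 3 > 0" by (simp_all add: closure_L2_dense)
  then obtain v where v: "v \<in> L2_dense" "dist v (L2_of f) < e / 3"
    unfolding closure_approachable by blast
  obtain g where g: "sq_integrable g" "v = L2_of g" "((\<lambda>z. L2_of (\<lambda>x. g (z + x))) \<longlongrightarrow> L2_of g) (at 0)"
    using L2_shift_dense[OF v(1)] by blast
  have "\<forall>\<^sub>F z in at 0. dist (L2_of (\<lambda>x. g (z + x))) (L2_of g) < e / 3"
    using tendstoD[OF g(3) \<open>e / 3 > 0\<close>] .
  then show "\<forall>\<^sub>F z in at 0. dist (L2_of (\<lambda>x. f (z + x))) (L2_of f) < e"
  proof eventually_elim
    case (elim z)
    have "dist (L2_of (\<lambda>x. f (z + x))) (L2_of (\<lambda>x. g (z + x))) < e / 3"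
      using v(2) norm_L2_of_shift_diff[OF f g(1), of z] by (simp add: g(2) dist_norm norm_minus_commute)
    then show ?case
      using elim v(2) dist_triangle[of "L2_of (\<lambda>x. f (z + x))" "L2_of f" "L2_of (\<lambda>x. g (z + x))"]
        dist_triangle[of "L2_of (\<lambda>x. g (z + x))" "L2_of f" "L2_of g"] by (simp add: g(2))
  qed
qed

definition conv :: "(real \<Rightarrow> real) \<Rightarrow> (real \<Rightarrow> real) \<Rightarrow> real \<Rightarrow> real" where
  "conv f \<phi> x = (LINT y|lebesgue. f y * \<phi> (x - y))"

lemma test_function_reflect: "test_function \<phi> \<Longrightarrow> test_function (\<lambda>y. \<phi> (x - y))"
  using test_function_affine[of \<phi> "- 1" 1 x] by simp

text \<open>Differentiation under the integral sign: by the mean value theorem the difference quotients of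
  \<open>\<phi>\<close> are bounded by \<open>K\<close> and supported in one fixed interval.\<close>

lemma conv_has_derivative:
  assumes f: "sq_integrable f" and \<phi>: "test_function \<phi>"
  shows "(conv f \<phi> has_real_derivative conv f (deriv \<phi>) x) (at x)"
proof -
  note \<phi>' = test_function_deriv[OF \<phi>]
  obtain K R where KR: "K \<ge> 0" "R \<ge> 0" "\<And>x. \<bar>deriv \<phi> x\<bar> \<le> K * indicat_real {- R..R} x"
    using test_function_bounded_support[OF \<phi>'] by blast
  have sq: "integrable lebesgue (\<lambda>y. f y * \<psi> (a - y))" if "test_function \<psi>" for \<psi> a
    by (rule sq_integrable_prod[OF f test_function_sq_integrable[OF test_function_reflect[OF that]]])
  have [measurable]: "f \<in> borel_measurable lebesgue" using f by (simp add: sq_integrable_measurable)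
  have [measurable]: "(\<lambda>y. \<psi> (a - y)) \<in> borel_measurable lebesgue" if "test_function \<psi>" for \<psi> a
    using test_function_sq_integrable[OF test_function_reflect[OF that, of a]] by (rule sq_integrable_measurable)
  have "((\<lambda>h. (conv f \<phi> (x + h) - conv f \<phi> x) / h) \<longlongrightarrow> conv f (deriv \<phi>) x) (at 0)"
    unfolding tendsto_at_iff_sequentially
  proof (intro allI impI)
    fix h :: "nat \<Rightarrow> real"
    assume h: "\<forall>i. h i \<in> UNIV - {0}" "h \<longlonglongrightarrow> 0"
    obtain H where H: "\<And>n. \<bar>h n\<bar> \<le> H"
      using convergent_imp_Bseq[of h] h(2) by (auto simp: convergent_def Bseq_def)
    define D where "D n y = f y * ((\<phi> (x + h n - y) - \<phi> (x - y)) / h n)" for n y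
    have D_eq: "((\<lambda>h. (conv f \<phi> (x + h) - conv f \<phi> x) / h) \<circ> h) n = (LINT y|lebesgue. D n y)" for n
    proof -
      have "(LINT y|lebesgue. D n y) = (LINT y|lebesgue. (f y * \<phi> (x + h n - y) - f y * \<phi> (x - y)) / h n)"
        unfolding D_def by (simp add: right_diff_distrib)
      also have "\<dots> = (conv f \<phi> (x + h n) - conv f \<phi> x) / h n"
        unfolding conv_def using sq[OF \<phi>] by simp
      finally show ?thesis by simp
    qed
    have "(\<lambda>n. LINT y|lebesgue. D n y) \<longlonglongrightarrow> (LINT y|lebesgue. f y * deriv \<phi> (x - y))"
    proof (rule integral_dominated_convergence)
      show "(\<lambda>y. f y * deriv \<phi> (x - y)) \<in> borel_measurable lebesgue"
        using sq[OF \<phi>'] by (rule borel_measurable_integrable)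
      show "D n \<in> borel_measurable lebesgue" for n
        unfolding D_def using \<phi> by measurable
      \<comment> \<open>\<open>R\<close> bounds the support of the derivative, \<open>H\<close> all increments \<open>h n\<close>.\<close>
      let ?I = "indicat_real {x - (R + H)..x + (R + H)}"
      show "integrable lebesgue (\<lambda>y. \<bar>f y\<bar> * (K * ?I y))"
        using integrable_abs[OF sq_integrable_prod[OF f sq_integrable_cmult[OF sq_integrable_indicator[of "{x - (R + H)..x + (R + H)}"], of K]]]
          KR(1) by (simp add: abs_mult)
      show "AE y in lebesgue. (\<lambda>n. D n y) \<longlonglongrightarrow> f y * deriv \<phi> (x - y)"
      proof (intro AE_I2)
        fix y
        have "((\<lambda>h. (\<phi> (x - y + h) - \<phi> (x - y)) / h) \<longlongrightarrow> deriv \<phi> (x - y)) (at 0)"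
          using test_function_has_derivative[OF \<phi>, of "x - y"] by (simp add: DERIV_def)
        then have "(\<lambda>n. (\<phi> (x - y + h n) - \<phi> (x - y)) / h n) \<longlonglongrightarrow> deriv \<phi> (x - y)"
          using h unfolding tendsto_at_iff_sequentially by (auto simp: o_def)
        then show "(\<lambda>n. D n y) \<longlonglongrightarrow> f y * deriv \<phi> (x - y)"
          unfolding D_def by (intro tendsto_intros) (simp add: algebra_simps)
      qed
      show "AE y in lebesgue. norm (D n y) \<le> \<bar>f y\<bar> * (K * ?I y)" for n
      proof (intro AE_I2)
        fix y
        have "\<exists>z. \<bar>z - (x - y)\<bar> \<le> \<bar>h n\<bar> \<and> \<phi> (x - y + h n) - \<phi> (x - y) = h n * deriv \<phi> z"
        proof (cases "h n > 0")
          case True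
          then obtain z where "x - y < z" "z < x - y + h n"
            "\<phi> (x - y + h n) - \<phi> (x - y) = (x - y + h n - (x - y)) * deriv \<phi> z"
            using MVT2[of "x - y" "x - y + h n" \<phi> "deriv \<phi>"] test_function_has_derivative[OF \<phi>] by auto
          then show ?thesis by (intro exI[of _ z]) auto
        next
          case False
          then have "h n < 0" using h(1) by (metis DiffE UNIV_I insertI1 linorder_neqE_linordered_idom)
          then obtain z where "x - y + h n < z" "z < x - y"
            "\<phi> (x - y) - \<phi> (x - y + h n) = (x - y - (x - y + h n)) * deriv \<phi> z"
            using MVT2[of "x - y + h n" "x - y" \<phi> "deriv \<phi>"] test_function_has_derivative[OF \<phi>] by auto
          then show ?thesis by (intro exI[of _ z]) (auto simp: algebra_simps)
        qed
        then obtain z where z: "\<bar>z - (x - y)\<bar> \<le> \<bar>h n\<bar>" "\<phi> (x - y + h n) - \<phi> (x - y) = h n * deriv \<phi> z"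
          by blast
        have "h n \<noteq> 0" using h(1) by auto
        have "norm (D n y) = \<bar>f y\<bar> * \<bar>deriv \<phi> z\<bar>"
          using z(2) \<open>h n \<noteq> 0\<close> by (simp add: D_def abs_mult algebra_simps)
        also have "\<bar>deriv \<phi> z\<bar> \<le> K * ?I y"
        proof (cases "z \<in> {- R..R}")
          case True
          then have "y \<in> {x - (R + H)..x + (R + H)}" using z(1) H[of n] by auto
          then show ?thesis using KR(3)[of z] True by simp
        next
          case False
          then show ?thesis using KR(3)[of z] KR(1) by simp
        qed
        finally show "norm (D n y) \<le> \<bar>f y\<bar> * (K * ?I y)" by (simp add: mult_left_mono)
      qed
    qed
    moreover have "((\<lambda>h. (conv f \<phi> (x + h) - conv f \<phi> x) / h) \<circ> h) = (\<lambda>n. LINT y|lebesgue. D n y)"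
      by (rule ext) (rule D_eq)
    ultimately show "((\<lambda>h. (conv f \<phi> (x + h) - conv f \<phi> x) / h) \<circ> h) \<longlonglongrightarrow> conv f (deriv \<phi>) x"
      unfolding conv_def[of f "deriv \<phi>"] by metis
  qed
  then show ?thesis by (simp add: DERIV_def)
qed

lemma conv_continuous: "sq_integrable f \<Longrightarrow> test_function \<phi> \<Longrightarrow> continuous_on A (conv f \<phi>)"
  by (intro continuous_at_imp_continuous_on ballI DERIV_isCont[OF conv_has_derivative])


lemma norm_L2_of_diff_power2:
  assumes "sq_integrable f" "sq_integrable g"
  shows "(norm (L2_of f - L2_of g))\<^sup>2 = (LINT x|lebesgue. (f x - g x)\<^sup>2)"
  unfolding L2_of_diff[OF assms, symmetric] norm_L2_of[OF sq_integrable_diff[OF assms]] by simp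

text \<open>By Jensen's inequality for the probability density \<open>\<phi>\<close>, the square of \<open>conv f \<phi> x - f x\<close> is at most the
  \<open>\<phi>\<close>-average of \<open>(f (x - z) - f x)\<^sup>2\<close>. Integrating in \<open>x\<close> and exchanging the integrals leaves the
  \<open>\<phi>\<close>-average of the squared distances between \<open>f\<close> and its translates. Tonelli's theorem is applied to a Borel
  representative \<open>g\<close> of \<open>f\<close>, because \<open>f (x - z)\<close> need not be measurable in \<open>(x, z)\<close> for the product of
  Borel \<open>\<sigma>\<close>-algebras.\<close>

lemma conv_close:
  assumes f: "sq_integrable f" and \<phi>: "test_function \<phi>" "\<And>x. \<phi> x \<ge> 0" "integrable lborel \<phi>" "(LINT x|lborel. \<phi> x) = 1"
    and supp: "\<And>x. \<bar>x\<bar> > \<delta> \<Longrightarrow> \<phi> x = 0" and e: "e \<ge> 0"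
    and shift: "\<And>z. \<bar>z\<bar> \<le> \<delta> \<Longrightarrow> norm (L2_of (\<lambda>x. f (z + x)) - L2_of f) \<le> e"
  shows "sq_integrable (conv f \<phi>)" "norm (L2_of (conv f \<phi>) - L2_of f) \<le> e"
proof -
  obtain g where g [measurable]: "g \<in> borel_measurable lborel" and fg: "AE x in lborel. f x = g x"
    using completion_ex_borel_measurable_real[of f lborel] f by (auto simp: sq_integrable_def)
  have [measurable]: "g \<in> borel_measurable borel" using g by simp
  have fg': "AE x in lebesgue. f x = g x" using fg by (rule AE_completion)
  have [measurable]: "f \<in> borel_measurable lebesgue" using f by (simp add: sq_integrable_measurable)
  have g_leb [measurable]: "g \<in> borel_measurable lebesgue" using g by (rule measurable_completion)
  have [measurable]: "\<phi> \<in> borel_measurable borel"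
    by (rule borel_measurable_continuous_onI[OF test_function_continuous[OF \<phi>(1)]])
  have g_sq: "sq_integrable g"
  proof -
    have "integrable lebesgue (\<lambda>x. (g x)\<^sup>2) \<longleftrightarrow> integrable lebesgue (\<lambda>x. (f x)\<^sup>2)"
    proof (rule integrable_cong_AE)
      show "AE x in lebesgue. (g x)\<^sup>2 = (f x)\<^sup>2" using fg' by eventually_elim simp
    qed measurable
    then show ?thesis using f g_leb by (simp add: sq_integrable_def)
  qed
  have g_sq': "integrable lborel (\<lambda>x. (g x)\<^sup>2)"
    using sq_integrable_power2[OF g_sq] by (simp add: integrable_completion)
  have Lfg: "L2_of f = L2_of g"
    by (rule L2_eqI) (use rep_L2_of[OF f] rep_L2_of[OF g_sq] fg' in eventually_elim, simp)
  have Lshift: "norm (L2_of (\<lambda>x. g (z + x)) - L2_of g) \<le> e" if "\<bar>z\<bar> \<le> \<delta>" for z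
  proof -
    have "norm (L2_of (\<lambda>x. f (z + x)) - L2_of (\<lambda>x. g (z + x))) = 0"
      using norm_L2_of_shift_diff[OF f g_sq, of z] by (simp add: Lfg)
    then show ?thesis using shift[OF that] by (simp add: Lfg)
  qed
  have conv_fg: "conv f \<phi> x = (LINT y|lborel. g y * \<phi> (x - y))" for x
  proof -
    have "conv f \<phi> x = (LINT y|lebesgue. g y * \<phi> (x - y))"
      unfolding conv_def
    proof (rule integral_cong_AE)
      show "AE y in lebesgue. f y * \<phi> (x - y) = g y * \<phi> (x - y)"
        using fg' by eventually_elim simp
    qed (auto intro!: borel_measurable_times g_leb sq_integrable_measurable[OF f]
        sq_integrable_measurable[OF test_function_sq_integrable[OF test_function_reflect[OF \<phi>(1)]]])
    also have "\<dots> = (LINT y|lborel. g y * \<phi> (x - y))"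
      by (rule integral_completion) measurable
    finally show ?thesis .
  qed
  obtain K R where KR: "K \<ge> 0" "R \<ge> 0" "\<And>x. \<bar>\<phi> x\<bar> \<le> K * indicat_real {- R..R} x"
    using test_function_bounded_support[OF \<phi>(1)] by blast
  have \<phi>K: "\<phi> x \<le> K" for x
    using KR(3)[of x] KR(1) \<phi>(2)[of x] by (cases "x \<in> {- R..R}") auto
  have I1: "integrable lborel (\<lambda>z. g (x - z) * \<phi> z)" for x
  proof -
    have "integrable lebesgue (\<lambda>y. g y * \<phi> (x - y))"
      by (rule sq_integrable_prod[OF g_sq test_function_sq_integrable[OF test_function_reflect[OF \<phi>(1)]]])
    then have "integrable lborel (\<lambda>y. g y * \<phi> (x - y))" by (simp add: integrable_completion)
    then show ?thesis
      using lborel_integrable_real_affine_iff[of "- 1" "\<lambda>y. g y * \<phi> (x - y)" x] by simp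
  qed
  have conv_g: "conv f \<phi> x = (LINT z|lborel. g (x - z) * \<phi> z)" for x
    unfolding conv_fg
    using lborel_integral_real_affine[of "- 1" "\<lambda>y. g y * \<phi> (x - y)" x] by simp
  have I2: "integrable lborel (\<lambda>z. (g (x - z))\<^sup>2 * \<phi> z)" for x
  proof (rule Bochner_Integration.integrable_bound)
    show "integrable lborel (\<lambda>z. K * (g (x - z))\<^sup>2)"
      using lborel_integrable_real_affine_iff[of "- 1" "\<lambda>y. (g y)\<^sup>2" x] g_sq' by simp
    show "AE z in lborel. norm ((g (x - z))\<^sup>2 * \<phi> z) \<le> norm (K * (g (x - z))\<^sup>2)"
      using \<phi>K \<phi>(2) KR(1) by (intro AE_I2) (simp add: abs_mult mult.commute mult_right_mono)
  qed measurable
  have pw: "ennreal ((conv f \<phi> x - g x)\<^sup>2) \<le> (\<integral>\<^sup>+z. ennreal ((g (x - z) - g x)\<^sup>2 * \<phi> z) \<partial>lborel)" for x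
  proof -
    \<comment> \<open>\<open>m\<close> is the mean of \<open>g (x - z) - g x\<close> under \<open>\<phi>\<close>; the variance is nonnegative.\<close>
    define m where "m = conv f \<phi> x - g x"
    have eq: "(g (x - z) - g x)\<^sup>2 * \<phi> z = (g (x - z))\<^sup>2 * \<phi> z - 2 * g x * (g (x - z) * \<phi> z) + (g x)\<^sup>2 * \<phi> z" for z
      by (simp add: power2_eq_square algebra_simps)
    have int: "integrable lborel (\<lambda>z. (g (x - z) - g x)\<^sup>2 * \<phi> z)"
      unfolding eq using I1[of x] I2[of x] \<phi>(3) by simp
    have eq2: "(g (x - z) - g x - m)\<^sup>2 * \<phi> z =
        (g (x - z) - g x)\<^sup>2 * \<phi> z - 2 * m * (g (x - z) * \<phi> z) + (2 * m * g x + m\<^sup>2) * \<phi> z" for z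
      by (simp add: power2_eq_square algebra_simps)
    have "0 \<le> (LINT z|lborel. (g (x - z) - g x - m)\<^sup>2 * \<phi> z)"
      using \<phi>(2) by simp
    also have "\<dots> = (LINT z|lborel. (g (x - z) - g x)\<^sup>2 * \<phi> z) - 2 * m * conv f \<phi> x + (2 * m * g x + m\<^sup>2)"
      unfolding eq2 conv_g using int I1[of x] \<phi>(3,4) by simp
    also have "\<dots> = (LINT z|lborel. (g (x - z) - g x)\<^sup>2 * \<phi> z) - m\<^sup>2"
      by (simp add: m_def power2_eq_square algebra_simps)
    finally have "m\<^sup>2 \<le> (LINT z|lborel. (g (x - z) - g x)\<^sup>2 * \<phi> z)" by simp
    then show ?thesis
      using int \<phi>(2) by (subst nn_integral_eq_integral) (auto simp: m_def intro: ennreal_leI)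
  qed
  have conv_meas [measurable]: "conv f \<phi> \<in> borel_measurable borel"
    by (rule borel_measurable_continuous_onI[OF conv_continuous[OF f \<phi>(1)]])
  have "(\<integral>\<^sup>+x. ennreal ((conv f \<phi> x - g x)\<^sup>2) \<partial>lborel)
      \<le> (\<integral>\<^sup>+x. \<integral>\<^sup>+z. ennreal ((g (x - z) - g x)\<^sup>2 * \<phi> z) \<partial>lborel \<partial>lborel)"
    by (rule nn_integral_mono) (rule pw)
  also have "\<dots> = (\<integral>\<^sup>+z. \<integral>\<^sup>+x. ennreal ((g (x - z) - g x)\<^sup>2 * \<phi> z) \<partial>lborel \<partial>lborel)"
    by (rule lborel_pair.Fubini'[symmetric]) measurable
  also have "\<dots> \<le> (\<integral>\<^sup>+z. ennreal (e\<^sup>2) * ennreal (\<phi> z) \<partial>lborel)"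
  proof (rule nn_integral_mono)
    fix z
    show "(\<integral>\<^sup>+x. ennreal ((g (x - z) - g x)\<^sup>2 * \<phi> z) \<partial>lborel) \<le> ennreal (e\<^sup>2) * ennreal (\<phi> z)"
    proof (cases "\<bar>z\<bar> \<le> \<delta>")
      case False
      then show ?thesis using supp[of z] by simp
    next
      case True
      have sqd: "sq_integrable (\<lambda>x. g (- z + x) - g x)"
        by (intro sq_integrable_diff sq_integrable_shift g_sq)
      have "(\<integral>\<^sup>+x. ennreal ((g (x - z) - g x)\<^sup>2) \<partial>lborel) = ennreal (LINT x|lebesgue. (g (- z + x) - g x)\<^sup>2)"
        using sq_integrable_power2[OF sqd]
        by (subst nn_integral_eq_integral) (auto simp: integrable_completion integral_completion)
      also have "(LINT x|lebesgue. (g (- z + x) - g x)\<^sup>2) = (norm (L2_of (\<lambda>x. g (- z + x)) - L2_of g))\<^sup>2"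
        by (rule norm_L2_of_diff_power2[OF sq_integrable_shift[OF g_sq] g_sq, symmetric])
      also have "ennreal \<dots> \<le> ennreal (e\<^sup>2)"
        using Lshift[of "- z"] True by (intro ennreal_leI power_mono) auto
      finally show ?thesis
        using \<phi>(2)[of z] by (simp add: ennreal_mult nn_integral_multc mult_right_mono)
    qed
  qed
  also have "\<dots> = ennreal (e\<^sup>2)"
    using \<phi> by (simp add: nn_integral_cmult nn_integral_eq_integral)
  finally have le: "(\<integral>\<^sup>+x. ennreal ((conv f \<phi> x - g x)\<^sup>2) \<partial>lborel) \<le> ennreal (e\<^sup>2)" .
  have "integrable lborel (\<lambda>x. (conv f \<phi> x - g x)\<^sup>2)"
    by (intro integrableI_nonneg) (use le_less_trans[OF le] in auto)
  then have sqd: "sq_integrable (\<lambda>x. conv f \<phi> x - g x)"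
    unfolding sq_integrable_def by (auto simp: integrable_completion intro!: measurable_completion)
  from sq_integrable_add[OF this g_sq] show sqc: "sq_integrable (conv f \<phi>)" by simp
  have "ennreal ((norm (L2_of (conv f \<phi>) - L2_of f))\<^sup>2) = ennreal (LINT x|lebesgue. (conv f \<phi> x - g x)\<^sup>2)"
    by (simp add: Lfg norm_L2_of_diff_power2[OF sqc g_sq])
  also have "\<dots> = (\<integral>\<^sup>+x. ennreal ((conv f \<phi> x - g x)\<^sup>2) \<partial>lborel)"
    using sq_integrable_power2[OF sqd]
    by (subst nn_integral_eq_integral) (auto simp: integrable_completion integral_completion)
  finally have "ennreal ((norm (L2_of (conv f \<phi>) - L2_of f))\<^sup>2) \<le> ennreal (e\<^sup>2)" using le by simp
  then have "(norm (L2_of (conv f \<phi>) - L2_of f))\<^sup>2 \<le> e\<^sup>2" by simp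
  then show "norm (L2_of (conv f \<phi>) - L2_of f) \<le> e"
    by (rule power2_le_imp_le) (rule e)
qed

lemma mollifier_sequence:
  obtains \<eta> :: "nat \<Rightarrow> real \<Rightarrow> real" where "\<And>n. test_function (\<eta> n)"
    "\<And>f. sq_integrable f \<Longrightarrow> \<forall>n. sq_integrable (conv f (\<eta> n))"
    "\<And>f. sq_integrable f \<Longrightarrow> (\<lambda>n. L2_of (conv f (\<eta> n))) \<longlonglongrightarrow> L2_of f"
proof -
  obtain \<eta> where \<eta>: "test_function \<eta>" "\<And>x. \<eta> x \<ge> 0" "\<And>x. \<bar>x\<bar> > 1 \<Longrightarrow> \<eta> x = 0"
    "integrable lborel \<eta>" "(LINT x|lborel. \<eta> x) = 1"
    using exists_mollifier by blast
  define \<eta>n where "\<eta>n n x = real (Suc n) * \<eta> (0 + real (Suc n) * x)" for n x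
  have test: "test_function (\<eta>n n)" for n
    unfolding \<eta>n_def by (rule test_function_affine[OF \<eta>(1)]) simp
  have nonneg: "\<eta>n n x \<ge> 0" for n x using \<eta>(2) by (simp add: \<eta>n_def)
  have int: "integrable lborel (\<eta>n n)" for n
    unfolding \<eta>n_def
    using lborel_integrable_real_affine_iff[of "real (Suc n)" \<eta> 0] \<eta>(4) by simp
  have int1: "(LINT x|lborel. \<eta>n n x) = 1" for n
    unfolding \<eta>n_def using lborel_integral_real_affine[of "real (Suc n)" \<eta> 0] \<eta>(5) by simp
  have supp: "\<eta>n n x = 0" if "\<bar>x\<bar> > 1 / real (Suc n)" for n x
  proof -
    have "real (Suc n) * \<bar>x\<bar> > 1" using that by (simp add: field_simps)
    then show ?thesis using \<eta>(3)[of "real (Suc n) * x"] by (simp add: \<eta>n_def abs_mult)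
  qed
  show thesis
  proof (rule that[of \<eta>n, OF test])
    fix f assume f: "sq_integrable f"
    show "\<forall>n. sq_integrable (conv f (\<eta>n n))"
    proof
      fix n
      have "norm (L2_of (\<lambda>x. f (z + x)) - L2_of f) \<le> 2 * norm (L2_of f)" for z
      proof -
        have "norm (L2_of (\<lambda>x. f (z + x))) = norm (L2_of f)"
          using norm_L2_of_shift_diff[OF f sq_integrable_zero, of z] norm_L2_of[of "\<lambda>x. 0"] by simp
        then show ?thesis using norm_triangle_ineq4[of "L2_of (\<lambda>x. f (z + x))" "L2_of f"] by simp
      qed
      then show "sq_integrable (conv f (\<eta>n n))"
        by (intro conv_close(1)[OF f test nonneg int int1 supp, where e = "2 * norm (L2_of f)"]) auto
    qed
    show "(\<lambda>n. L2_of (conv f (\<eta>n n))) \<longlonglongrightarrow> L2_of f"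
    proof (rule LIMSEQ_I)
      fix r :: real assume "r > 0"
      then have "\<forall>\<^sub>F z in at 0. dist (L2_of (\<lambda>x. f (z + x))) (L2_of f) < r / 2"
        by (intro tendstoD[OF L2_shift_tendsto[OF f]]) simp
      then obtain d where d: "d > 0"
        "\<And>z. z \<noteq> 0 \<Longrightarrow> \<bar>z\<bar> < d \<Longrightarrow> norm (L2_of (\<lambda>x. f (z + x)) - L2_of f) < r / 2"
        by (auto simp: eventually_at dist_norm)
      obtain N where N: "1 / real (Suc N) < d" using nat_approx_posE[OF d(1)] by blast
      have "norm (L2_of (conv f (\<eta>n n)) - L2_of f) \<le> r / 2" if "n \<ge> N" for n
      proof (rule conv_close(2)[OF f test nonneg int int1 supp])
        fix z assume "\<bar>z\<bar> \<le> 1 / real (Suc n)"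
        also have "\<dots> \<le> 1 / real (Suc N)" using that by (simp add: frac_le)
        also note N
        finally show "norm (L2_of (\<lambda>x. f (z + x)) - L2_of f) \<le> r / 2"
          using d(2)[of z] \<open>r > 0\<close> by (cases "z = 0") auto
      qed (use \<open>r > 0\<close> in auto)
      then show "\<exists>N. \<forall>n\<ge>N. norm (L2_of (conv f (\<eta>n n)) - L2_of f) < r"
        using \<open>r > 0\<close> by (metis field_sum_of_halves le_less_trans less_add_same_cancel1 half_gt_zero)
    qed
  qed
qed


section \<open>Weak derivatives\<close>

text \<open>The function \<open>y \<mapsto> \<phi> (x - y)\<close> is itself a test function, so the definition of the weak derivative says
  precisely that mollification commutes with differentiation.\<close>

lemma conv_weak_deriv:
  assumes "has_weak_deriv k f g" and \<phi>: "test_function \<phi>"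
  shows "conv (rep_L2 f) ((deriv ^^ k) \<phi>) x = conv (rep_L2 g) \<phi> x"
proof -
  define \<psi> where "\<psi> = (\<lambda>y. 1 * \<phi> (x + (- 1) * y))"
  have "test_function \<psi>" unfolding \<psi>_def by (rule test_function_affine[OF \<phi>]) simp
  then have "(LINT y|lebesgue. rep_L2 f y * (deriv ^^ k) \<psi> y) = (- 1) ^ k * (LINT y|lebesgue. rep_L2 g y * \<psi> y)"
    using assms(1) unfolding has_weak_deriv_def by blast
  moreover have "(deriv ^^ k) \<psi> = (\<lambda>y. 1 * (- 1) ^ k * (deriv ^^ k) \<phi> (x + (- 1) * y))"
    unfolding \<psi>_def by (rule funpow_deriv_affine) (rule test_function_differentiable[OF \<phi>])
  moreover have "(LINT y|lebesgue. rep_L2 f y * ((- 1) ^ k * (deriv ^^ k) \<phi> (x - y)))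
      = (- 1) ^ k * (LINT y|lebesgue. rep_L2 f y * (deriv ^^ k) \<phi> (x - y))"
    unfolding mult.left_commute[of _ "(- 1) ^ k"] by simp
  ultimately show ?thesis by (simp add: \<psi>_def conv_def)
qed

text \<open>Two weak derivatives have the same mollifications, and these determine the class.\<close>

lemma weak_deriv_unique:
  assumes "has_weak_deriv k f g" "has_weak_deriv k f h"
  shows "g = h"
proof -
  obtain \<eta> where \<eta>: "\<And>n. test_function (\<eta> n)"
    "\<And>f. sq_integrable f \<Longrightarrow> (\<lambda>n. L2_of (conv f (\<eta> n))) \<longlonglongrightarrow> L2_of f"
    by (rule mollifier_sequence) blast
  have "conv (rep_L2 g) (\<eta> n) = conv (rep_L2 h) (\<eta> n)" for n
    using conv_weak_deriv[OF assms(1) \<eta>(1)] conv_weak_deriv[OF assms(2) \<eta>(1)] by (auto simp: fun_eq_iff)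
  then show "g = h"
    using \<eta>(2)[OF sq_integrable_rep[of g]] \<eta>(2)[OF sq_integrable_rep[of h]]
    by (simp add: L2_of_rep LIMSEQ_unique)
qed

lemma weak_deriv_eq: "has_weak_deriv k f g \<Longrightarrow> weak_deriv k f = g"
  unfolding weak_deriv_def by (rule the_equality) (auto intro: weak_deriv_unique)

lemma has_weak_deriv_Suc:
  assumes "has_weak_deriv j f g" "has_weak_deriv (Suc j) f h"
  shows "has_weak_deriv 1 g h"
  unfolding has_weak_deriv_def
proof (intro allI impI)
  fix \<phi> assume \<phi>: "test_function \<phi>"
  have "(LINT x|lebesgue. rep_L2 f x * (deriv ^^ j) (deriv \<phi>) x) = (- 1) ^ j * (LINT x|lebesgue. rep_L2 g x * deriv \<phi> x)"
    using assms(1) test_function_deriv[OF \<phi>] unfolding has_weak_deriv_def by blast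
  moreover have "(LINT x|lebesgue. rep_L2 f x * (deriv ^^ Suc j) \<phi> x) = (- 1) ^ Suc j * (LINT x|lebesgue. rep_L2 h x * \<phi> x)"
    using assms(2) \<phi> unfolding has_weak_deriv_def by blast
  ultimately have "(- 1) ^ j * (LINT x|lebesgue. rep_L2 g x * deriv \<phi> x) = (- 1) ^ j * (- (LINT x|lebesgue. rep_L2 h x * \<phi> x))"
    by (simp add: funpow_swap1)
  then have "(LINT x|lebesgue. rep_L2 g x * deriv \<phi> x) = - (LINT x|lebesgue. rep_L2 h x * \<phi> x)"
    by (subst (asm) mult_cancel_left) simp
  then show "(LINT x|lebesgue. rep_L2 g x * (deriv ^^ 1) \<phi> x) = (- 1) ^ 1 * (LINT x|lebesgue. rep_L2 h x * \<phi> x)"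
    by simp
qed

text \<open>An integrable function need not tend to \<open>0\<close>, but it is small at arbitrarily remote points, which is
  all that is needed to drop boundary terms.\<close>

lemma integrable_imp_small_at_top:
  fixes F :: "real \<Rightarrow> real"
  assumes F: "integrable lebesgue F" and e: "e > 0"
  shows "\<exists>x\<ge>N. \<bar>F x\<bar> < e"
proof (rule ccontr)
  assume "\<not> ?thesis"
  then have big: "\<And>x. x \<ge> N \<Longrightarrow> e \<le> \<bar>F x\<bar>" by (auto simp: not_less)
  \<comment> \<open>Otherwise \<open>\<bar>F\<bar> \<ge> e\<close> on an interval of length \<open>m\<close>, which is too long for the integral of \<open>\<bar>F\<bar>\<close>.\<close>
  define m where "m = (LINT x|lebesgue. \<bar>F x\<bar>) / e + 1"
  have m: "m > 0" using e by (simp add: m_def add_nonneg_pos)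
  have "(LINT x|lebesgue. e * indicat_real {N..N + m} x) \<le> (LINT x|lebesgue. \<bar>F x\<bar>)"
  proof (rule integral_mono)
    show "integrable lebesgue (\<lambda>x. e * indicat_real {N..N + m} x)"
      by (intro integrable_mult_right integrable_real_indicator) (auto simp: emeasure_lborel_Icc_eq)
    show "integrable lebesgue (\<lambda>x. \<bar>F x\<bar>)" using F by simp
    show "e * indicat_real {N..N + m} x \<le> \<bar>F x\<bar>" for x
      using big[of x] by (auto simp: indicator_def)
  qed
  also have "(LINT x|lebesgue. e * indicat_real {N..N + m} x) = e * m" using m by simp
  also have "e * m = (LINT x|lebesgue. \<bar>F x\<bar>) + e" using e by (simp add: m_def distrib_left)
  finally show False using e by simp
qed

lemma integrable_imp_small_at_bot:
  fixes F :: "real \<Rightarrow> real"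
  assumes F: "integrable lebesgue F" and e: "e > 0"
  shows "\<exists>x\<le>N. \<bar>F x\<bar> < e"
proof -
  have "integrable lebesgue (\<lambda>x. F (0 + (- 1) * x))"
    by (rule lebesgue_integrable_real_affine[OF F]) simp
  from integrable_imp_small_at_top[OF this e, of "- N"] obtain x where "x \<ge> - N" "\<bar>F (- x)\<bar> < e" by auto
  then show ?thesis by (intro exI[of _ "- x"]) auto
qed

context
  fixes F f :: "real \<Rightarrow> real"
  assumes F: "\<And>x. (F has_real_derivative f x) (at x)" "integrable lebesgue F"
    and f: "continuous_on UNIV f" "integrable lebesgue f"
begin

lemma set_integral_derivative:
  assumes "a \<le> b"
  shows "set_integrable lebesgue {a..b} f" "(LINT x:{a..b}|lebesgue. f x) = F b - F a"
proof -
  have c: "continuous_on {a..b} f" using f(1) by (rule continuous_on_subset) simp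
  have "(f has_integral F b - F a) {a..b}"
    using F(1) assms
    by (intro fundamental_theorem_of_calculus)
      (auto intro: has_field_derivative_at_within simp flip: has_real_derivative_iff_has_vector_derivative)
  then show "set_integrable lebesgue {a..b} f" "(LINT x:{a..b}|lebesgue. f x) = F b - F a"
    using set_lebesgue_integral_continuous[OF c] by (simp_all add: has_integral_iff)
qed

text \<open>Integrate from a remote point at which \<open>F\<close> is small.\<close>

lemma abs_le_integral_abs_derivative: "\<bar>F x\<bar> \<le> (LINT x|lebesgue. \<bar>f x\<bar>)"
proof (rule field_le_epsilon)
  fix e :: real assume "e > 0"
  then obtain a where a: "a \<le> x" "\<bar>F a\<bar> < e"
    using integrable_imp_small_at_bot[OF F(2)] by blast
  have "\<bar>LINT x:{a..x}|lebesgue. f x\<bar> \<le> (LINT y|lebesgue. \<bar>indicat_real {a..x} y * f y\<bar>)"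
    unfolding set_lebesgue_integral_def real_scaleR_def by (rule integral_abs_bound)
  also have "\<dots> \<le> (LINT x|lebesgue. \<bar>f x\<bar>)"
  proof (rule integral_mono)
    show "integrable lebesgue (\<lambda>y. \<bar>indicat_real {a..x} y * f y\<bar>)"
      using set_integral_derivative(1)[OF a(1)] by (simp add: set_integrable_def)
  qed (use f(2) in \<open>auto simp: indicator_def\<close>)
  finally show "\<bar>F x\<bar> \<le> (LINT x|lebesgue. \<bar>f x\<bar>) + e"
    using set_integral_derivative(2)[OF a(1)] a(2) by linarith
qed

lemma integral_derivative_eq_0: "(LINT x|lebesgue. f x) = 0"
proof -
  have "\<exists>a b. a \<le> - real n \<and> real n \<le> b \<and> \<bar>F a\<bar> < 1 / real (Suc n) \<and> \<bar>F b\<bar> < 1 / real (Suc n)" for n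
    using integrable_imp_small_at_bot[OF F(2), of "1 / real (Suc n)" "- real n"]
      integrable_imp_small_at_top[OF F(2), of "1 / real (Suc n)" "real n"] by auto
  then obtain a b where ab: "\<And>n. a n \<le> - real n" "\<And>n. real n \<le> b n"
    "\<And>n. \<bar>F (a n)\<bar> < 1 / real (Suc n)" "\<And>n. \<bar>F (b n)\<bar> < 1 / real (Suc n)" by metis
  have le: "a n \<le> b n" for n using ab(1,2)[of n] by linarith
  have to0: "X \<longlonglongrightarrow> 0" if "\<And>n. \<bar>X n\<bar> < 1 / real (Suc n)" for X :: "nat \<Rightarrow> real"
    by (rule Lim_null_comparison[OF always_eventually LIMSEQ_Suc[OF lim_1_over_n]])
      (use that in \<open>simp add: less_imp_le\<close>)
  have "(\<lambda>n. LINT x|lebesgue. indicat_real {a n..b n} x * f x) \<longlonglongrightarrow> (LINT x|lebesgue. f x)"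
  proof (rule integral_dominated_convergence[where w = "\<lambda>x. \<bar>f x\<bar>"])
    show "AE x in lebesgue. (\<lambda>n. indicat_real {a n..b n} x * f x) \<longlonglongrightarrow> f x"
    proof (intro AE_I2 tendsto_eventually)
      fix x :: real
      obtain n where n: "\<bar>x\<bar> \<le> real n" using real_arch_simple by blast
      show "\<forall>\<^sub>F n in sequentially. indicat_real {a n..b n} x * f x = f x"
        using eventually_ge_at_top[of n]
      proof eventually_elim
        case (elim k)
        then have "\<bar>x\<bar> \<le> real k" using n by linarith
        then have "x \<in> {a k..b k}" using ab(1,2)[of k] by auto
        then show ?case by simp
      qed
    qed
    show "(\<lambda>x. indicat_real {a n..b n} x * f x) \<in> borel_measurable lebesgue" for n
      using set_integral_derivative(1)[OF le] by (auto simp: set_integrable_def)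
  qed (use f(2) in \<open>auto simp: indicator_def intro!: AE_I2\<close>)
  moreover have "(LINT x|lebesgue. indicat_real {a n..b n} x * f x) = F (b n) - F (a n)" for n
    using set_integral_derivative(2)[OF le, of n] by (simp add: set_lebesgue_integral_def)
  moreover have "(\<lambda>n. F (b n) - F (a n)) \<longlonglongrightarrow> 0 - 0"
    by (intro tendsto_diff to0 ab)
  ultimately show ?thesis by (simp add: LIMSEQ_unique)
qed

end

lemma inner_L2_of:
  assumes "sq_integrable f" "sq_integrable g"
  shows "inner (L2_of f) (L2_of g) = (LINT x|lebesgue. f x * g x)"
  unfolding inner_L2_def
proof (rule integral_cong_AE)
  show "AE x in lebesgue. rep_L2 (L2_of f) x * rep_L2 (L2_of g) x = f x * g x"
    using rep_L2_of[OF assms(1)] rep_L2_of[OF assms(2)] by eventually_elim simp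
qed (use assms in \<open>auto intro!: borel_measurable_times sq_integrable_measurable\<close>)

lemma integral_abs_mult_le:
  assumes f: "sq_integrable f" and g: "sq_integrable g"
  shows "(LINT x|lebesgue. \<bar>f x * g x\<bar>) \<le> norm (L2_of f) * norm (L2_of g)"
proof -
  have abs: "sq_integrable (\<lambda>x. \<bar>h x\<bar>)" "norm (L2_of (\<lambda>x. \<bar>h x\<bar>)) = norm (L2_of h)" if "sq_integrable h" for h
  proof -
    show *: "sq_integrable (\<lambda>x. \<bar>h x\<bar>)"
      using that by (auto simp: sq_integrable_def intro: borel_measurable_abs)
    show "norm (L2_of (\<lambda>x. \<bar>h x\<bar>)) = norm (L2_of h)" by (simp add: norm_L2_of * that)
  qed
  have "(LINT x|lebesgue. \<bar>f x * g x\<bar>) = inner (L2_of (\<lambda>x. \<bar>f x\<bar>)) (L2_of (\<lambda>x. \<bar>g x\<bar>))"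
    by (simp add: inner_L2_of abs f g abs_mult)
  also have "\<dots> \<le> norm (L2_of (\<lambda>x. \<bar>f x\<bar>)) * norm (L2_of (\<lambda>x. \<bar>g x\<bar>))"
    by (rule norm_cauchy_schwarz)
  finally show ?thesis by (simp add: abs f g)
qed

text \<open>The one-dimensional Agmon inequality: \<open>abs_le_integral_abs_derivative\<close> applied to \<open>w\<^sup>2\<close>.\<close>

lemma C1_sup_bound:
  assumes w: "\<And>x. (w has_real_derivative d x) (at x)" "continuous_on UNIV d" and sq: "sq_integrable w" "sq_integrable d"
  shows "(w x)\<^sup>2 \<le> 2 * norm (L2_of w) * norm (L2_of d)"
proof -
  have cw: "continuous_on UNIV w"
    by (intro continuous_at_imp_continuous_on ballI DERIV_isCont[OF w(1)])
  have "\<bar>(w x)\<^sup>2\<bar> \<le> (LINT x|lebesgue. \<bar>2 * (w x * d x)\<bar>)"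
  proof (rule abs_le_integral_abs_derivative[where F = "\<lambda>x. (w x)\<^sup>2"])
    show "((\<lambda>x. (w x)\<^sup>2) has_real_derivative 2 * (w x * d x)) (at x)" for x
      by (auto intro!: derivative_eq_intros w(1))
    show "continuous_on UNIV (\<lambda>x. 2 * (w x * d x))" by (intro continuous_intros cw w(2))
  qed (use sq in \<open>auto intro: sq_integrable_power2 sq_integrable_prod\<close>)
  also have "\<dots> = 2 * (LINT x|lebesgue. \<bar>w x * d x\<bar>)" by (simp add: abs_mult)
  also have "\<dots> \<le> 2 * (norm (L2_of w) * norm (L2_of d))"
    by (intro mult_left_mono integral_abs_mult_le sq) simp
  finally show ?thesis by simp
qed

lemma H1_approx:
  assumes "has_weak_deriv 1 v g"
  obtains w d :: "nat \<Rightarrow> real \<Rightarrow> real"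
  where "\<And>n x. (w n has_real_derivative d n x) (at x)" "\<And>n. continuous_on UNIV (d n)"
    "\<And>n. sq_integrable (w n)" "\<And>n. sq_integrable (d n)"
    "(\<lambda>n. L2_of (w n)) \<longlonglongrightarrow> v" "(\<lambda>n. L2_of (d n)) \<longlonglongrightarrow> g"
proof -
  obtain \<eta> where \<eta>: "\<And>n. test_function (\<eta> n)"
    "\<And>f. sq_integrable f \<Longrightarrow> \<forall>n. sq_integrable (conv f (\<eta> n))"
    "\<And>f. sq_integrable f \<Longrightarrow> (\<lambda>n. L2_of (conv f (\<eta> n))) \<longlonglongrightarrow> L2_of f"
    by (rule mollifier_sequence) blast
  show thesis
  proof (rule that[of "\<lambda>n. conv (rep_L2 v) (\<eta> n)" "\<lambda>n. conv (rep_L2 g) (\<eta> n)"])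
    show "(conv (rep_L2 v) (\<eta> n) has_real_derivative conv (rep_L2 g) (\<eta> n) x) (at x)" for n x
      using conv_has_derivative[OF sq_integrable_rep \<eta>(1), of v n x] conv_weak_deriv[OF assms \<eta>(1), of n x] by simp
    show "continuous_on UNIV (conv (rep_L2 g) (\<eta> n))" for n
      by (rule conv_continuous[OF sq_integrable_rep \<eta>(1)])
  qed (use \<eta>(2,3)[OF sq_integrable_rep] in \<open>auto simp: L2_of_rep\<close>)
qed

text \<open>Both sides come from \<open>\<integral> (w z)' = 0\<close> for the mollifications \<open>w\<close>, \<open>z\<close> and are continuous in the four
  classes. The second factor is not a test function here, so this is more than the definition of a weak
  derivative.\<close>

lemma H1_parts:
  assumes "has_weak_deriv 1 v v'" "has_weak_deriv 1 u u'"
  shows "inner v' u = - inner v u'"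
proof -
  obtain w d where w: "\<And>n x. (w n has_real_derivative d n x) (at x)" "\<And>n. continuous_on UNIV (d n)"
    "\<And>n. sq_integrable (w n)" "\<And>n. sq_integrable (d n)"
    "(\<lambda>n. L2_of (w n)) \<longlonglongrightarrow> v" "(\<lambda>n. L2_of (d n)) \<longlonglongrightarrow> v'"
    by (rule H1_approx[OF assms(1)]) blast
  obtain z e where z: "\<And>n x. (z n has_real_derivative e n x) (at x)" "\<And>n. continuous_on UNIV (e n)"
    "\<And>n. sq_integrable (z n)" "\<And>n. sq_integrable (e n)"
    "(\<lambda>n. L2_of (z n)) \<longlonglongrightarrow> u" "(\<lambda>n. L2_of (e n)) \<longlonglongrightarrow> u'"
    by (rule H1_approx[OF assms(2)]) blast
  have cont: "continuous_on UNIV (w n)" "continuous_on UNIV (z n)" for n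
    by (intro continuous_at_imp_continuous_on ballI DERIV_isCont[OF w(1)] DERIV_isCont[OF z(1)])+
  have zero: "inner (L2_of (d n)) (L2_of (z n)) + inner (L2_of (w n)) (L2_of (e n)) = 0" for n
  proof -
    have "(LINT x|lebesgue. d n x * z n x + w n x * e n x) = 0"
    proof (rule integral_derivative_eq_0)
      show "((\<lambda>x. w n x * z n x) has_real_derivative d n x * z n x + w n x * e n x) (at x)" for x
        by (auto intro!: derivative_eq_intros w(1) z(1))
      show "continuous_on UNIV (\<lambda>x. d n x * z n x + w n x * e n x)"
        by (intro continuous_intros cont w(2) z(2))
    qed (use w(3,4) z(3,4) in \<open>auto intro!: Bochner_Integration.integrable_add sq_integrable_prod\<close>)
    then show ?thesis by (simp add: inner_L2_of w(3,4) z(3,4) sq_integrable_prod)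
  qed
  have "(\<lambda>n. inner (L2_of (d n)) (L2_of (z n)) + inner (L2_of (w n)) (L2_of (e n))) \<longlonglongrightarrow> inner v' u + inner v u'"
    by (intro tendsto_intros w(5,6) z(5,6))
  then have "inner v' u + inner v u' = 0"
    unfolding zero by (simp add: LIMSEQ_const_iff)
  then show ?thesis by simp
qed

text \<open>The bound for the mollifications passes to a subsequence that converges almost everywhere.\<close>

lemma H1_sup_bound:
  assumes "has_weak_deriv 1 v g"
  shows "AE x in lebesgue. (rep_L2 v x)\<^sup>2 \<le> 2 * norm v * norm g"
proof -
  obtain w d where w: "\<And>n x. (w n has_real_derivative d n x) (at x)" "\<And>n. continuous_on UNIV (d n)"
    "\<And>n. sq_integrable (w n)" "\<And>n. sq_integrable (d n)"
    "(\<lambda>n. L2_of (w n)) \<longlonglongrightarrow> v" "(\<lambda>n. L2_of (d n)) \<longlonglongrightarrow> g"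
    by (rule H1_approx[OF assms]) blast
  have sqd: "sq_integrable (\<lambda>x. w n x - rep_L2 v x)" for n by (intro sq_integrable_diff w(3)) simp
  have "(\<lambda>n. (norm (L2_of (w n) - v))\<^sup>2) \<longlonglongrightarrow> 0\<^sup>2"
    by (intro tendsto_power tendsto_norm_zero LIM_zero w(5))
  moreover have "(norm (L2_of (w n) - v))\<^sup>2 = (LINT x|lebesgue. norm ((w n x - rep_L2 v x)\<^sup>2))" for n
    using norm_L2_of_diff_power2[OF w(3) sq_integrable_rep, of n v] by (simp add: L2_of_rep)
  ultimately have "(\<lambda>n. LINT x|lebesgue. norm ((w n x - rep_L2 v x)\<^sup>2)) \<longlonglongrightarrow> 0" by simp
  from tendsto_L1_AE_subseq[OF sq_integrable_power2[OF sqd] this]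
  obtain r where r: "strict_mono r" "AE x in lebesgue. (\<lambda>n. (w (r n) x - rep_L2 v x)\<^sup>2) \<longlonglongrightarrow> 0" by blast
  show ?thesis
    using r(2)
  proof eventually_elim
    case (elim x)
    then have "(\<lambda>n. sqrt ((w (r n) x - rep_L2 v x)\<^sup>2)) \<longlonglongrightarrow> sqrt 0" by (rule tendsto_real_sqrt)
    then have "(\<lambda>n. w (r n) x - rep_L2 v x) \<longlonglongrightarrow> 0" by (simp add: tendsto_rabs_zero_iff)
    then have "(\<lambda>n. w (r n) x) \<longlonglongrightarrow> rep_L2 v x" by (rule LIM_zero_cancel)
    then have 1: "(\<lambda>n. (w (r n) x)\<^sup>2) \<longlonglongrightarrow> (rep_L2 v x)\<^sup>2" by (rule tendsto_power)
    have "(\<lambda>n. 2 * norm (L2_of (w n)) * norm (L2_of (d n))) \<longlonglongrightarrow> 2 * norm v * norm g"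
      by (intro tendsto_intros w(5,6))
    from LIMSEQ_subseq_LIMSEQ[OF this r(1)]
    have 2: "(\<lambda>n. 2 * norm (L2_of (w (r n))) * norm (L2_of (d (r n)))) \<longlonglongrightarrow> 2 * norm v * norm g"
      by (simp add: o_def)
    show ?case
      by (rule LIMSEQ_le[OF 1 2]) (use C1_sup_bound[OF w(1-4)] in blast)
  qed
qed

text \<open>For a smooth decaying function \<open>3 w\<^sup>2 w' = (w\<^sup>3)'\<close> has integral \<open>0\<close>. The difference between the cubic
  integrals of \<open>v\<close> and of its mollification \<open>w n\<close> is controlled by sup bounds times \<open>L\<^sup>2\<close> distances, and the
  sup bounds \<open>c n\<close> converge to that of \<open>v\<close>.\<close>

lemma H1_cubic_zero:
  assumes "has_weak_deriv 1 v g"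
  shows "(LINT x|lebesgue. rep_L2 v x * (rep_L2 v x * rep_L2 g x)) = 0"
proof -
  obtain w d where w: "\<And>n x. (w n has_real_derivative d n x) (at x)" "\<And>n. continuous_on UNIV (d n)"
    "\<And>n. sq_integrable (w n)" "\<And>n. sq_integrable (d n)"
    "(\<lambda>n. L2_of (w n)) \<longlonglongrightarrow> v" "(\<lambda>n. L2_of (d n)) \<longlonglongrightarrow> g"
    by (rule H1_approx[OF assms]) blast
  define c where "c n = sqrt (2 * norm (L2_of (w n)) * norm (L2_of (d n)))" for n
  define C where "C = sqrt (2 * norm v * norm g)"
  have c0: "c n \<ge> 0" "C \<ge> 0" for n by (simp_all add: c_def C_def)
  have wc: "\<bar>w n x\<bar> \<le> c n" for n x
    unfolding c_def by (rule real_le_rsqrt) (use C1_sup_bound[OF w(1-4)] in simp)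
  have vC: "AE x in lebesgue. \<bar>rep_L2 v x\<bar> \<le> C"
    using H1_sup_bound[OF assms] unfolding C_def by eventually_elim (rule real_le_rsqrt, simp)
  have [measurable]: "w n \<in> borel_measurable lebesgue" "d n \<in> borel_measurable lebesgue" for n
    using w(3,4) by (auto intro: sq_integrable_measurable)
  have bd: "integrable lebesgue (\<lambda>x. a x * b x)"
    if "integrable lebesgue b" "a \<in> borel_measurable lebesgue" "AE x in lebesgue. \<bar>a x\<bar> \<le> k" for a b :: "real \<Rightarrow> real" and k
  proof (rule Bochner_Integration.integrable_bound)
    show "integrable lebesgue (\<lambda>x. k * b x)" using that by simp
    show "(\<lambda>x. a x * b x) \<in> borel_measurable lebesgue" using that by measurable
    show "AE x in lebesgue. norm (a x * b x) \<le> norm (k * b x)"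
      using that(3) by eventually_elim (auto simp: abs_mult intro!: mult_right_mono)
  qed
  have cont: "continuous_on UNIV (w n)" for n
    by (intro continuous_at_imp_continuous_on ballI DERIV_isCont[OF w(1)])
  have int_wwd: "integrable lebesgue (\<lambda>x. w n x * (w n x * d n x))" for n
    by (rule bd[where k = "c n"]) (auto intro: sq_integrable_prod w wc AE_I2)
  have int_vvg: "integrable lebesgue (\<lambda>x. rep_L2 v x * (rep_L2 v x * rep_L2 g x))"
    by (rule bd[OF _ _ vC]) (auto intro: sq_integrable_prod)
  have zero: "(LINT x|lebesgue. w n x * (w n x * d n x)) = 0" for n
  proof -
    have "(LINT x|lebesgue. 3 * (w n x * (w n x * d n x))) = 0"
    proof (rule integral_derivative_eq_0)
      show "((\<lambda>x. w n x * (w n x * w n x)) has_real_derivative 3 * (w n x * (w n x * d n x))) (at x)" for x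
        by (auto intro!: derivative_eq_intros w(1) simp: algebra_simps)
      show "integrable lebesgue (\<lambda>x. w n x * (w n x * w n x))"
        by (rule bd[where k = "c n"]) (auto intro: sq_integrable_prod w wc AE_I2)
      show "continuous_on UNIV (\<lambda>x. 3 * (w n x * (w n x * d n x)))"
        by (intro continuous_intros cont w(2))
    qed (use int_wwd in simp)
    then show ?thesis by simp
  qed
  have sq1: "sq_integrable (\<lambda>x. rep_L2 v x - w n x)" and sq2: "sq_integrable (\<lambda>x. rep_L2 g x - d n x)" for n
    by (auto intro: sq_integrable_diff w)
  have bound: "\<bar>LINT x|lebesgue. rep_L2 v x * (rep_L2 v x * rep_L2 g x)\<bar>
      \<le> (C + c n) * (norm (v - L2_of (w n)) * norm g) + c n * (norm (L2_of (w n)) * norm (g - L2_of (d n)))" for n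
  proof -
    let ?A = "\<lambda>x. \<bar>(rep_L2 v x - w n x) * rep_L2 g x\<bar>" and ?B = "\<lambda>x. \<bar>w n x * (rep_L2 g x - d n x)\<bar>"
    have iA: "integrable lebesgue ?A" and iB: "integrable lebesgue ?B"
      by (auto intro!: integrable_abs sq_integrable_prod sq1 sq2 w)
    have "\<bar>LINT x|lebesgue. rep_L2 v x * (rep_L2 v x * rep_L2 g x)\<bar> =
        \<bar>LINT x|lebesgue. rep_L2 v x * (rep_L2 v x * rep_L2 g x) - w n x * (w n x * d n x)\<bar>"
      using int_vvg int_wwd[of n] zero[of n] by simp
    also have "\<dots> \<le> (LINT x|lebesgue. \<bar>rep_L2 v x * (rep_L2 v x * rep_L2 g x) - w n x * (w n x * d n x)\<bar>)"
      by simp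
    also have "\<dots> \<le> (LINT x|lebesgue. (C + c n) * ?A x + c n * ?B x)"
    proof (rule integral_mono_AE)
      show "AE x in lebesgue. \<bar>rep_L2 v x * (rep_L2 v x * rep_L2 g x) - w n x * (w n x * d n x)\<bar>
          \<le> (C + c n) * ?A x + c n * ?B x"
        using vC
      proof eventually_elim
        case (elim x)
        have "\<bar>rep_L2 v x * (rep_L2 v x * rep_L2 g x) - w n x * (w n x * d n x)\<bar> =
            \<bar>(rep_L2 v x + w n x) * ((rep_L2 v x - w n x) * rep_L2 g x) + w n x * (w n x * (rep_L2 g x - d n x))\<bar>"
          by (simp add: algebra_simps)
        also have "\<dots> \<le> \<bar>rep_L2 v x + w n x\<bar> * ?A x + \<bar>w n x\<bar> * ?B x"
          by (rule order_trans[OF abs_triangle_ineq]) (simp add: abs_mult)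
        also have "\<dots> \<le> (C + c n) * ?A x + c n * ?B x"
          using elim wc[of n x] by (intro add_mono mult_right_mono) auto
        finally show ?case .
      qed
    qed (use int_vvg int_wwd iA iB in auto)
    also have "\<dots> = (C + c n) * (LINT x|lebesgue. ?A x) + c n * (LINT x|lebesgue. ?B x)"
      using iA iB by simp
    also have "\<dots> \<le> (C + c n) * (norm (v - L2_of (w n)) * norm g) + c n * (norm (L2_of (w n)) * norm (g - L2_of (d n)))"
    proof (intro add_mono mult_left_mono)
      show "(LINT x|lebesgue. ?A x) \<le> norm (v - L2_of (w n)) * norm g"
        using integral_abs_mult_le[OF sq1 sq_integrable_rep, of n g]
        by (simp add: L2_of_diff w(3) L2_of_rep)
      show "(LINT x|lebesgue. ?B x) \<le> norm (L2_of (w n)) * norm (g - L2_of (d n))"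
        using integral_abs_mult_le[OF w(3) sq2, of n n]
        by (simp add: L2_of_diff w(4) L2_of_rep)
    qed (use c0 in auto)
    finally show ?thesis .
  qed
  have "(\<lambda>n. (C + c n) * (norm (v - L2_of (w n)) * norm g) + c n * (norm (L2_of (w n)) * norm (g - L2_of (d n))))
      \<longlonglongrightarrow> (C + C) * (norm (v - v) * norm g) + C * (norm v * norm (g - g))"
    unfolding c_def C_def by (intro tendsto_intros w(5,6))
  then have "\<bar>LINT x|lebesgue. rep_L2 v x * (rep_L2 v x * rep_L2 g x)\<bar> \<le> (C + C) * (norm (v - v) * norm g) + C * (norm v * norm (g - g))"
    by (rule LIMSEQ_le_const) (use bound in blast)
  then show ?thesis by simp
qed


section \<open>The form bound for unbounded potentials\<close>

text \<open>The tangent inequality at \<open>1\<close> for the convex function \<open>y \<mapsto> y\<^sup>p\<close>, applied to \<open>y = x/\<theta>\<close>. It plays the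
  role of Hoelder's inequality in the form bound below and also covers the case \<open>p = 1\<close>.\<close>

lemma mult_le_weighted_powr:
  fixes x \<theta> p :: real
  assumes p: "p \<ge> 1" and \<theta>: "\<theta> > 0" and x: "x \<ge> 0"
  shows "x \<le> x powr p / (p * \<theta> powr (p - 1)) + (1 - 1 / p) * \<theta>"
proof (cases "x = 0")
  case True
  then show ?thesis using p \<theta> by (simp add: field_simps)
next
  case False
  define y where "y = x / \<theta>"
  have y: "y > 0" using False x \<theta> by (simp add: y_def)
  have "p * (1 powr (p - 1)) * (y - 1) \<le> y powr p - 1 powr p"
  proof (rule convex_on_imp_above_tangent[where A = "{0<..}" and f = "\<lambda>z. z powr p"])
    show "((\<lambda>z. z powr p) has_real_derivative p * 1 powr (p - 1)) (at 1 within {0<..})"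
      by (rule has_field_derivative_at_within) (auto intro!: derivative_eq_intros)
  qed (use p y powr_convex[OF p] in \<open>auto simp: interior_open\<close>)
  then have py: "p * y \<le> y powr p + (p - 1)" by (simp add: algebra_simps)
  have "p * x = p * y * \<theta>" using \<theta> by (simp add: y_def)
  also have "\<dots> \<le> (y powr p + (p - 1)) * \<theta>"
    using \<theta> py by (intro mult_right_mono) auto
  also have "\<dots> = y powr p * \<theta> + (p - 1) * \<theta>" by (rule distrib_right)
  also have "y powr p * \<theta> = x powr p / \<theta> powr (p - 1)"
    using \<theta> x by (simp add: y_def powr_divide powr_diff)
  finally have "p * x \<le> x powr p / \<theta> powr (p - 1) + (p - 1) * \<theta>" .
  then have "x \<le> (x powr p / \<theta> powr (p - 1) + (p - 1) * \<theta>) / p"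
    using p by (simp add: field_simps)
  also have "\<dots> = x powr p / (p * \<theta> powr (p - 1)) + (1 - 1 / p) * \<theta>"
    using p by (simp add: field_simps)
  finally show ?thesis .
qed

lemma in_Lp_add:
  assumes p: "1 \<le> p" and "in_Lp p f" "in_Lp p g"
  shows "in_Lp p (\<lambda>x. f x + g x)"
proof -
  have [measurable]: "f \<in> borel_measurable lebesgue" "g \<in> borel_measurable lebesgue"
    using assms by (auto simp: in_Lp_def)
  have key: "\<bar>a + b\<bar> powr p \<le> 2 powr p * (\<bar>a\<bar> powr p + \<bar>b\<bar> powr p)" for a b :: real
  proof -
    have "\<bar>a + b\<bar> powr p \<le> (2 * max \<bar>a\<bar> \<bar>b\<bar>) powr p" using p by (intro powr_mono2) auto
    also have "\<dots> = 2 powr p * max \<bar>a\<bar> \<bar>b\<bar> powr p" by (simp add: powr_mult)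
    also have "\<dots> \<le> 2 powr p * (\<bar>a\<bar> powr p + \<bar>b\<bar> powr p)"
      by (intro mult_left_mono) (auto simp: max_def)
    finally show ?thesis .
  qed
  have "integrable lebesgue (\<lambda>x. \<bar>f x + g x\<bar> powr p)"
  proof (rule Bochner_Integration.integrable_bound)
    show "integrable lebesgue (\<lambda>x. 2 powr p * (\<bar>f x\<bar> powr p + \<bar>g x\<bar> powr p))"
      using assms by (simp add: in_Lp_def)
    show "AE x in lebesgue. norm (\<bar>f x + g x\<bar> powr p) \<le> norm (2 powr p * (\<bar>f x\<bar> powr p + \<bar>g x\<bar> powr p))"
      proof (rule AE_I2)
      fix x
      show "norm (\<bar>f x + g x\<bar> powr p) \<le> norm (2 powr p * (\<bar>f x\<bar> powr p + \<bar>g x\<bar> powr p))"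
        using order_trans[OF key[of "f x" "g x"] abs_ge_self] by simp
    qed
  qed measurable
  then show ?thesis by (simp add: in_Lp_def)
qed

text \<open>The constant that remains in front of \<open>|v|\<^sup>2\<close> after the Gagliardo-Nirenberg and Young inequalities; \<open>N\<close>
  stands for the \<open>L\<^sup>p\<close> norm of the potential.\<close>

definition GN_const :: "real \<Rightarrow> real \<Rightarrow> real" where
  "GN_const p N = (2 * p - 1) / (2 * p) * (2 / p) powr (1 / (2 * p - 1)) * N powr (2 * p / (2 * p - 1))"

text \<open>Split \<open>|b| \<le> |b|\<^sup>p / (p \<theta>\<^sup>p\<^sup>-\<^sup>1) + (1 - 1/p) \<theta>\<close>: the first part is integrable and is paired with
  \<open>v\<^sup>2 \<le> 2 |v| |g|\<close>, the second is a constant and is paired with \<open>|v|\<^sup>2\<close>. Absorbing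
  \<open>2 |v| |g| \<kappa> \<le> |g|\<^sup>2 + \<kappa>\<^sup>2 |v|\<^sup>2\<close> leaves the factor \<open>\<kappa>\<^sup>2 + (1 - 1/p) \<theta>\<close>, and the choice of \<open>\<theta>\<close> below minimises
  it; the minimum is \<open>GN_const\<close>. Here \<open>|v|\<close> and \<open>|g|\<close> are \<open>L\<^sup>2\<close> norms.\<close>

lemma potential_form_bound:
  assumes p: "1 \<le> p" and b: "in_Lp p b" and v: "has_weak_deriv 1 v g"
  shows "integrable lebesgue (\<lambda>x. \<bar>b x\<bar> * (rep_L2 v x)\<^sup>2)"
    and "(LINT x|lebesgue. \<bar>b x\<bar> * (rep_L2 v x)\<^sup>2) \<le> (norm g)\<^sup>2 + GN_const p (Lp_norm p b) * (norm v)\<^sup>2"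
proof -
  have [measurable]: "b \<in> borel_measurable lebesgue" using b by (simp add: in_Lp_def)
  have bint: "integrable lebesgue (\<lambda>x. \<bar>b x\<bar> powr p)" using b by (simp add: in_Lp_def)
  have vint: "integrable lebesgue (\<lambda>x. (rep_L2 v x)\<^sup>2)" by (simp add: sq_integrable_power2)
  define M where "M = 2 * norm v * norm g"
  have M: "M \<ge> 0" by (simp add: M_def)
  have pw: "AE x in lebesgue. \<bar>b x\<bar> * (rep_L2 v x)\<^sup>2 \<le>
      M / (p * \<theta> powr (p - 1)) * \<bar>b x\<bar> powr p + (1 - 1 / p) * \<theta> * (rep_L2 v x)\<^sup>2" if "\<theta> > 0" for \<theta>
    using H1_sup_bound[OF v]
  proof eventually_elim
    case (elim x)
    have "\<bar>b x\<bar> * (rep_L2 v x)\<^sup>2 \<le> (\<bar>b x\<bar> powr p / (p * \<theta> powr (p - 1)) + (1 - 1 / p) * \<theta>) * (rep_L2 v x)\<^sup>2"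
      by (intro mult_right_mono mult_le_weighted_powr[OF p that]) auto
    also have "\<dots> = \<bar>b x\<bar> powr p / (p * \<theta> powr (p - 1)) * (rep_L2 v x)\<^sup>2 + (1 - 1 / p) * \<theta> * (rep_L2 v x)\<^sup>2"
      by (simp add: algebra_simps)
    also have "\<bar>b x\<bar> powr p / (p * \<theta> powr (p - 1)) * (rep_L2 v x)\<^sup>2 \<le> \<bar>b x\<bar> powr p / (p * \<theta> powr (p - 1)) * M"
      using elim p by (intro mult_left_mono) (auto simp: M_def)
    finally show ?case by (simp add: algebra_simps)
  qed
  have dom: "integrable lebesgue (\<lambda>x. M / (p * \<theta> powr (p - 1)) * \<bar>b x\<bar> powr p + (1 - 1 / p) * \<theta> * (rep_L2 v x)\<^sup>2)" for \<theta>
    using bint vint by (intro Bochner_Integration.integrable_add integrable_mult_right) auto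
  show int: "integrable lebesgue (\<lambda>x. \<bar>b x\<bar> * (rep_L2 v x)\<^sup>2)"
    by (rule Bochner_Integration.integrable_bound[OF dom[of 1]])
      (measurable, use pw[OF zero_less_one] in eventually_elim, simp)
  define B where "B = (LINT x|lebesgue. \<bar>b x\<bar> powr p)"
  have B: "B \<ge> 0" by (simp add: B_def)
  have K: "GN_const p (Lp_norm p b) \<ge> 0" using p by (simp add: GN_const_def)
  show "(LINT x|lebesgue. \<bar>b x\<bar> * (rep_L2 v x)\<^sup>2) \<le> (norm g)\<^sup>2 + GN_const p (Lp_norm p b) * (norm v)\<^sup>2"
  proof (cases "B = 0")
    case True
    then have "AE x in lebesgue. \<bar>b x\<bar> powr p = 0"
      using integral_nonneg_eq_0_iff_AE[OF bint] by (simp add: B_def)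
    then have "AE x in lebesgue. \<bar>b x\<bar> * (rep_L2 v x)\<^sup>2 = 0" by eventually_elim simp
    then have "(LINT x|lebesgue. \<bar>b x\<bar> * (rep_L2 v x)\<^sup>2) = 0" by (rule integral_eq_zero_AE)
    then show ?thesis using K by simp
  next
    case False
    then have B: "B > 0" using B by simp
    define \<theta> where "\<theta> = (2 / p) powr (1 / (2 * p - 1)) * B powr (2 / (2 * p - 1))"
    have \<theta>: "\<theta> > 0" using p B by (simp add: \<theta>_def)
    define \<kappa> where "\<kappa> = B / (p * \<theta> powr (p - 1))"
    have "\<theta> powr (2 * p - 1) = 2 / p * B\<^sup>2"
    proof -
      have e: "2 / (2 * p - 1) * (2 * p - 1) = 2" "1 / (2 * p - 1) * (2 * p - 1) = 1" using p by (auto simp: field_simps)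
      have "\<theta> powr (2 * p - 1) = (2 / p) powr (1 / (2 * p - 1) * (2 * p - 1)) * B powr (2 / (2 * p - 1) * (2 * p - 1))"
        using p B by (simp only: \<theta>_def powr_mult powr_powr)
      then show ?thesis unfolding e using p B by simp
    qed
    then have B2: "B\<^sup>2 = p / 2 * \<theta> powr (2 * p - 1)" using p by (simp add: field_simps)
    have "(\<theta> powr (p - 1))\<^sup>2 * \<theta> = \<theta> powr (2 * p - 1)"
    proof -
      have "(\<theta> powr (p - 1))\<^sup>2 * \<theta> = \<theta> powr (p - 1) * \<theta> powr (p - 1) * \<theta> powr 1"
        using \<theta> by (simp add: power2_eq_square)
      also have "\<dots> = \<theta> powr (p - 1 + (p - 1) + 1)" by (simp only: powr_add)
      also have "p - 1 + (p - 1) + 1 = 2 * p - 1" by simp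
      finally show ?thesis .
    qed
    then have \<kappa>2: "\<kappa>\<^sup>2 = \<theta> / (2 * p)"
      using p \<theta> B2 by (simp add: \<kappa>_def power_divide power_mult_distrib field_simps power2_eq_square)
    have K_eq: "GN_const p (Lp_norm p b) = (1 - 1 / p) * \<theta> + \<kappa>\<^sup>2"
    proof -
      have "Lp_norm p b powr (2 * p / (2 * p - 1)) = B powr (2 / (2 * p - 1))"
        using p by (simp add: Lp_norm_def B_def powr_powr)
      then have "GN_const p (Lp_norm p b) = (2 * p - 1) / (2 * p) * \<theta>"
        by (simp add: GN_const_def \<theta>_def)
      also have "\<dots> = (1 - 1 / p) * \<theta> + \<theta> / (2 * p)" using p by (simp add: field_simps)
      finally show ?thesis by (simp add: \<kappa>2)
    qed
    have "(LINT x|lebesgue. \<bar>b x\<bar> * (rep_L2 v x)\<^sup>2) \<le>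
        (LINT x|lebesgue. M / (p * \<theta> powr (p - 1)) * \<bar>b x\<bar> powr p + (1 - 1 / p) * \<theta> * (rep_L2 v x)\<^sup>2)"
      by (rule integral_mono_AE[OF int dom pw[OF \<theta>]])
    also have "\<dots> = M * \<kappa> + (1 - 1 / p) * \<theta> * (norm v)\<^sup>2"
      using bint vint by (simp add: \<kappa>_def B_def norm_L2_power2)
    also have "M * \<kappa> \<le> (norm g)\<^sup>2 + \<kappa>\<^sup>2 * (norm v)\<^sup>2"
      using sum_squares_bound[of "norm g" "\<kappa> * norm v"]
      by (simp add: M_def power_mult_distrib algebra_simps)
    finally show ?thesis unfolding K_eq by (simp add: algebra_simps)
  qed
qed

text \<open>The smallness condition on the norm of the potential is positivity of the decay rate, solved for \<open>N\<close>.\<close>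

lemma GN_const_less:
  assumes p: "1 \<le> p" and a: "a > 0" and N: "N \<ge> 0" "N < (a / c_const p) powr (1 - 1 / (2 * p))"
  shows "GN_const p N < a"
proof -
  have c: "c_const p > 0" using p by (simp add: c_const_def field_simps)
  have "N powr (2 * p / (2 * p - 1)) < ((a / c_const p) powr (1 - 1 / (2 * p))) powr (2 * p / (2 * p - 1))"
    using N p by (intro powr_less_mono2) auto
  also have "\<dots> = a / c_const p"
  proof -
    have "(1 - 1 / (2 * p)) * (2 * p / (2 * p - 1)) = 1" using p by (simp add: field_simps)
    then show ?thesis using a c by (simp only: powr_powr) simp
  qed
  finally have "c_const p * N powr (2 * p / (2 * p - 1)) < a"
    using c by (simp add: field_simps)
  moreover have "GN_const p N = c_const p * N powr (2 * p / (2 * p - 1))"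
    using p by (simp add: GN_const_def c_const_def field_simps)
  ultimately show ?thesis by simp
qed


section \<open>Dissipativity of the operator and the nonlinear term\<close>

lemma in_Linf_bound:
  assumes "in_Linf a"
  obtains C where "C \<ge> 0" "AE x in lebesgue. \<bar>a x\<bar> \<le> C"
proof -
  obtain C where "AE x in lebesgue. \<bar>a x\<bar> \<le> C" using assms by (auto simp: in_Linf_def)
  then have "AE x in lebesgue. \<bar>a x\<bar> \<le> \<bar>C\<bar>" by eventually_elim linarith
  then show thesis by (intro that[of "\<bar>C\<bar>"]) auto
qed

lemma sq_integrable_mult_bounded:
  assumes a: "a \<in> borel_measurable lebesgue" "AE x in lebesgue. \<bar>a x\<bar> \<le> C" and C: "C \<ge> 0" and f: "sq_integrable f"
  shows "sq_integrable (\<lambda>x. a x * f x)" "norm (L2_of (\<lambda>x. a x * f x)) \<le> C * norm (L2_of f)"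
proof -
  have [measurable]: "a \<in> borel_measurable lebesgue" "f \<in> borel_measurable lebesgue"
    using a f by (auto intro: sq_integrable_measurable)
  have le: "AE x in lebesgue. (a x * f x)\<^sup>2 \<le> C\<^sup>2 * (f x)\<^sup>2"
    using a(2)
  proof eventually_elim
    case (elim x)
    then have "(a x)\<^sup>2 \<le> C\<^sup>2" by (simp add: abs_le_square_iff[symmetric])
    then show ?case by (simp add: power_mult_distrib mult_right_mono)
  qed
  have fi: "integrable lebesgue (\<lambda>x. C\<^sup>2 * (f x)\<^sup>2)" using f by (simp add: sq_integrable_power2)
  have "integrable lebesgue (\<lambda>x. (a x * f x)\<^sup>2)"
    by (rule Bochner_Integration.integrable_bound[OF fi]) (measurable, use le in eventually_elim, simp)
  then show sq: "sq_integrable (\<lambda>x. a x * f x)" by (simp add: sq_integrable_def)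
  have "(LINT x|lebesgue. (a x * f x)\<^sup>2) \<le> (LINT x|lebesgue. C\<^sup>2 * (f x)\<^sup>2)"
    using sq by (intro integral_mono_AE le fi) (simp add: sq_integrable_power2)
  then have "sqrt (LINT x|lebesgue. (a x * f x)\<^sup>2) \<le> sqrt (C\<^sup>2 * (LINT x|lebesgue. (f x)\<^sup>2))" by simp
  then show "norm (L2_of (\<lambda>x. a x * f x)) \<le> C * norm (L2_of f)"
    using C by (simp add: norm_L2_of sq f real_sqrt_mult)
qed

context
  fixes a :: "real \<Rightarrow> real"
  assumes a: "in_Linf a"
begin

lemma sq_integrable_mult_Linf:
  assumes f: "sq_integrable f"
  shows "sq_integrable (\<lambda>x. a x * f x)"
proof -
  obtain C where C: "C \<ge> 0" "AE x in lebesgue. \<bar>a x\<bar> \<le> C" by (rule in_Linf_bound[OF a])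
  show ?thesis
    by (rule sq_integrable_mult_bounded(1)[OF _ C(2,1) f]) (use a in \<open>simp add: in_Linf_def\<close>)
qed

lemma bounded_linear_mult_L2: "bounded_linear (mult_L2 a)"
proof -
  obtain C where C: "C \<ge> 0" "AE x in lebesgue. \<bar>a x\<bar> \<le> C" by (rule in_Linf_bound[OF a])
  note sq = sq_integrable_mult_Linf[OF sq_integrable_rep]
  show ?thesis
  proof (rule bounded_linear_intro[where K = C])
    fix f g :: L2 and r :: real
    show "mult_L2 a (f + g) = mult_L2 a f + mult_L2 a g"
      unfolding mult_L2_def
      by (rule L2_eqI)
        (use rep_L2_of[OF sq[of f]] rep_L2_of[OF sq[of g]] rep_L2_of[OF sq[of "f + g"]] rep_L2_plus[of f g]
          rep_L2_plus[of "L2_of (\<lambda>x. a x * rep_L2 f x)" "L2_of (\<lambda>x. a x * rep_L2 g x)"]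
          in eventually_elim, simp add: algebra_simps)
    show "mult_L2 a (r *\<^sub>R f) = r *\<^sub>R mult_L2 a f"
      unfolding mult_L2_def
      by (rule L2_eqI)
        (use rep_L2_of[OF sq[of f]] rep_L2_of[OF sq[of "r *\<^sub>R f"]] rep_L2_scaleR[of r f]
          rep_L2_scaleR[of r "L2_of (\<lambda>x. a x * rep_L2 f x)"]
          in eventually_elim, simp add: algebra_simps)
    show "norm (mult_L2 a f) \<le> norm f * C"
      using sq_integrable_mult_bounded(2)[OF _ C(2,1) sq_integrable_rep, of f] a
      by (simp add: mult_L2_def in_Linf_def L2_of_rep mult.commute)
  qed
qed

lemma inner_mult_L2:
  "inner (mult_L2 a f) g = (LINT x|lebesgue. a x * rep_L2 f x * rep_L2 g x)"
  using inner_L2_of[OF sq_integrable_mult_Linf[OF sq_integrable_rep] sq_integrable_rep, of f g]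
  by (simp add: mult_L2_def L2_of_rep)

lemma integrable_mult_Linf:
  "integrable lebesgue (\<lambda>x. a x * rep_L2 f x * rep_L2 g x)"
  by (rule sq_integrable_prod[OF sq_integrable_mult_Linf[OF sq_integrable_rep] sq_integrable_rep])

end

definition weighted_sq :: "(real \<Rightarrow> real) \<Rightarrow> L2 \<Rightarrow> real" where
  "weighted_sq a v = (LINT x|lebesgue. \<bar>a x\<bar> * (rep_L2 v x)\<^sup>2)"

lemma in_Linf_abs: "in_Linf a \<Longrightarrow> in_Linf (\<lambda>x. \<bar>a x\<bar>)"
  by (auto simp: in_Linf_def intro: borel_measurable_abs)

lemma weighted_sq_nonneg: "weighted_sq a v \<ge> 0"
  by (simp add: weighted_sq_def)

lemma weighted_sq_eq_inner:
  assumes "in_Linf a"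
  shows "weighted_sq a v = inner (mult_L2 (\<lambda>x. \<bar>a x\<bar>) v) v"
  by (simp add: weighted_sq_def inner_mult_L2[OF in_Linf_abs[OF assms]] power2_eq_square mult.assoc)

lemma integrable_weighted_sq:
  assumes "in_Linf a"
  shows "integrable lebesgue (\<lambda>x. \<bar>a x\<bar> * (rep_L2 v x)\<^sup>2)"
  using integrable_mult_Linf[OF in_Linf_abs[OF assms], of v v] by (simp add: power2_eq_square mult.assoc)

lemma weighted_sq_continuous:
  assumes "in_Linf a"
  shows "continuous_on A (weighted_sq a)"
  unfolding weighted_sq_eq_inner[OF assms, abs_def]
  by (intro continuous_on_inner linear_continuous_on bounded_linear_mult_L2 in_Linf_abs assms continuous_on_id)

lemma weighted_sq_le:
  assumes "in_Linf a"
  obtains C where "\<And>v. \<bar>weighted_sq a v\<bar> \<le> C * (norm v)\<^sup>2"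
proof -
  obtain C where C: "\<And>v. norm (mult_L2 (\<lambda>x. \<bar>a x\<bar>) v) \<le> norm v * C"
    using bounded_linear.bounded[OF bounded_linear_mult_L2[OF in_Linf_abs[OF assms]]] by blast
  have "\<bar>weighted_sq a v\<bar> \<le> C * (norm v)\<^sup>2" for v
  proof -
    have "\<bar>weighted_sq a v\<bar> \<le> norm (mult_L2 (\<lambda>x. \<bar>a x\<bar>) v) * norm v"
      unfolding weighted_sq_eq_inner[OF assms] by (rule Cauchy_Schwarz_ineq2)
    also have "\<dots> \<le> norm v * C * norm v" by (intro mult_right_mono C) simp
    finally show ?thesis by (simp add: power2_eq_square mult_ac)
  qed
  then show thesis by (rule that)
qed

text \<open>Pointwise Young inequality with weight \<open>c\<close>; the choice \<open>c = exp \<tau>\<close> matches the weight with which the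
  delayed term leaves the energy.\<close>

lemma weighted_young:
  assumes a: "in_Linf a" and c: "c > 0"
  shows "- 2 * inner v (mult_L2 a w) \<le> c * weighted_sq a v + inverse c * weighted_sq a w"
proof -
  have "- 2 * inner v (mult_L2 a w) = (LINT x|lebesgue. - 2 * (a x * rep_L2 w x * rep_L2 v x))"
    by (simp add: inner_commute[of v] inner_mult_L2[OF a])
  also have "\<dots> \<le> (LINT x|lebesgue. c * (\<bar>a x\<bar> * (rep_L2 v x)\<^sup>2) + inverse c * (\<bar>a x\<bar> * (rep_L2 w x)\<^sup>2))"
  proof (rule integral_mono)
    fix x
    have "2 * \<bar>rep_L2 w x\<bar> * \<bar>rep_L2 v x\<bar> \<le> c * (rep_L2 v x)\<^sup>2 + inverse c * (rep_L2 w x)\<^sup>2"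
    proof -
      define q where "q = sqrt c"
      have q: "q > 0" "c = q\<^sup>2" using c by (simp_all add: q_def)
      have "2 * (\<bar>rep_L2 w x\<bar> / q) * (q * \<bar>rep_L2 v x\<bar>) \<le> (\<bar>rep_L2 w x\<bar> / q)\<^sup>2 + (q * \<bar>rep_L2 v x\<bar>)\<^sup>2"
        by (rule sum_squares_bound)
      then show ?thesis using q by (simp add: power_mult_distrib power_divide field_simps)
    qed
    then have "\<bar>a x\<bar> * (2 * \<bar>rep_L2 w x\<bar> * \<bar>rep_L2 v x\<bar>) \<le>
        \<bar>a x\<bar> * (c * (rep_L2 v x)\<^sup>2 + inverse c * (rep_L2 w x)\<^sup>2)"
      by (rule mult_left_mono) simp
    moreover have "- 2 * (a x * rep_L2 w x * rep_L2 v x) \<le> \<bar>a x\<bar> * (2 * \<bar>rep_L2 w x\<bar> * \<bar>rep_L2 v x\<bar>)"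
      using abs_ge_minus_self[of "2 * (a x * rep_L2 w x * rep_L2 v x)"] by (simp add: abs_mult)
    ultimately show "- 2 * (a x * rep_L2 w x * rep_L2 v x) \<le>
        c * (\<bar>a x\<bar> * (rep_L2 v x)\<^sup>2) + inverse c * (\<bar>a x\<bar> * (rep_L2 w x)\<^sup>2)"
      by (simp add: algebra_simps)
  qed (intro Bochner_Integration.integrable_add integrable_mult_right integrable_mult_Linf integrable_weighted_sq a)+
  also have "\<dots> = c * weighted_sq a v + inverse c * weighted_sq a w"
    using integrable_weighted_sq[OF a] by (simp add: weighted_sq_def)
  finally show ?thesis .
qed

text \<open>Since \<open>v''\<close> is the derivative of \<open>v'\<close>, integration by parts gives \<open>\<langle>v'', v\<rangle> = - |v'|\<^sup>2\<close> and
  \<open>\<langle>v''', v\<rangle> = - \<langle>v'', v'\<rangle> = 0\<close>. The potential costs at most \<open>|v'|\<^sup>2\<close> plus a multiple of \<open>|v|\<^sup>2\<close>, so the gradient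
  cancels. What remains is continuous on \<open>L\<^sup>2(\<real>)\<close>, although the operator is not.\<close>

lemma A_op_dissipative:
  assumes p: "1 \<le> p" and lam0: "in_Linf lam0" and lam: "in_Linf lam"
    and b0: "in_Lp p \<beta>0" "AE x in lebesgue. lam0 x \<ge> \<alpha>0 - \<beta>0 x"
    and b: "in_Lp p \<beta>" "AE x in lebesgue. k * \<bar>lam x\<bar> \<le> \<alpha> + \<beta> x"
    and vh: "(v, h) \<in> A_op lam0"
  shows "inner h v \<le> - (k * weighted_sq lam v +
    (\<alpha>0 - \<alpha> - GN_const p (Lp_norm p (\<lambda>x. \<beta> x + \<beta>0 x))) * (norm v)\<^sup>2)"
proof -
  have ex: "\<exists>g. has_weak_deriv j v g" if "j \<le> 3" for j
    using vh that by (simp add: A_op_def sobolev_def)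
  obtain g1 g2 g3 where g: "has_weak_deriv 1 v g1" "has_weak_deriv 2 v g2" "has_weak_deriv 3 v g3"
    using ex[of 1] ex[of 2] ex[of 3] by auto
  have h: "h = - g3 + g2 - mult_L2 lam0 v"
    using vh by (simp add: A_op_def weak_deriv_eq[OF g(2)] weak_deriv_eq[OF g(3)])
  have g12: "has_weak_deriv 1 g1 g2"
    by (rule has_weak_deriv_Suc[OF g(1)]) (use g(2) in \<open>simp add: numeral_2_eq_2\<close>)
  have g23: "has_weak_deriv 1 g2 g3"
    by (rule has_weak_deriv_Suc[OF g(2)]) (use g(3) in \<open>simp add: numeral_3_eq_3 numeral_2_eq_2\<close>)
  have "inner g2 g1 = 0" using H1_parts[OF g12 g12] by (simp add: inner_commute)
  then have "inner g3 v = 0" using H1_parts[OF g23 g(1)] by simp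
  moreover have "inner g2 v = - (norm g1)\<^sup>2" using H1_parts[OF g12 g(1)] by (simp add: power2_norm_eq_inner)
  ultimately have hv: "inner h v = - (norm g1)\<^sup>2 - inner (mult_L2 lam0 v) v"
    by (simp add: h inner_add_left inner_diff_left)
  define r where "r x = \<bar>\<beta> x + \<beta>0 x\<bar> * (rep_L2 v x)\<^sup>2" for x
  note GN = potential_form_bound[OF p in_Lp_add[OF p b(1) b0(1)] g(1)]
  have r: "integrable lebesgue r" using GN(1) by (simp add: r_def[abs_def])
  have vint: "integrable lebesgue (\<lambda>x. (rep_L2 v x)\<^sup>2)" by (simp add: sq_integrable_power2)
  have l0: "integrable lebesgue (\<lambda>x. lam0 x * (rep_L2 v x)\<^sup>2)"
    using integrable_mult_Linf[OF lam0, of v v] by (simp add: power2_eq_square mult.assoc)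
  have "k * weighted_sq lam v - inner (mult_L2 lam0 v) v =
      (LINT x|lebesgue. k * (\<bar>lam x\<bar> * (rep_L2 v x)\<^sup>2) - lam0 x * (rep_L2 v x)\<^sup>2)"
    using integrable_weighted_sq[OF lam, of v] l0
    by (simp add: weighted_sq_def inner_mult_L2[OF lam0] power2_eq_square mult.assoc)
  also have "\<dots> \<le> (LINT x|lebesgue. (\<alpha> - \<alpha>0) * (rep_L2 v x)\<^sup>2 + r x)"
  proof (rule integral_mono_AE)
    show "AE x in lebesgue. k * (\<bar>lam x\<bar> * (rep_L2 v x)\<^sup>2) - lam0 x * (rep_L2 v x)\<^sup>2 \<le> (\<alpha> - \<alpha>0) * (rep_L2 v x)\<^sup>2 + r x"
      using b0(2) b(2)
    proof eventually_elim
      case (elim x)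
      then have "k * \<bar>lam x\<bar> - lam0 x \<le> \<alpha> - \<alpha>0 + \<bar>\<beta> x + \<beta>0 x\<bar>" by linarith
      then have "(k * \<bar>lam x\<bar> - lam0 x) * (rep_L2 v x)\<^sup>2 \<le> (\<alpha> - \<alpha>0 + \<bar>\<beta> x + \<beta>0 x\<bar>) * (rep_L2 v x)\<^sup>2"
        by (rule mult_right_mono) simp
      then show ?case by (simp add: r_def algebra_simps)
    qed
  qed (use integrable_weighted_sq[OF lam, of v] l0 vint r in auto)
  also have "\<dots> = (\<alpha> - \<alpha>0) * (norm v)\<^sup>2 + (LINT x|lebesgue. r x)"
    using vint r by (simp add: norm_L2_power2)
  also have "(LINT x|lebesgue. r x) \<le> (norm g1)\<^sup>2 + GN_const p (Lp_norm p (\<lambda>x. \<beta> x + \<beta>0 x)) * (norm v)\<^sup>2"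
    using GN(2) by (simp add: r_def)
  finally show ?thesis unfolding hv by (simp add: algebra_simps)
qed

text \<open>The nonlinear term does not contribute to the energy balance. Its norm bound, together with
  \<open>u \<in> L\<^sup>2(0,T; H\<^sup>1(\<real>))\<close>, makes it integrable in time with values in \<open>L\<^sup>2(\<real>)\<close>.\<close>

lemma burgers_term:
  assumes "v \<in> sobolev 1"
  shows "inner v (mult_L2 (rep_L2 v) (weak_deriv 1 v)) = 0"
    and "norm (mult_L2 (rep_L2 v) (weak_deriv 1 v)) \<le> (norm (v, weak_deriv 1 v))\<^sup>2"
proof -
  obtain g where g: "has_weak_deriv 1 v g" using assms by (auto simp: sobolev_def)
  have wd: "weak_deriv 1 v = g" by (rule weak_deriv_eq[OF g])
  define N where "N = norm (v, g)"
  have N2: "N\<^sup>2 = (norm v)\<^sup>2 + (norm g)\<^sup>2" by (simp add: N_def norm_prod_def)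
  have bnd: "AE x in lebesgue. \<bar>rep_L2 v x\<bar> \<le> N"
    using H1_sup_bound[OF g]
  proof eventually_elim
    case (elim x)
    have "(rep_L2 v x)\<^sup>2 \<le> N\<^sup>2" using elim sum_squares_bound[of "norm v" "norm g"] by (simp add: N2)
    then show ?case by (simp add: N_def abs_le_square_iff[symmetric])
  qed
  have N: "N \<ge> 0" by (simp add: N_def)
  note sq = sq_integrable_mult_bounded[OF rep_L2_measurable bnd N sq_integrable_rep[of g]]
  have "inner v (mult_L2 (rep_L2 v) g) = (LINT x|lebesgue. rep_L2 v x * (rep_L2 v x * rep_L2 g x))"
    using inner_L2_of[OF sq_integrable_rep sq(1), of v] by (simp add: mult_L2_def L2_of_rep)
  then show "inner v (mult_L2 (rep_L2 v) (weak_deriv 1 v)) = 0"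
    unfolding wd using H1_cubic_zero[OF g] by simp
  have "norm (mult_L2 (rep_L2 v) g) \<le> N * norm g" using sq(2) by (simp add: mult_L2_def L2_of_rep)
  also have "norm g \<le> N" by (simp add: N_def norm_prod_def)
  then have "N * norm g \<le> N * N" by (intro mult_left_mono) (simp_all add: N_def)
  finally show "norm (mult_L2 (rep_L2 v) (weak_deriv 1 v)) \<le> (norm (v, weak_deriv 1 v))\<^sup>2"
    unfolding wd by (simp add: N_def power2_eq_square)
qed


section \<open>Integral inequalities with delay\<close>

text \<open>The inequality bounds \<open>E\<close> at earlier times from below, so it is integrated backwards from \<open>T\<close>:
  \<open>exp (\<gamma> s) (E T + \<gamma> \<integral>\<^sub>s\<^sup>T E)\<close> is nonincreasing in \<open>s\<close>. Integrating forwards from \<open>0\<close> would only bound the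
  integral of \<open>E\<close>, not \<open>E T\<close>.\<close>

lemma backward_gronwall:
  fixes E :: "real \<Rightarrow> real"
  assumes T: "T \<ge> 0" and g: "\<gamma> \<ge> 0" and cont: "continuous_on {0..T} E"
    and decr: "\<And>a. a \<in> {0..T} \<Longrightarrow> E T - E a \<le> - \<gamma> * integral {a..T} E"
  shows "E T \<le> E 0 * exp (- \<gamma> * T)"
proof -
  \<comment> \<open>The integral over \<open>{s..T}\<close>, written so that it can be differentiated in \<open>s\<close>.\<close>
  define J where "J s = integral {0..T} E - integral {0..s} E" for s
  have J: "J s = integral {s..T} E" if "s \<in> {0..T}" for s
    using Henstock_Kurzweil_Integration.integral_combine[of 0 s T E] integrable_continuous_real[OF cont] that
    by (simp add: J_def)
  define G where "G s = exp (\<gamma> * s) * (E T + \<gamma> * J s)" for s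
  have J_deriv: "(J has_vector_derivative (- E s)) (at s within {0..T})" if "s \<in> {0..T}" for s
    unfolding J_def
    using has_vector_derivative_diff[OF has_vector_derivative_const integral_has_vector_derivative[OF cont that]] by simp
  have G_deriv: "(G has_real_derivative \<gamma> * exp (\<gamma> * s) * (E T + \<gamma> * J s - E s)) (at s within {0..T})"
    if "s \<in> {0..T}" for s
    unfolding G_def
    using J_deriv[OF that]
    by (auto intro!: derivative_eq_intros simp: has_real_derivative_iff_has_vector_derivative[symmetric] algebra_simps)
  have "G 0 \<ge> G T"
  proof (rule DERIV_nonpos_imp_decreasing_open[OF T])
    show "continuous_on {0..T} G" by (rule DERIV_continuous_on[OF G_deriv])
    fix s assume s: "0 < s" "s < T"
    then have "(G has_real_derivative \<gamma> * exp (\<gamma> * s) * (E T + \<gamma> * J s - E s)) (at s)"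
      using G_deriv[of s] at_within_Icc_at[of 0 s T] by simp
    moreover have "E T + \<gamma> * J s - E s \<le> 0" using decr[of s] J[of s] s by simp
    then have "\<gamma> * exp (\<gamma> * s) * (E T + \<gamma> * J s - E s) \<le> 0" using g by (intro mult_nonneg_nonpos) auto
    ultimately show "\<exists>y. (G has_real_derivative y) (at s) \<and> y \<le> 0" by blast
  qed
  moreover have "G 0 \<le> E 0" using decr[of 0] J[of 0] T by (simp add: G_def)
  moreover have "G T = exp (\<gamma> * T) * E T" by (simp add: G_def J_def)
  ultimately have "exp (\<gamma> * T) * E T \<le> E 0" by linarith
  then show ?thesis by (simp add: exp_minus field_simps)
qed

definition delay_term :: "real \<Rightarrow> (real \<Rightarrow> real) \<Rightarrow> real \<Rightarrow> real" where
  "delay_term \<tau> L t = integral {t - \<tau>..t} (\<lambda>s. exp (- (t - s)) * L s)"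

lemma delay_term_nonneg:
  assumes "\<And>s. s \<in> {t - \<tau>..t} \<Longrightarrow> L s \<ge> 0"
  shows "delay_term \<tau> L t \<ge> 0"
proof (cases "(\<lambda>s. exp (- (t - s)) * L s) integrable_on {t - \<tau>..t}")
  case True
  then show ?thesis unfolding delay_term_def by (rule integral_nonneg) (use assms in auto)
qed (simp add: delay_term_def not_integrable_integral)

text \<open>Up to the factor \<open>exp (- t)\<close> the term is a difference of two values of a primitive of \<open>exp s * L s\<close>.\<close>

lemma delay_term_derivative:
  assumes \<tau>: "\<tau> > 0" and L: "continuous_on {- \<tau>..T} L" and t: "t \<in> {0..T}"
  shows "(delay_term \<tau> L has_real_derivative L t - exp (- \<tau>) * L (t - \<tau>) - delay_term \<tau> L t) (at t within {0..T})"
proof -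
  define h where "h s = exp s * L s" for s
  have h: "continuous_on {- \<tau>..T} h" unfolding h_def by (intro continuous_intros L)
  define J where "J x = integral {- \<tau>..x} h" for x
  have D: "delay_term \<tau> L s = exp (- s) * (J s - J (s - \<tau>))" if "s \<in> {0..T}" for s
  proof -
    have "h integrable_on {- \<tau>..s}"
      by (rule integrable_continuous_real[OF continuous_on_subset[OF h]]) (use that in auto)
    then have "J s = J (s - \<tau>) + integral {s - \<tau>..s} h"
      unfolding J_def using that \<tau> by (intro Henstock_Kurzweil_Integration.integral_combine[symmetric]) auto
    moreover have "delay_term \<tau> L s = integral {s - \<tau>..s} (\<lambda>r. exp (- s) * h r)"
      unfolding delay_term_def by (rule integral_cong) (simp add: h_def exp_diff exp_minus field_simps)
    ultimately show ?thesis by simp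
  qed
  have J: "(J has_real_derivative h x) (at x within {- \<tau>..T})" if "x \<in> {- \<tau>..T}" for x
    unfolding J_def has_real_derivative_iff_has_vector_derivative
    by (rule integral_has_vector_derivative[OF h that])
  have J1: "(J has_real_derivative h t) (at t within {0..T})"
    by (rule DERIV_subset[OF J]) (use t \<tau> in auto)
  have "(J \<circ> (\<lambda>s. s - \<tau>) has_real_derivative h (t - \<tau>) * 1) (at t within {0..T})"
  proof (rule DERIV_image_chain)
    show "((\<lambda>s. s - \<tau>) has_real_derivative 1) (at t within {0..T})" by (auto intro!: derivative_eq_intros)
    show "(J has_real_derivative h (t - \<tau>)) (at (t - \<tau>) within (\<lambda>s. s - \<tau>) ` {0..T})"
      by (rule DERIV_subset[OF J]) (use t \<tau> in auto)
  qed
  then have J2: "((\<lambda>s. J (s - \<tau>)) has_real_derivative h (t - \<tau>)) (at t within {0..T})"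
    by (simp add: o_def)
  have "((\<lambda>s. exp (- s) * (J s - J (s - \<tau>))) has_real_derivative
      L t - exp (- \<tau>) * L (t - \<tau>) - delay_term \<tau> L t) (at t within {0..T})"
    unfolding D[OF t]
    by (auto intro!: derivative_eq_intros J1 J2 simp: h_def field_simps exp_diff exp_minus)
  then show ?thesis
    by (rule has_field_derivative_transform_within[OF _ zero_less_one t]) (simp add: D)
qed

text \<open>The delay term gains \<open>L t\<close> and loses \<open>exp (- \<tau>) L (t - \<tau>)\<close>, which cancels the corresponding terms in
  the inequality for \<open>y\<close>. The sum then dissipates \<open>2 c y\<close> plus the delay term itself; the latter decays
  only at rate \<open>1\<close>, whence \<open>\<gamma> \<le> 1\<close>.\<close>

lemma delayed_energy_decay:
  assumes \<tau>: "\<tau> > 0" and T: "T \<ge> 0" and gam: "\<gamma> \<ge> 0" "\<gamma> \<le> 1" "\<gamma> \<le> 2 * c"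
    and L: "continuous_on {- \<tau>..T} L" "\<And>s. L s \<ge> 0"
    and y: "continuous_on {0..T} y" "\<And>s. y s \<ge> 0"
    and ineq: "\<And>a. a \<in> {0..T} \<Longrightarrow> y T - y a \<le> integral {a..T} (\<lambda>s. - L s - 2 * c * y s + exp (- \<tau>) * L (s - \<tau>))"
  shows "y T + delay_term \<tau> L T \<le> (y 0 + delay_term \<tau> L 0) * exp (- \<gamma> * T)"
proof -
  define D where "D = delay_term \<tau> L"
  have D_deriv: "(D has_real_derivative L t - exp (- \<tau>) * L (t - \<tau>) - D t) (at t within {0..T})" if "t \<in> {0..T}" for t
    unfolding D_def by (rule delay_term_derivative[OF \<tau> L(1) that])
  have D_cont: "continuous_on {0..T} D" by (rule DERIV_continuous_on[OF D_deriv])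
  have D0: "D t \<ge> 0" for t unfolding D_def by (rule delay_term_nonneg) (rule L(2))
  have Lc: "continuous_on {0..T} L" "continuous_on {0..T} (\<lambda>s. L (s - \<tau>))"
    using \<tau> by (auto intro!: continuous_on_subset[OF L(1)] continuous_on_compose2[OF L(1)] continuous_intros)
  have "(\<lambda>t. y t + D t) T \<le> (\<lambda>t. y t + D t) 0 * exp (- \<gamma> * T)"
  proof (rule backward_gronwall[OF T gam(1)])
    show "continuous_on {0..T} (\<lambda>t. y t + D t)" by (intro continuous_intros y D_cont)
    fix a assume a: "a \<in> {0..T}"
    then have sub: "{a..T} \<subseteq> {0..T}" by auto
    note c = continuous_on_subset[OF Lc(1) sub] continuous_on_subset[OF Lc(2) sub]
      continuous_on_subset[OF y(1) sub] continuous_on_subset[OF D_cont sub]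
    have FTC: "((\<lambda>t. L t - exp (- \<tau>) * L (t - \<tau>) - D t) has_integral D T - D a) {a..T}"
    proof (rule fundamental_theorem_of_calculus)
      show "a \<le> T" using a by simp
      fix t assume "t \<in> {a..T}"
      then show "(D has_vector_derivative L t - exp (- \<tau>) * L (t - \<tau>) - D t) (at t within {a..T})"
        unfolding has_real_derivative_iff_has_vector_derivative[symmetric]
        using sub by (intro DERIV_subset[OF D_deriv sub]) auto
    qed
    have "((\<lambda>s. - L s - 2 * c * y s + exp (- \<tau>) * L (s - \<tau>)) has_integral
        integral {a..T} (\<lambda>s. - L s - 2 * c * y s + exp (- \<tau>) * L (s - \<tau>))) {a..T}"
      by (intro integrable_integral integrable_continuous_real continuous_intros c)
    from has_integral_add[OF this FTC]
    have 1: "((\<lambda>s. - 2 * c * y s - D s) has_integral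
        integral {a..T} (\<lambda>s. - L s - 2 * c * y s + exp (- \<tau>) * L (s - \<tau>)) + (D T - D a)) {a..T}"
      by (rule has_integral_eq[rotated]) simp
    have 2: "((\<lambda>s. - \<gamma> * (y s + D s)) has_integral (- \<gamma> * integral {a..T} (\<lambda>s. y s + D s))) {a..T}"
      by (intro has_integral_mult_right integrable_integral integrable_continuous_real continuous_intros c)
    have "integral {a..T} (\<lambda>s. - L s - 2 * c * y s + exp (- \<tau>) * L (s - \<tau>)) + (D T - D a)
        \<le> - \<gamma> * integral {a..T} (\<lambda>s. y s + D s)"
    proof (rule has_integral_le[OF 1 2])
      fix s
      have "\<gamma> * y s \<le> 2 * c * y s" "\<gamma> * D s \<le> 1 * D s"
        using gam y(2) D0 by (intro mult_right_mono; simp)+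
      then show "- 2 * c * y s - D s \<le> - \<gamma> * (y s + D s)" by (simp add: algebra_simps)
    qed
    then show "y T + D T - (y a + D a) \<le> - \<gamma> * integral {a..T} (\<lambda>t. y t + D t)"
      using ineq[OF a] by linarith
  qed
  then show ?thesis by (simp add: D_def)
qed


section \<open>Decay of the energy\<close>

lemma mild_solution_continuous:
  assumes \<tau>: "\<tau> > 0" and u0: "continuous_on {- \<tau>..0} u0" and T: "T \<ge> 0" and sol: "mild_solution \<tau> lam S u0 T u"
  shows "continuous_on {- \<tau>..T} u"
proof -
  have "continuous_on {- \<tau>..0} u"
    using u0 by (rule continuous_on_eq) (use sol in \<open>simp add: mild_solution_def\<close>)
  moreover have "continuous_on {0..T} u" using sol by (simp add: mild_solution_def space_B_def)
  ultimately have "continuous_on ({- \<tau>..0} \<union> {0..T}) u" by (intro continuous_on_closed_Un) auto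
  moreover have "{- \<tau>..0} \<union> {0..T} = {- \<tau>..T}" using \<tau> T by auto
  ultimately show ?thesis by simp
qed

text \<open>The factor \<open>(exp \<tau> + 1)/2\<close> in the dissipation pays twice: \<open>exp \<tau>\<close> for the part of the delayed
  product that is taken at the present time, and \<open>1\<close> for the amount that enters the delay term.\<close>

lemma mild_solution_energy_inequality:
  assumes S: "C0_semigroup S" and \<tau>: "\<tau> > 0" and lam: "in_Linf lam"
    and gen: "\<And>v h. (v, h) \<in> generator S \<Longrightarrow>
      inner h v \<le> - ((exp \<tau> + 1) / 2 * weighted_sq lam v + c * (norm v)\<^sup>2)"
    and u0: "continuous_on {- \<tau>..0} u0" and sol: "mild_solution \<tau> lam S u0 T u" and a: "a \<in> {0..T}"
  shows "(norm (u T))\<^sup>2 - (norm (u a))\<^sup>2 \<le> integral {a..T}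
    (\<lambda>s. - weighted_sq lam (u s) - 2 * c * (norm (u s))\<^sup>2 + exp (- \<tau>) * weighted_sq lam (u (s - \<tau>)))"
proof (cases "a = T")
  case True
  then show ?thesis by simp
next
  case False
  with a have aT: "0 \<le> a" "a < T" by auto
  note u = mild_solution_continuous[OF \<tau> u0 _ sol]
  have uc: "continuous_on {- \<tau>..T} u" using u aT by simp
  define R where "R = (\<lambda>s. - weighted_sq lam (u s) - 2 * c * (norm (u s))\<^sup>2 + exp (- \<tau>) * weighted_sq lam (u (s - \<tau>)))"
  have R: "continuous_on {a..T} R"
    unfolding R_def
    by (intro continuous_intros continuous_on_compose2[OF weighted_sq_continuous[OF lam, of UNIV]]
        continuous_on_compose2[OF uc]) (use aT \<tau> in auto)
  define Q where "Q v = (exp \<tau> + 1) / 2 * weighted_sq lam v + c * (norm v)\<^sup>2" for v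
  have Q: "continuous_on UNIV Q"
    unfolding Q_def by (intro continuous_intros weighted_sq_continuous lam)
  obtain Cw where Cw: "\<And>v. \<bar>weighted_sq lam v\<bar> \<le> Cw * (norm v)\<^sup>2" by (rule weighted_sq_le[OF lam]) blast
  have Qb: "\<bar>Q v\<bar> \<le> ((exp \<tau> + 1) / 2 * Cw + \<bar>c\<bar>) * (norm v)\<^sup>2" for v
  proof -
    have "\<bar>Q v\<bar> \<le> \<bar>(exp \<tau> + 1) / 2 * weighted_sq lam v\<bar> + \<bar>c * (norm v)\<^sup>2\<bar>"
      unfolding Q_def by (rule abs_triangle_ineq)
    also have "\<dots> = (exp \<tau> + 1) / 2 * \<bar>weighted_sq lam v\<bar> + \<bar>c\<bar> * (norm v)\<^sup>2"
      by (simp add: abs_mult)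
    also have "\<dots> \<le> (exp \<tau> + 1) / 2 * (Cw * (norm v)\<^sup>2) + \<bar>c\<bar> * (norm v)\<^sup>2"
      by (intro add_right_mono mult_left_mono Cw) (simp add: add_nonneg_nonneg)
    finally show ?thesis by (simp only: distrib_right mult.assoc)
  qed
  define w where "w s = mult_L2 (rep_L2 (u s)) (weak_deriv 1 (u s))" for s
  define f where "f s = - mult_L2 lam (u (s - \<tau>)) - w s" for s
  have lin: "bounded_linear (S t)" if "t \<ge> 0" for t using C0_semigroupD(1)[OF S that] .
  have f_eq: "S (t - s) (f s) = - S (t - s) (mult_L2 lam (u (s - \<tau>))) - S (t - s) (w s)" if "s \<in> {0..t}" for t s
    using lin[of "t - s"] that by (simp add: f_def linear_simps)
  have int1: "set_integrable lebesgue {0..t} (\<lambda>s. S (t - s) (mult_L2 lam (u (s - \<tau>))))"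
    and int2: "set_integrable lebesgue {0..t} (\<lambda>s. S (t - s) (w s))"
    and mild: "u t = S t (u0 0) - (LINT s:{0..t}|lebesgue. S (t - s) (mult_L2 lam (u (s - \<tau>))))
      - (LINT s:{0..t}|lebesgue. S (t - s) (w s))" if "t \<in> {0..T}" for t
    using sol that by (auto simp: mild_solution_def w_def)
  have int1': "set_integrable lebesgue {0..t} (\<lambda>s. - S (t - s) (mult_L2 lam (u (s - \<tau>))))" if "t \<in> {0..T}" for t
    using int1[OF that] by (simp add: set_integrable_def)
  have intf: "set_integrable lebesgue {0..t} (\<lambda>s. S (t - s) (f s))" if "t \<in> {0..T}" for t
    by (subst set_integrable_cong[OF refl refl f_eq])
      (auto intro: set_integral_diff(1)[OF int1'[OF that] int2[OF that]])
  have mildf: "u t = S t (u0 0) + (LINT s:{0..t}|lebesgue. S (t - s) (f s))" if "t \<in> {0..T}" for t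
  proof -
    have "(LINT s:{0..t}|lebesgue. S (t - s) (f s)) =
        (LINT s:{0..t}|lebesgue. - S (t - s) (mult_L2 lam (u (s - \<tau>))) - S (t - s) (w s))"
      by (rule set_lebesgue_integral_cong) (auto simp: f_eq)
    also have "\<dots> = (LINT s:{0..t}|lebesgue. - S (t - s) (mult_L2 lam (u (s - \<tau>)))) - (LINT s:{0..t}|lebesgue. S (t - s) (w s))"
      by (rule set_integral_diff(2)[OF int1'[OF that] int2[OF that]])
    also have "(LINT s:{0..t}|lebesgue. - S (t - s) (mult_L2 lam (u (s - \<tau>)))) =
        - (LINT s:{0..t}|lebesgue. S (t - s) (mult_L2 lam (u (s - \<tau>))))"
      by (simp add: set_lebesgue_integral_def)
    finally show ?thesis using mild[OF that] by simp
  qed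
  have uB: "u \<in> space_B T" using sol by (simp add: mild_solution_def)
  then have "AE s in lebesgue_on {0..T}. u s \<in> sobolev 1" by (simp add: space_B_def)
  then have sob: "AE s in lebesgue. s \<in> {0..T} \<longrightarrow> u s \<in> sobolev 1"
    by (subst (asm) AE_restrict_space_iff) auto
  have H1: "set_integrable lebesgue {0..T} (\<lambda>s. (norm (u s, weak_deriv 1 (u s)))\<^sup>2)"
    using uB by (simp add: space_B_def set_integrable_def integrable_restrict_space)
  obtain B where B: "\<And>s. s \<in> {- \<tau>..T} \<Longrightarrow> norm (u s) \<le> B"
    using compact_imp_bounded[OF compact_continuous_image[OF uc compact_Icc]] unfolding bounded_iff by blast
  obtain C where C: "C > 0" "\<And>v. norm (mult_L2 lam v) \<le> norm v * C"
    using bounded_linear.pos_bounded[OF bounded_linear_mult_L2[OF lam]] by blast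
  have g: "set_integrable lebesgue {0..T} (\<lambda>s. B * C + (norm (u s, weak_deriv 1 (u s)))\<^sup>2)"
    by (intro set_integral_add(1) H1 set_lebesgue_integral_continuous(1) continuous_on_const)
  have fg: "AE s in lebesgue. s \<in> {0..T} \<longrightarrow> norm (f s) \<le> B * C + (norm (u s, weak_deriv 1 (u s)))\<^sup>2"
    using sob
  proof eventually_elim
    case (elim s)
    show ?case
    proof
      assume s: "s \<in> {0..T}"
      have "norm (f s) \<le> norm (mult_L2 lam (u (s - \<tau>))) + norm (w s)"
        unfolding f_def using norm_triangle_ineq4[of "- mult_L2 lam (u (s - \<tau>))" "w s"] by simp
      also have "norm (mult_L2 lam (u (s - \<tau>))) \<le> B * C"
        by (rule order_trans[OF C(2) mult_right_mono[OF B]]) (use s \<tau> C(1) in auto)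
      also have "norm (w s) \<le> (norm (u s, weak_deriv 1 (u s)))\<^sup>2"
        unfolding w_def by (rule burgers_term(2)) (use elim s in blast)
      finally show "norm (f s) \<le> B * C + (norm (u s, weak_deriv 1 (u s)))\<^sup>2" by simp
    qed
  qed
  note en = mild_energy_inequality[OF S gen[folded Q_def] Q Qb continuous_on_subset[OF uc] intf mildf g fg aT order_refl]
  have "(norm (u T))\<^sup>2 - (norm (u a))\<^sup>2 \<le> (LINT s:{a..T}|lebesgue. - 2 * Q (u s) + 2 * inner (u s) (f s))"
    by (rule en(2)) (use \<tau> in auto)
  also have "\<dots> \<le> (LINT s:{a..T}|lebesgue. R s)"
  proof (rule set_integral_mono_AE)
    show "set_integrable lebesgue {a..T} (\<lambda>s. - 2 * Q (u s) + 2 * inner (u s) (f s))"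
      by (rule en(1)) (use \<tau> in auto)
    show "set_integrable lebesgue {a..T} R" by (rule set_lebesgue_integral_continuous(1)[OF R])
    show "AE s\<in>{a..T} in lebesgue. - 2 * Q (u s) + 2 * inner (u s) (f s) \<le> R s"
      using sob
    proof eventually_elim
      case (elim s)
      show ?case
      proof
        assume s: "s \<in> {a..T}"
        have "inner (u s) (w s) = 0" unfolding w_def by (rule burgers_term(1)) (use elim s aT in auto)
        then have "2 * inner (u s) (f s) = - 2 * inner (u s) (mult_L2 lam (u (s - \<tau>)))"
          by (simp add: f_def inner_diff_right)
        also have "\<dots> \<le> exp \<tau> * weighted_sq lam (u s) + exp (- \<tau>) * weighted_sq lam (u (s - \<tau>))"
          using weighted_young[OF lam exp_gt_zero, of "u s" "u (s - \<tau>)" \<tau>] by (simp add: exp_minus)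
        finally show "- 2 * Q (u s) + 2 * inner (u s) (f s) \<le> R s"
          by (simp add: Q_def R_def field_simps)
      qed
    qed
  qed
  also have "\<dots> = integral {a..T} R" by (rule set_lebesgue_integral_continuous(2)[OF R])
  finally show ?thesis by (simp only: R_def)
qed

lemma energy_eq:
  assumes lam: "in_Linf lam" and u: "continuous_on {t - \<tau>..t} u"
  shows "energy \<tau> lam u t = 1 / 2 * ((norm (u t))\<^sup>2 + delay_term \<tau> (\<lambda>s. weighted_sq lam (u s)) t)"
proof -
  have "(LINT x|lebesgue. exp (- (t - s)) * \<bar>lam x\<bar> * (rep_L2 (u s) x)\<^sup>2) = exp (- (t - s)) * weighted_sq lam (u s)" for s
    by (simp add: weighted_sq_def mult.assoc)
  moreover have "continuous_on {t - \<tau>..t} (\<lambda>s. exp (- (t - s)) * weighted_sq lam (u s))"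
    by (intro continuous_intros continuous_on_compose2[OF weighted_sq_continuous[OF lam, of UNIV] u]) auto
  ultimately show ?thesis
    by (simp add: energy_def delay_term_def set_lebesgue_integral_continuous(2) norm_L2_power2)
qed

lemma energy_decay:
  assumes S: "C0_semigroup S" and \<tau>: "\<tau> > 0" and lam: "in_Linf lam"
    and gen: "\<And>v h. (v, h) \<in> generator S \<Longrightarrow>
      inner h v \<le> - ((exp \<tau> + 1) / 2 * weighted_sq lam v + c * (norm v)\<^sup>2)" and c: "c \<ge> 0"
    and u0: "continuous_on {- \<tau>..0} u0" and sol: "global_mild_solution \<tau> lam S u0 u" and t: "t \<ge> 0"
  shows "energy \<tau> lam u t \<le> energy \<tau> lam u 0 * exp (- min (2 * c) 1 * t)"
proof (cases "t = 0")
  case False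
  with t have sol: "mild_solution \<tau> lam S u0 t u" using sol by (simp add: global_mild_solution_def)
  have u: "continuous_on {- \<tau>..t} u" by (rule mild_solution_continuous[OF \<tau> u0 t sol])
  define L where "L s = weighted_sq lam (u s)" for s
  have decay: "(norm (u t))\<^sup>2 + delay_term \<tau> L t \<le> ((norm (u 0))\<^sup>2 + delay_term \<tau> L 0) * exp (- min (2 * c) 1 * t)"
  proof (rule delayed_energy_decay[OF \<tau> t, where c = c])
    show "continuous_on {- \<tau>..t} L"
      unfolding L_def by (rule continuous_on_compose2[OF weighted_sq_continuous[OF lam, of UNIV] u]) auto
    show "continuous_on {0..t} (\<lambda>t. (norm (u t))\<^sup>2)"
      using \<tau> by (intro continuous_intros continuous_on_subset[OF u]) auto
    show "(norm (u t))\<^sup>2 - (norm (u a))\<^sup>2 \<le> integral {a..t} (\<lambda>s. - L s - 2 * c * (norm (u s))\<^sup>2 + exp (- \<tau>) * L (s - \<tau>))"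
      if "a \<in> {0..t}" for a
      unfolding L_def by (rule mild_solution_energy_inequality[OF S \<tau> lam gen u0 sol that])
  qed (use c in \<open>auto simp: L_def weighted_sq_nonneg\<close>)
  have en: "energy \<tau> lam u s = 1 / 2 * ((norm (u s))\<^sup>2 + delay_term \<tau> L s)" if "s \<in> {0..t}" for s
    unfolding L_def by (rule energy_eq[OF lam continuous_on_subset[OF u]]) (use that in auto)
  have eqs: "energy \<tau> lam u t = 1 / 2 * ((norm (u t))\<^sup>2 + delay_term \<tau> L t)"
    "energy \<tau> lam u 0 = 1 / 2 * ((norm (u 0))\<^sup>2 + delay_term \<tau> L 0)"
    using en t by simp_all
  show ?thesis unfolding eqs mult.assoc by (rule mult_left_mono[OF decay]) simp
qed simp

theorem theorem4p3:
  fixes \<tau> p \<alpha>0 \<alpha> :: real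
    and lam0 lam \<beta>0 \<beta> :: "real \<Rightarrow> real"
    and S :: "real \<Rightarrow> L2 \<Rightarrow> L2"
  assumes "\<tau> > 0" and "1 \<le> p"
    and "in_Linf lam0" and "in_Linf lam"
    and "C0_semigroup S" and "generator S = A_op lam0"
    and "\<alpha>0 > 0" and "in_Lp p \<beta>0"
    and "AE x in lebesgue. lam0 x \<ge> \<alpha>0 - \<beta>0 x"
    and "Lp_norm p \<beta>0 < (\<alpha>0 / c_const p) powr (1 - 1 / (2 * p))"
    and "\<alpha> > 0" and "in_Lp p \<beta>"
    and "AE x in lebesgue. (exp \<tau> + 1) / 2 * \<bar>lam x\<bar> \<le> \<alpha> + \<beta> x"
    and "0 \<le> \<alpha>" and "\<alpha> < \<alpha>0"
    and "Lp_norm p (\<lambda>x. \<beta>0 x + \<beta> x) < ((\<alpha>0 - \<alpha>) / c_const p) powr (1 - 1 / (2 * p))"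
  shows "exponentially_stable \<tau> lam S \<and>
    (\<forall>u0 u. continuous_on {- \<tau>..0} u0 \<longrightarrow> global_mild_solution \<tau> lam S u0 u \<longrightarrow>
      (let \<gamma> = min (2 * (\<alpha>0 - \<alpha> - (2 * p - 1) / (2 * p) * (2 / p) powr (1 / (2 * p - 1)) *
                 Lp_norm p (\<lambda>x. \<beta> x + \<beta>0 x) powr (2 * p / (2 * p - 1)))) 1;
           C = 1 / 2 * (LINT x|lebesgue. (rep_L2 (u0 0) x)\<^sup>2) +
               1 / 2 * (LINT s:{- \<tau>..0}|lebesgue.
                 exp s * (LINT x|lebesgue. \<bar>lam x\<bar> * (rep_L2 (u0 s) x)\<^sup>2))
       in C = energy \<tau> lam u 0 \<and> (\<forall>t\<ge>0. energy \<tau> lam u t \<le> C * exp (- \<gamma> * t))))"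
proof -
  define c where "c = \<alpha>0 - \<alpha> - GN_const p (Lp_norm p (\<lambda>x. \<beta> x + \<beta>0 x))"
  define C where "C u0 = 1 / 2 * (LINT x|lebesgue. (rep_L2 (u0 0) x)\<^sup>2) +
    1 / 2 * (LINT s:{- \<tau>..0}|lebesgue. exp s * (LINT x|lebesgue. \<bar>lam x\<bar> * (rep_L2 (u0 s) x)\<^sup>2))" for u0
  have "GN_const p (Lp_norm p (\<lambda>x. \<beta> x + \<beta>0 x)) < \<alpha>0 - \<alpha>"
    using assms(2,15,16) by (intro GN_const_less) (auto simp: Lp_norm_def add.commute)
  then have c: "c > 0" by (simp add: c_def)
  have gen: "inner h v \<le> - ((exp \<tau> + 1) / 2 * weighted_sq lam v + c * (norm v)\<^sup>2)" if "(v, h) \<in> generator S" for v h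
    unfolding c_def using that assms(6) by (intro A_op_dissipative[OF assms(2,3,4,8,9,12,13)]) simp
  have C_eq: "C u0 = energy \<tau> lam u 0" if sol: "global_mild_solution \<tau> lam S u0 u" for u0 u
  proof -
    have u: "u s = u0 s" if "s \<in> {- \<tau>..0}" for s
      using sol that by (auto simp: global_mild_solution_def mild_solution_def dest: spec[of _ 1])
    have "(LINT s:{- \<tau>..0}|lebesgue. exp s * (LINT x|lebesgue. \<bar>lam x\<bar> * (rep_L2 (u0 s) x)\<^sup>2)) =
        (LINT s:{0 - \<tau>..0}|lebesgue. LINT x|lebesgue. exp (- (0 - s)) * \<bar>lam x\<bar> * (rep_L2 (u s) x)\<^sup>2)"
      unfolding diff_0 by (rule set_lebesgue_integral_cong) (auto simp: u mult.assoc)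
    then show ?thesis using u[of 0] assms(1) by (simp add: C_def energy_def)
  qed
  have decay: "energy \<tau> lam u t \<le> C u0 * exp (- min (2 * c) 1 * t)"
    if "continuous_on {- \<tau>..0} u0" "global_mild_solution \<tau> lam S u0 u" "t \<ge> 0" for u0 u t
    unfolding C_eq[OF that(2)]
    by (rule energy_decay[OF assms(5,1,4) gen less_imp_le[OF c] that])
  have "exponentially_stable \<tau> lam S"
    unfolding exponentially_stable_def
  proof (rule exI[of _ "min (2 * c) 1"], intro conjI allI impI)
    show "min (2 * c) 1 > 0" using c by simp
    fix u0 :: "real \<Rightarrow> L2" assume "continuous_on {- \<tau>..0} u0"
    then show "\<exists>C. \<forall>u. global_mild_solution \<tau> lam S u0 u \<longrightarrow>
        (\<forall>t\<ge>0. energy \<tau> lam u t \<le> C * exp (- min (2 * c) 1 * t))"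
      using decay by blast
  qed
  then show ?thesis
    using C_eq decay unfolding c_def C_def GN_const_def Let_def by blast
qed

end
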